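(* Let $\alpha^{(0)},\beta^{(0)}\in\mathbb{C}$ be fixed and let $(x_n)_{n\in\mathbb{Z}}$ be a solution, with all $x_n\neq0$, of the Somos-5 recurrence $x_nx_{n+5}=\alpha^{(0)}x_{n+1}x_{n+4}+\beta^{(0)}x_{n+2}x_{n+3}$, given by the analytic formula in the context with parameters $A_+,A_-,B_-,z_0^{(0)},J^{(0)}$ and associated quantities $\kappa^{(0)},g_2^{(0)},g_3^{(0)}$. Then the Somos-5 shadow equation $$x_ny_{n+5}+y_nx_{n+5}-\alpha^{(0)}\left(x_{n+1}y_{n+4}+y_{n+1}x_{n+4}\right)-\beta^{(0)}\left(x_{n+2}y_{n+3}+y_{n+2}x_{n+3}\right)=0$$ for the unknown sequence $(y_n)$ has $5$ linearly independent solutions, which can be chosen as follows: $$y_n^{(i)}=\begin{cases}0,& n\text{ odd}\\ x_n,& n\text{ even}\end{cases},\qquad y_n^{(ii)}=\begin{cases}x_n,& n\text{ odd}\\ 0,& n\text{ even}\end{cases},\qquad y_n^{(iii)}=n\,x_n,$$ $$y_n^{(iv)}=\zeta\big(z_0^{(0)}+n\kappa^{(0)}\big)\,x_n,$$ $$y_n^{(v)}=x_n\,\partial_{J^{(0)}}\log x_n=x_n\left(\frac{\mathrm{d}\kappa^{(0)}}{\mathrm{d}J^{(0)}}\partial_{\kappa^{(0)}}+\frac{\mathrm{d}g_2^{(0)}}{\mathrm{d}J^{(0)}}\partial_{g_2^{(0)}}+\frac{\mathrm{d}g_3^{(0)}}{\mathrm{d}J^{(0)}}\partial_{g_3^{(0)}}\right)\log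 x_n .$$
   Context: Analytic form of Somos-5 solutions (superscripts $(0)$ omitted). For $\alpha,\beta\in\mathbb{C}$ and $J\in\mathbb{C}$ with $\beta+\alpha J\neq0$, put $$\tilde\mu=(\beta+\alpha J)^{1/4},\quad \tilde\lambda=\frac{1}{3\tilde\mu^2}\left(\frac{J^2}{4}+\alpha\right),\quad g_2=12\tilde\lambda^2-2J,\quad g_3=4\tilde\lambda^3-g_2\tilde\lambda-\tilde\mu^2$$ (with a fixed branch of the fourth root, analytic near the given $J$). Assume that $\mathrm{y}^2=4\mathrm{x}^3-g_2\mathrm{x}-g_3$ is nonsingular (an elliptic curve) and let $\sigma(z)=\sigma(z;g_2,g_3)$, $\zeta(z)=\zeta(z;g_2,g_3)=\sigma'(z)/\sigma(z)$, $\wp=-\zeta'$ be its Weierstrass functions. Choose $\kappa$, depending analytically on $J$ locally, with $\wp(\kappa)=\tilde\lambda$, $\wp'(\kappa)=\tilde\mu$, and put $\mu=\tilde\mu/\sigma(2\kappa)=-\sigma(\kappa)^{-4}$. For arbitrary $A_+,A_-,B_-\in\mathbb{C}^*$ and $z_0\in\mathbb{C}$, with $B_+=-\mu^{-1}B_-=\sigma(\kappa)^4B_-$, the Somos-5 solution is $$x_n=A_{\pm}B_{\pm}^{\lfloor n/2\rfloor}\mu^{\lfloor n/2\rfloor^2}\sigma(n\kappa+z_0),$$ with subscript $+$ for even $n$ and $-$ for odd $n$. The constant $J$ is the value of the Somos-5 first integral $$J=\frac{x_n^2x_{n+3}^2x_{n+4}+x_nx_{n+1}^2x_{n+4}^2+\alpha(x_{n+1}^2x_{n+2}^2x_{n+4}+x_nx_{n+2}^2x_{n+3}^2)+\beta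 x_{n+1}x_{n+2}^3x_{n+3}}{x_nx_{n+1}x_{n+2}x_{n+3}x_{n+4}}.$$ All $x_n\ne0$ means that $z_0+n\kappa$ is never a period. In $y_n^{(v)}$, $\alpha,\beta$ and $A_+,A_-,B_-,z_0$ are held fixed, $B_+$ is replaced by $\sigma(\kappa)^4B_-$ (so it varies with $\kappa,g_2,g_3$), and $\kappa,g_2,g_3$ are regarded as functions of $J$. The parameters of the given solution are the quantities with superscript $(0)$. *)

theory Defs
  imports "HOL-Complex_Analysis.Complex_Analysis" "HOL-Library.Function_Algebras"
begin

section \<open>Weierstrass functions with given invariants\<close>

definition is_lattice :: "complex set \<Rightarrow> bool" where
  "is_lattice L \<longleftrightarrow>
     (\<exists>w1 w2. Im (w2 / w1) \<noteq> 0 \<and> L = {of_int m * w1 + of_int n * w2 | m n :: int. True})"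

definition lattice_g2 :: "complex set \<Rightarrow> complex" where
  "lattice_g2 L = 60 * (\<Sum>\<^sub>\<infinity>w\<in>L - {0}. 1 / w ^ 4)"

definition lattice_g3 :: "complex set \<Rightarrow> complex" where
  "lattice_g3 L = 140 * (\<Sum>\<^sub>\<infinity>w\<in>L - {0}. 1 / w ^ 6)"

text \<open>The unconditional infinite product is the limit of the products over finite subsets
  of the nonzero periods, in the same way as \<^const>\<open>infsum\<close> is defined for sums.\<close>

definition lattice_sigma :: "complex set \<Rightarrow> complex \<Rightarrow> complex" where
  "lattice_sigma L z = z * Lim (finite_subsets_at_top (L - {0}))
     (\<lambda>F. \<Prod>w\<in>F. (1 - z / w) * exp (z / w + z\<^sup>2 / (2 * w\<^sup>2)))"

text \<open>The affine curve \<open>y\<^sup>2 = 4 x\<^sup>3 - g2 x - g3\<close> has no point at which both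
  partial derivatives of its equation vanish (its point at infinity is always smooth).\<close>

definition nonsingular_cubic :: "complex \<Rightarrow> complex \<Rightarrow> bool" where
  "nonsingular_cubic g2 g3 \<longleftrightarrow>
     \<not> (\<exists>x y. y\<^sup>2 = 4 * x ^ 3 - g2 * x - g3 \<and> 2 * y = 0 \<and> 12 * x\<^sup>2 - g2 = 0)"

text \<open>For a nonsingular cubic there is exactly one lattice with these invariants, so the
  choice is immaterial; it is arbitrary for singular cubics.\<close>

definition period_lattice :: "complex \<Rightarrow> complex \<Rightarrow> complex set" where
  "period_lattice g2 g3 = (SOME L. is_lattice L \<and> lattice_g2 L = g2 \<and> lattice_g3 L = g3)"

definition wsigma :: "complex \<Rightarrow> complex \<Rightarrow> complex \<Rightarrow> complex" where
  "wsigma g2 g3 z = lattice_sigma (period_lattice g2 g3) z"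

definition wzeta :: "complex \<Rightarrow> complex \<Rightarrow> complex \<Rightarrow> complex" where
  "wzeta g2 g3 z = deriv (wsigma g2 g3) z / wsigma g2 g3 z"

text \<open>The values of \<open>wzeta\<close> and \<open>wp\<close> at the periods (their poles) carry no meaning.\<close>

definition wp :: "complex \<Rightarrow> complex \<Rightarrow> complex \<Rightarrow> complex" where
  "wp g2 g3 z = - deriv (wzeta g2 g3) z"

section \<open>Somos-5 and its shadow\<close>

definition somos5 :: "complex \<Rightarrow> complex \<Rightarrow> (int \<Rightarrow> complex) \<Rightarrow> bool" where
  "somos5 \<alpha> \<beta> x \<longleftrightarrow>
     (\<forall>n. x n * x (n + 5) = \<alpha> * x (n + 1) * x (n + 4) + \<beta> * x (n + 2) * x (n + 3))"

definition somos5_shadow ::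
    "complex \<Rightarrow> complex \<Rightarrow> (int \<Rightarrow> complex) \<Rightarrow> (int \<Rightarrow> complex) \<Rightarrow> bool" where
  "somos5_shadow \<alpha> \<beta> x y \<longleftrightarrow>
     (\<forall>n. x n * y (n + 5) + y n * x (n + 5)
          - \<alpha> * (x (n + 1) * y (n + 4) + y (n + 1) * x (n + 4))
          - \<beta> * (x (n + 2) * y (n + 3) + y (n + 2) * x (n + 3)) = 0)"

text \<open>In the next three definitions \<open>mut\<close> is the chosen branch of
  \<open>J \<mapsto> (\<beta> + \<alpha> J)\<^bsup>1/4\<^esup>\<close>.\<close>

definition somos5_lambda :: "complex \<Rightarrow> (complex \<Rightarrow> complex) \<Rightarrow> complex \<Rightarrow> complex" where
  "somos5_lambda \<alpha> mut J = 1 / (3 * (mut J)\<^sup>2) * (J\<^sup>2 / 4 + \<alpha>)"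

definition somos5_g2 :: "complex \<Rightarrow> (complex \<Rightarrow> complex) \<Rightarrow> complex \<Rightarrow> complex" where
  "somos5_g2 \<alpha> mut J = 12 * (somos5_lambda \<alpha> mut J)\<^sup>2 - 2 * J"

definition somos5_g3 :: "complex \<Rightarrow> (complex \<Rightarrow> complex) \<Rightarrow> complex \<Rightarrow> complex" where
  "somos5_g3 \<alpha> mut J =
     4 * somos5_lambda \<alpha> mut J ^ 3 - somos5_g2 \<alpha> mut J * somos5_lambda \<alpha> mut J - (mut J)\<^sup>2"

text \<open>The analytic Somos-5 solution as a function of \<open>\<kappa>, g2, g3\<close>. Both
  \<open>\<mu> = - \<sigma>(\<kappa>)\<^bsup>-4\<^esup>\<close> (which equals \<open>\<wp>'(\<kappa>) / \<sigma>(2\<kappa>)\<close>) and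
  \<open>B\<^sub>+ = - B\<^sub>- / \<mu> = \<sigma>(\<kappa>)\<^sup>4 B\<^sub>-\<close> vary with \<open>\<kappa>, g2, g3\<close>.
  The operation \<open>div\<close> on \<^typ>\<open>int\<close> rounds down.\<close>

definition somos5_sol ::
    "complex \<Rightarrow> complex \<Rightarrow> complex \<Rightarrow> complex \<Rightarrow> int \<Rightarrow> complex \<Rightarrow> complex \<Rightarrow> complex \<Rightarrow> complex" where
  "somos5_sol Ap Am Bm z0 n \<kappa> g2 g3 =
     (let \<mu> = - 1 / wsigma g2 g3 \<kappa> ^ 4;
          Bp = wsigma g2 g3 \<kappa> ^ 4 * Bm
      in (if even n then Ap * Bp powi (n div 2) else Am * Bm powi (n div 2))
         * \<mu> powi ((n div 2)\<^sup>2) * wsigma g2 g3 (of_int n * \<kappa> + z0))"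

text \<open>The derivative of \<open>log f\<close>, independent of the branch of the logarithm.\<close>

definition log_deriv :: "(complex \<Rightarrow> complex) \<Rightarrow> complex \<Rightarrow> complex" where
  "log_deriv f a = deriv f a / f a"

definition lin_indep_seqs :: "(int \<Rightarrow> complex) list \<Rightarrow> bool" where
  "lin_indep_seqs ys \<longleftrightarrow>
     distinct ys \<and> \<not> module.dependent (\<lambda>(c :: complex) y n. c * y n) (set ys)"

end

theory Submission
  imports Defs "HOL-Real_Asymp.Real_Asymp"
begin

text \<open>Put \<open>D(z) = \<wp>(z) - \<wp>(\<kappa>)\<close> and \<open>u\<^sub>n = z\<^sub>0 + n \<kappa>\<close>. By the addition formula of \<open>\<sigma>\<close>, the ratio
  \<open>x\<^sub>n x\<^bsub>n+3\<^esub> / (x\<^bsub>n+1\<^esub> x\<^bsub>n+2\<^esub>)\<close> equals \<open>D(u\<^bsub>n+1\<^esub>) D(u\<^bsub>n+2\<^esub>)\<close>, and the addition formulas of \<open>\<sigma>\<close> and \<open>\<wp>\<close> then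
  yield both the recurrence and the value \<open>J\<close> of the first integral, for all nearby \<open>z\<^sub>0\<close> and \<open>J\<close>.
  Differentiating the recurrence in \<open>z\<^sub>0\<close> and in \<open>J\<close> gives the last two shadows.

  For the independence, the derivative of the first integral annihilates the first four solutions but
  not the fifth. A relation among the first four involving \<open>\<zeta>\<close> would make \<open>\<zeta>(u\<^sub>n + \<kappa>) - \<zeta>(u\<^sub>n - \<kappa>)\<close> independent
  of \<open>n\<close>, hence \<open>\<wp>(u\<^sub>n)\<close> too; then \<open>u\<^sub>n + u\<^bsub>n+1\<^esub>\<close> is a period for all \<open>n\<close>, and so is \<open>2 \<kappa>\<close>,
  contradicting \<open>\<wp>'(\<kappa>) \<noteq> 0\<close>.

  A nonsingular cubic has a period lattice because the image of the modular function \<open>j\<close> on the upper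
  half plane is open and closed. Near the origin \<open>\<sigma>(z; g\<^sub>2, g\<^sub>3)\<close> is jointly differentiable since the Laurent
  coefficients of \<open>\<wp>\<close> are polynomials in \<open>g\<^sub>2, g\<^sub>3\<close> of geometric growth; the duplication formulas carry
  this to all \<open>z\<close> off the lattice.\<close>

section \<open>Lattices in the complex plane\<close>

text \<open>\<open>period_lattice\<close> is an arbitrary choice, so the dependence of
  \<open>wsigma\<close> on the invariants cannot be read off the lattice. Near 0, however, the
  second-order differential equation determines every Laurent coefficient of wp from the invariants,
  on a disc whose radius depends only on a bound for them. The duplication formulas for sigma, wp
  and wp' form a closed algebraic system, so differentiability at z/2 passes to z without following
  the moving periods.

  The image of j is closed because every lattice has a basis with ratio in a half strip, where j
  tends to infinity. This requires the discriminant to vanish in the limit, which is why zeta(4) and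
  zeta(6) are computed.

  The ratios q_n = x_n x_{n+3} / (x_{n+1} x_{n+2}) are the natural coordinates: the first integral
  is J = q_n + q_{n+1} + \<alpha> (1/q_n + 1/q_{n+1}) + \<beta> / (q_n q_{n+1}). They are unchanged
  when the even terms, the odd terms, or all terms through c^n are rescaled, so the first three
  shadows leave J fixed. Varying \<open>z0\<close> leaves it fixed too, and only the fifth shadow
  changes it.\<close>

lemma summable_on_int:
  fixes u :: "int \<Rightarrow> real"
  assumes "summable (\<lambda>n. u (int n))" "summable (\<lambda>n. u (- int n))" "\<And>m. u m \<ge> 0"
  shows "u summable_on UNIV"
proof -
  have 1: "(u \<circ> int) summable_on UNIV" "(u \<circ> (\<lambda>n. - int n)) summable_on UNIV"
    using assms by (auto intro!: summable_nonneg_imp_summable_on simp: o_def)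
  have "u summable_on (range int)" "u summable_on (range (\<lambda>n. - int n))"
    using 1 by (subst summable_on_reindex; force simp: inj_on_def)+
  then have "u summable_on (range int \<union> range (\<lambda>n. - int n))"
    by (rule summable_on_union)
  also have "range int \<union> range (\<lambda>n. - int n) = UNIV"
    by (auto simp: image_iff) (metis int_cases2)
  finally show ?thesis .
qed

text \<open>With k the maximum, both 1 + |m| and 1 + |n| are at most 2k. So 1/k^3 is at most 8 times
  a product of one-variable terms with exponent -3/2, and the double sum factorises into two
  convergent ones. The 8 is (2k)^3 / k^3.\<close>

lemma summable_on_max_cubed:
  "(\<lambda>(m, n). 1 / real_of_int (max \<bar>m\<bar> \<bar>n\<bar>) ^ 3) summable_on (UNIV - {(0::int, 0::int)})"
proof -
  define u where "u = (\<lambda>m::int. (1 + \<bar>real_of_int m\<bar>) powr (-3/2))"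
  have u0: "u m > 0" for m by (auto simp: u_def intro!: powr_gt_zero[THEN iffD2])
  have su: "summable (\<lambda>n. (1 + real n) powr (-3/2))"
    using summable_real_powr_iff[of "-3/2"] summable_iff_shift[of "\<lambda>n. real n powr (-3/2)" 1]
    by (simp add: add.commute)
  have u: "u summable_on UNIV"
    by (rule summable_on_int) (use su u0 in \<open>auto simp: u_def\<close>)
  have prod: "(\<lambda>p. norm (case p of (m, n) \<Rightarrow> u m * u n)) summable_on Sigma UNIV (\<lambda>_. UNIV)"
    unfolding Infinite_Sum.abs_summable_on_Sigma_iff using u0 u
    by (auto simp: abs_mult infsum_cmult_right' intro!: summable_on_cmult_right summable_on_cmult_left)
       (auto simp: summable_on_cmult_left less_imp_le abs_of_pos)
  have le: "1 / real_of_int (max \<bar>m\<bar> \<bar>n\<bar>) ^ 3 \<le> 8 * (u m * u n)" if "(m,n) \<noteq> (0,0)" for m n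
  proof -
    define k where "k = real_of_int (max \<bar>m\<bar> \<bar>n\<bar>)"
    have k: "k \<ge> 1" "\<bar>real_of_int m\<bar> \<le> k" "\<bar>real_of_int n\<bar> \<le> k"
      using that by (auto simp: k_def max_def)
    have "k ^ 3 = k powr 3" using k by (simp add: powr_numeral)
    also have "\<dots> = k powr (3/2) * k powr (3/2)" using k by (simp flip: powr_add)
    finally have k3: "k^3 = k powr (3/2) * k powr (3/2)" .
    have ge: "u j \<ge> (2*k) powr (-3/2)" if "\<bar>real_of_int j\<bar> \<le> k" for j
      unfolding u_def using k that by (intro powr_mono2') auto
    have "(2*k) powr (-3/2) * (2*k) powr (-3/2) \<le> u m * u n"
      using ge k u0 by (intro mult_mono) (auto simp: less_imp_le)
    also have "(2*k) powr (-3/2) * (2*k) powr (-3/2) = (2*k) powr (-3)"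
      by (simp flip: powr_add)
    also have "\<dots> = 1 / (2*k)^3" using k by (simp add: powr_minus powr_numeral field_simps)
    finally have "1 / (8*k^3) \<le> u m * u n" by (simp add: power_mult_distrib)
    then show ?thesis using k by (simp add: k_def[symmetric] field_simps)
  qed
  have "(\<lambda>(m,n). 8 * (u m * u n)) summable_on (UNIV - {(0,0)})"
    using prod[THEN abs_summable_summable] 
    by (auto simp: case_prod_unfold intro!: summable_on_cmult_right elim: summable_on_subset_banach)
  then have "(\<lambda>p. norm (case p of (m, n) \<Rightarrow> 1 / real_of_int (max \<bar>m\<bar> \<bar>n\<bar>) ^ 3)) summable_on (UNIV - {(0::int, 0::int)})"
  proof (rule Infinite_Sum.abs_summable_on_comparison_test')
    fix p :: "int \<times> int" assume "p \<in> UNIV - {(0,0)}"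
    then show "norm (case p of (m, n) \<Rightarrow> 1 / real_of_int (max \<bar>m\<bar> \<bar>n\<bar>) ^ 3) \<le> (case p of (m, n) \<Rightarrow> 8 * (u m * u n))"
      using le[of "fst p" "snd p"] by (simp add: case_prod_unfold)
  qed
  then show ?thesis by (rule abs_summable_summable)
qed

text \<open>The imaginary part controls n, and then the real part controls m. The constant depends
  on \<tau> only through the two bounds, which makes the Eisenstein series converge locally
  uniformly in \<tau>.\<close>

lemma int_combination_bound:
  fixes \<tau> :: complex
  assumes "\<bar>Im \<tau>\<bar> \<ge> \<epsilon>" "\<epsilon> > 0" "\<bar>Re \<tau>\<bar> \<le> R"
  shows "real_of_int (max \<bar>m\<bar> \<bar>n\<bar>) \<le> (1 + (1 + R) / \<epsilon>) * norm (of_int m + of_int n * \<tau>)"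
proof -
  let ?w = "of_int m + of_int n * \<tau>"
  have "\<bar>real_of_int n\<bar> * \<epsilon> \<le> \<bar>real_of_int n\<bar> * \<bar>Im \<tau>\<bar>" using assms by (intro mult_left_mono) auto
  also have "\<dots> = \<bar>Im ?w\<bar>" by (simp add: abs_mult)
  also have "\<dots> \<le> norm ?w" by (rule abs_Im_le_cmod)
  finally have n: "\<bar>real_of_int n\<bar> \<le> norm ?w / \<epsilon>" using assms by (simp add: field_simps)
  have R: "R \<ge> 0" using assms by linarith
  have "\<bar>real_of_int m\<bar> \<le> \<bar>Re ?w\<bar> + \<bar>real_of_int n\<bar> * \<bar>Re \<tau>\<bar>"
    by (simp add: abs_mult[symmetric])
  also have "\<dots> \<le> norm ?w + norm ?w / \<epsilon> * R"
    using assms n R by (intro add_mono mult_mono abs_Re_le_cmod) auto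
  finally have m: "\<bar>real_of_int m\<bar> \<le> norm ?w + norm ?w / \<epsilon> * R" .
  have "norm ?w / \<epsilon> * R \<ge> 0" using R assms by auto
  moreover have "(1 + (1 + R) / \<epsilon>) * norm ?w = norm ?w + norm ?w/\<epsilon> + norm ?w / \<epsilon> * R"
    using assms by (simp add: field_simps)
  ultimately show ?thesis using m n by (auto simp: max_def intro: order_trans)
qed

section \<open>Geometry of a period lattice\<close>

locale complex_lattice =
  fixes L :: "complex set"
  assumes is_lattice: "is_lattice L"
begin

lemma basis:
  obtains w1 w2 where "Im (w2 / w1) \<noteq> 0" "L = {of_int m * w1 + of_int n * w2 | m n :: int. True}"
  using is_lattice unfolding is_lattice_def by blast

lemma zero_mem [simp]: "0 \<in> L"
  by (rule basis) (metis (mono_tags, lifting) add_0 mem_Collect_eq mult_zero_left of_int_0)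

lemma add_mem: "a \<in> L \<Longrightarrow> b \<in> L \<Longrightarrow> a + b \<in> L"
proof (rule basis)
  fix w1 w2 assume L: "L = {of_int m * w1 + of_int n * w2 | m n :: int. True}" and "a \<in> L" "b \<in> L"
  then obtain m n m' n' where "a = of_int m * w1 + of_int n * w2" "b = of_int m' * w1 + of_int n' * w2"
    by auto
  then have "a + b = of_int (m+m') * w1 + of_int (n+n') * w2" by (simp add: algebra_simps)
  then show ?thesis unfolding L by blast
qed

lemma uminus_mem: "a \<in> L \<Longrightarrow> - a \<in> L"
proof (rule basis)
  fix w1 w2 assume L: "L = {of_int m * w1 + of_int n * w2 | m n :: int. True}" and "a \<in> L"
  then obtain m n where "a = of_int m * w1 + of_int n * w2" by auto
  then have "- a = of_int (-m) * w1 + of_int (-n) * w2" by (simp add: algebra_simps)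
  then show ?thesis unfolding L by blast
qed

lemma uminus_mem_iff [simp]: "- a \<in> L \<longleftrightarrow> a \<in> L"
  using uminus_mem[of a] uminus_mem[of "-a"] by auto

lemma diff_mem: "a \<in> L \<Longrightarrow> b \<in> L \<Longrightarrow> a - b \<in> L"
  using add_mem[of a "-b"] by simp

lemma add_mem_iff: "w \<in> L \<Longrightarrow> z + w \<in> L \<longleftrightarrow> z \<in> L"
  using add_mem[of z w] diff_mem[of "z + w" w] by auto

lemma countable_lattice: "countable L"
proof (rule basis)
  fix w1 w2 assume L: "L = {of_int m * w1 + of_int n * w2 | m n :: int. True}"
  have "L = (\<lambda>(m::int, n::int). of_int m * w1 + of_int n * w2) ` UNIV" unfolding L by auto
  then show ?thesis by simp
qed

lemma connected_compl: "connected (- L)"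
  using connected_open_diff_countable[OF _ open_UNIV connected_UNIV countable_lattice]
  by (simp add: Compl_eq_Diff_UNIV)

text \<open>The norm bound also gives injectivity: a combination equal to zero has both coefficients
  zero. Sums over the lattice thus become sums over integer pairs.\<close>

lemma indexed:
  obtains w1 w2 K where "Im (w2 / w1) \<noteq> 0" "w1 \<noteq> 0" "K > 0"
    "bij_betw (\<lambda>(m::int, n::int). of_int m * w1 + of_int n * w2) UNIV L"
    "bij_betw (\<lambda>(m::int, n::int). of_int m * w1 + of_int n * w2) (UNIV - {(0,0)}) (L - {0})"
    "\<And>m n. real_of_int (max \<bar>m\<bar> \<bar>n\<bar>) \<le> K * norm (of_int m * w1 + of_int n * w2)"
proof (rule basis)
  fix w1 w2 assume L: "L = {of_int m * w1 + of_int n * w2 | m n :: int. True}" and im: "Im (w2/w1) \<noteq> 0"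
  let ?f = "\<lambda>(m::int, n::int). of_int m * w1 + of_int n * w2"
  define \<tau> where "\<tau> = w2/w1"
  define K where "K = (1 + (1 + \<bar>Re \<tau>\<bar>) / \<bar>Im \<tau>\<bar>) / norm w1"
  have w1: "w1 \<noteq> 0" using im by auto
  have K: "K > 0" using w1 im by (auto simp: K_def \<tau>_def intro!: divide_pos_pos add_pos_nonneg)
  have bd: "real_of_int (max \<bar>m\<bar> \<bar>n\<bar>) \<le> K * norm (of_int m * w1 + of_int n * w2)" for m n
  proof -
    have "of_int m * w1 + of_int n * w2 = w1 * (of_int m + of_int n * \<tau>)"
      using w1 by (simp add: \<tau>_def field_simps)
    then have "K * norm (of_int m * w1 + of_int n * w2) = (1 + (1 + \<bar>Re \<tau>\<bar>) / \<bar>Im \<tau>\<bar>) * norm (of_int m + of_int n * \<tau>)"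
      using w1 by (simp add: K_def norm_mult)
    then show ?thesis using int_combination_bound[of "\<bar>Im \<tau>\<bar>" \<tau> "\<bar>Re \<tau>\<bar>" m n] im by (simp add: \<tau>_def)
  qed
  have inj: "inj ?f"
  proof (rule injI, clarsimp)
    fix m n m' n' :: int assume "of_int m * w1 + of_int n * w2 = of_int m' * w1 + of_int n' * w2"
    then have "of_int (m-m') * w1 + of_int (n-n') * w2 = 0" by (simp add: algebra_simps)
    then have "real_of_int (max \<bar>m-m'\<bar> \<bar>n-n'\<bar>) \<le> 0" using bd[of "m-m'" "n-n'"] by (simp del: of_int_diff)
    then show "m = m' \<and> n = n'" by auto
  qed
  have ran: "range ?f = L" unfolding L by auto
  have b1: "bij_betw ?f UNIV L" using inj ran by (auto simp: bij_betw_def)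
  have "bij_betw ?f (UNIV - {(0,0)}) (L - {0})"
    using bij_betw_DiffI[OF b1, of "{(0,0)}" "{0}"] by (simp add: bij_betw_def)
  then show ?thesis using that[OF im w1 K b1 _ bd] by blast
qed

lemma summable_cubed: "(\<lambda>w. 1 / norm w ^ 3) summable_on (L - {0})"
proof (rule indexed)
  fix w1 w2 :: complex and K :: real
  let ?f = "\<lambda>(m::int, n::int). of_int m * w1 + of_int n * w2"
  assume K: "K > 0" and bij: "bij_betw ?f (UNIV - {(0,0)}) (L - {0})"
    and bd: "\<And>m n. real_of_int (max \<bar>m\<bar> \<bar>n\<bar>) \<le> K * norm (of_int m * w1 + of_int n * w2)"
  have "(\<lambda>p. K^3 * (case p of (m,n) \<Rightarrow> 1 / real_of_int (max \<bar>m\<bar> \<bar>n\<bar>) ^ 3)) summable_on (UNIV - {(0, 0)})"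
    by (intro summable_on_cmult_right summable_on_max_cubed)
  then have "(\<lambda>p. norm (1 / norm (?f p) ^ 3)) summable_on (UNIV - {(0,0)})"
  proof (rule Infinite_Sum.abs_summable_on_comparison_test')
    fix p :: "int \<times> int" assume p: "p \<in> UNIV - {(0,0)}"
    obtain m n where pmn: "p = (m,n)" by force
    with p have mn: "(m,n) \<noteq> (0,0)" by auto
    let ?k = "real_of_int (max \<bar>m\<bar> \<bar>n\<bar>)" and ?w = "norm (of_int m * w1 + of_int n * w2)"
    have k: "?k > 0" using mn by auto
    then have w: "?w > 0" using bd[of m n] K by (metis less_le_trans zero_less_mult_pos)
    have "?k ^ 3 \<le> (K * ?w) ^ 3" using bd k by (intro power_mono) auto
    then have "1 / ?w^3 \<le> K^3 * (1/ ?k^3)" using k w by (simp add: field_simps power_mult_distrib)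
    then show "norm (1 / norm (?f p) ^ 3) \<le> K ^ 3 * (case p of (m, n) \<Rightarrow> 1 / real_of_int (max \<bar>m\<bar> \<bar>n\<bar>) ^ 3)"
      by (simp add: pmn)
  qed
  then have "(\<lambda>p. 1 / norm (?f p) ^ 3) summable_on (UNIV - {(0,0)})" by (rule abs_summable_summable)
  then show ?thesis
    using summable_on_reindex_bij_betw[OF bij, of "\<lambda>w. 1 / norm w ^ 3"] by simp
qed

lemma finite_norm_le: "finite {w\<in>L. norm w \<le> R}"
proof (rule indexed)
  fix w1 w2 :: complex and K :: real
  let ?f = "\<lambda>(m::int, n::int). of_int m * w1 + of_int n * w2"
  assume K: "K > 0" and bij: "bij_betw ?f UNIV L"
    and bd: "\<And>m n. real_of_int (max \<bar>m\<bar> \<bar>n\<bar>) \<le> K * norm (of_int m * w1 + of_int n * w2)"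
  define N where "N = \<lceil>K * R\<rceil>"
  have "{w\<in>L. norm w \<le> R} \<subseteq> ?f ` ({-N..N} \<times> {-N..N})"
  proof clarify
    fix w assume w: "w \<in> L" "norm w \<le> R"
    then obtain m n where mn: "w = of_int m * w1 + of_int n * w2" using bij by (auto simp: bij_betw_def)
    have "real_of_int (max \<bar>m\<bar> \<bar>n\<bar>) \<le> K * norm w" using bd mn by auto
    also have "\<dots> \<le> K * R" using w K by auto
    finally have "max \<bar>m\<bar> \<bar>n\<bar> \<le> N" unfolding N_def by linarith
    then have "(m,n) \<in> {-N..N} \<times> {-N..N}" by auto
    then show "w \<in> ?f ` ({-N..N} \<times> {-N..N})" using mn by (intro image_eqI[of _ _ "(m,n)"]) auto
  qed
  then show ?thesis by (rule finite_subset) auto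
qed

lemma isolated: obtains d where "d > 0" "\<And>w. w \<in> L \<Longrightarrow> w \<noteq> z \<Longrightarrow> d \<le> dist z w"
proof -
  have "finite {w\<in>L. norm w \<le> norm z + 1}" by (rule finite_norm_le)
  from finite_set_avoid[OF this, of z] obtain d where
    d: "d > 0" "\<And>w. w \<in> L \<Longrightarrow> norm w \<le> norm z + 1 \<Longrightarrow> w \<noteq> z \<Longrightarrow> d \<le> dist z w" by auto
  show ?thesis
  proof (rule that[of "min d 1"])
    fix w assume w: "w \<in> L" "w \<noteq> z"
    show "min d 1 \<le> dist z w"
    proof (cases "norm w \<le> norm z + 1")
      case False
      have "norm w \<le> norm z + dist z w" by (metis dist_commute dist_norm norm_triangle_sub)
      then show ?thesis using False by auto
    qed (use d(2)[of w] w in auto)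
  qed (use d in auto)
qed

lemma closed_lattice: "closed L"
  unfolding closed_limpt islimpt_approachable
  by (metis isolated not_le dist_commute)

lemma open_compl: "open (- L)"
  using closed_lattice by auto

lemma small_ball: obtains r where "r > 0" "\<And>w. w \<in> L \<Longrightarrow> w \<noteq> 0 \<Longrightarrow> r \<le> norm w"
  using isolated[of 0] by auto

lemma infsum_uminus_lattice: "infsum f (L - {0}) = infsum (\<lambda>w. f (- w)) (L - {0})"
  by (rule infsum_reindex_bij_witness[of _ uminus uminus]) auto

lemma summable_high_power:
  assumes "k \<ge> 3" shows "(\<lambda>w. 1 / norm w ^ k) summable_on (L - {0})"
proof (rule small_ball)
  fix r assume r: "r > 0" "\<And>w. w \<in> L \<Longrightarrow> w \<noteq> 0 \<Longrightarrow> r \<le> norm w"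
  have "(\<lambda>w. 1 / r^(k-3) * (1 / norm w ^ 3)) summable_on (L - {0})"
    by (intro summable_on_cmult_right summable_cubed)
  then have "(\<lambda>w. norm (1 / norm w ^ k)) summable_on (L - {0})"
  proof (rule Infinite_Sum.abs_summable_on_comparison_test')
    fix w assume w: "w \<in> L - {0}"
    have "norm w ^ k = norm w ^ (k-3) * norm w ^ 3" using assms by (simp flip: power_add)
    also have "\<dots> \<ge> r ^ (k-3) * norm w ^ 3" using w r by (intro mult_right_mono power_mono) auto
    finally have "1 / norm w ^ k \<le> 1 / (r ^ (k-3) * norm w ^ 3)" using w r by (intro divide_left_mono) auto
    then show "norm (1 / norm w ^ k) \<le> 1 / r ^ (k-3) * (1 / norm w ^ 3)" by simp
  qed
  then show ?thesis by (rule abs_summable_summable)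
qed

end

section \<open>The Weierstrass functions of a lattice\<close>

text \<open>It suffices to dominate the terms themselves: a locally uniform limit of complex
  differentiable functions can be differentiated termwise. The index set is arbitrary, because
  lattice sums are unconditional.\<close>

lemma has_field_derivative_infsum:
  fixes f f' :: "'a \<Rightarrow> complex \<Rightarrow> complex"
  assumes "open A" "z \<in> A" "M summable_on X"
    and le: "\<And>x z. x \<in> X \<Longrightarrow> z \<in> A \<Longrightarrow> norm (f x z) \<le> M x"
    and der: "\<And>x z. x \<in> X \<Longrightarrow> z \<in> A \<Longrightarrow> (f x has_field_derivative f' x z) (at z)"
  shows "((\<lambda>z. \<Sum>\<^sub>\<infinity>x\<in>X. f x z) has_field_derivative (\<Sum>\<^sub>\<infinity>x\<in>X. f' x z)) (at z)"
    and "(\<lambda>x. f' x z) summable_on X"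
proof -
  obtain r where r: "r > 0" "cball z r \<subseteq> A" using assms(1,2) by (meson open_contains_cball)
  have u: "uniform_limit (cball z r) (\<lambda>X y. \<Sum>x\<in>X. f x y) (\<lambda>y. \<Sum>\<^sub>\<infinity>x\<in>X. f x y) (finite_subsets_at_top X)"
    by (rule Weierstrass_m_test_general[OF _ assms(3)]) (use le r in auto)
  have ev: "\<forall>\<^sub>F n in finite_subsets_at_top X. continuous_on (cball z r) (\<lambda>y. \<Sum>x\<in>n. f x y) \<and>
        (\<forall>w \<in> ball z r. ((\<lambda>y. \<Sum>x\<in>n. f x y) has_field_derivative (\<Sum>x\<in>n. f' x w)) (at w))"
  proof (rule eventually_finite_subsets_at_top_weakI)
    fix Y assume Y: "finite Y" "Y \<subseteq> X"
    have d: "((\<lambda>y. \<Sum>x\<in>Y. f x y) has_field_derivative (\<Sum>x\<in>Y. f' x w)) (at w)" if "w \<in> A" for w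
      using Y that by (intro DERIV_sum der) auto
    then show "continuous_on (cball z r) (\<lambda>y. \<Sum>x\<in>Y. f x y) \<and>
        (\<forall>w \<in> ball z r. ((\<lambda>y. \<Sum>x\<in>Y. f x y) has_field_derivative (\<Sum>x\<in>Y. f' x w)) (at w))"
      using r ball_subset_cball[of z r] by (intro conjI ballI d DERIV_continuous_on[OF DERIV_subset[OF d]]) auto
  qed
  obtain g' where g': "\<And>w. w \<in> ball z r \<Longrightarrow> ((\<lambda>y. \<Sum>\<^sub>\<infinity>x\<in>X. f x y) has_field_derivative (g' w)) (at w) \<and>
       ((\<lambda>n. (\<Sum>x\<in>n. f' x w)) \<longlongrightarrow> g' w) (finite_subsets_at_top X)"
    using has_complex_derivative_uniform_limit[OF ev u _ r(1)] by auto
  then have hs: "((\<lambda>x. f' x z) has_sum g' z) X" using r(1) unfolding has_sum_def by auto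
  then show "(\<lambda>x. f' x z) summable_on X" by (rule has_sum_imp_summable)
  show "((\<lambda>z. \<Sum>\<^sub>\<infinity>x\<in>X. f x z) has_field_derivative (\<Sum>\<^sub>\<infinity>x\<in>X. f' x z)) (at z)"
    using g'[of z] r(1) infsumI[OF hs] by auto
qed

definition lattice_zeta :: "complex set \<Rightarrow> complex \<Rightarrow> complex" where
  "lattice_zeta L z = deriv (lattice_sigma L) z / lattice_sigma L z"

definition lattice_wp :: "complex set \<Rightarrow> complex \<Rightarrow> complex" where
  "lattice_wp L z = - deriv (lattice_zeta L) z"

section \<open>Canonical factors of the sigma product and their logarithmic derivatives\<close>

definition wfactor :: "complex \<Rightarrow> complex \<Rightarrow> complex" where
  "wfactor w z = (1 - z / w) * exp (z / w + z\<^sup>2 / (2 * w\<^sup>2))"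

text \<open>A logarithm of \<open>wfactor w\<close> for |w| > 2 |z|: there 1 - z/w has positive real
  part, so the principal branch is holomorphic.\<close>

definition wlog :: "complex \<Rightarrow> complex \<Rightarrow> complex" where
  "wlog w z = Ln (1 - z / w) + z / w + z\<^sup>2 / (2 * w\<^sup>2)"

text \<open>The logarithmic derivative of \<open>wfactor w\<close>, put over one denominator so that
  its decay like w^-3 is visible.\<close>

definition zterm :: "complex \<Rightarrow> complex \<Rightarrow> complex" where
  "zterm w z = z\<^sup>2 / (w\<^sup>2 * (z - w))"

text \<open>Minus the z-derivative of \<open>zterm w\<close>. Subtracting 1/w^2 makes the sum over
  the lattice converge.\<close>

definition pterm :: "complex \<Rightarrow> complex \<Rightarrow> complex" where
  "pterm w z = 1 / (z - w)\<^sup>2 - 1 / w\<^sup>2"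

lemma zterm_alt: "w \<noteq> 0 \<Longrightarrow> z \<noteq> w \<Longrightarrow> zterm w z = 1 / (z - w) + 1 / w + z / w\<^sup>2"
  by (simp add: zterm_def field_simps power2_eq_square)

lemma wfactor_0 [simp]: "wfactor w 0 = 1" by (simp add: wfactor_def)

lemma wlog_0 [simp]: "wlog w 0 = 0" by (simp add: wlog_def)

lemma wfactor_eq_0_iff: "w \<noteq> 0 \<Longrightarrow> wfactor w z = 0 \<longleftrightarrow> z = w"
  by (auto simp: wfactor_def)

lemma has_field_derivative_wfactor:
  assumes "w \<noteq> 0" "z \<noteq> w"
  shows "(wfactor w has_field_derivative wfactor w z * zterm w z) (at z)"
proof -
  define e where "e = exp (z / w + z\<^sup>2 / (2 * w\<^sup>2))"
  have "((\<lambda>z. z / w + z\<^sup>2 / (2 * w\<^sup>2)) has_field_derivative 1 / w + z / w\<^sup>2) (at z)"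
    using assms by (auto intro!: derivative_eq_intros simp: power2_eq_square)
  then have "((\<lambda>z. exp (z / w + z\<^sup>2 / (2 * w\<^sup>2))) has_field_derivative e * (1 / w + z / w\<^sup>2)) (at z)"
    unfolding e_def by (rule DERIV_fun_exp)
  moreover have "((\<lambda>z. 1 - z / w) has_field_derivative - (1 / w)) (at z)"
    using assms by (auto intro!: derivative_eq_intros)
  ultimately have "((\<lambda>z. (1 - z / w) * exp (z / w + z\<^sup>2 / (2 * w\<^sup>2))) has_field_derivative
     (1 - z / w) * (e * (1 / w + z / w\<^sup>2)) + - (1 / w) * e) (at z)"
    unfolding e_def by (rule DERIV_mult'[rotated])
  note der = this
  have "(1 - z / w) * (1 / (z - w)) = - (1 / w)" using assms by (simp add: divide_simps)
  note up = this
  have gen: "u * (e * s) + q * e = u * e * (p + s)" if "u * p = q" for u p q s :: complex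
    unfolding that[symmetric] by (simp add: algebra_simps)
  have "(1 - z / w) * (e * (1 / w + z / w\<^sup>2)) + - (1 / w) * e
      = (1 - z / w) * e * (1 / (z - w) + (1 / w + z / w\<^sup>2))" by (rule gen[OF up])
  then have "(1 - z / w) * (e * (1 / w + z / w\<^sup>2)) + - (1 / w) * e = wfactor w z * zterm w z"
    unfolding wfactor_def zterm_alt[OF assms] e_def[symmetric] by (simp only: add.assoc)
  with der show ?thesis by (simp only: wfactor_def[abs_def])
qed

lemma far_point:
  fixes z w :: complex
  assumes "norm z < R" "norm w > 2 * R"
  shows "w \<noteq> 0" "z \<noteq> w" "norm (z - w) > norm w / 2" "norm (z/w) < 1/2" "norm w > 0"
proof -
  have "R > 0" using assms(1) by (smt (verit) norm_ge_zero)
  then show 1: "w \<noteq> 0" "norm w > 0" using assms by auto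
  have "norm w \<le> norm (z - w) + norm z" using norm_triangle_sub[of w z] by (simp add: norm_minus_commute add.commute)
  then show 2: "norm (z - w) > norm w / 2" using assms by linarith
  show "z \<noteq> w" using 2 1 by auto
  show "norm (z/w) < 1/2" using assms 1 by (simp add: norm_divide field_simps)
qed

lemma far_re: 
  fixes z w :: complex
  assumes "norm z < R" "norm w > 2 * R" shows "1 - z / w \<notin> \<real>\<^sub>\<le>\<^sub>0"
proof -
  have "Re (z/w) < 1/2" using far_point(4)[OF assms] complex_Re_le_cmod[of "z/w"] by linarith
  then show ?thesis by (auto simp: complex_nonpos_Reals_iff)
qed

lemma exp_wlog: assumes "norm z < R" "norm w > 2 * R" shows "exp (wlog w z) = wfactor w z"
proof -
  have "1 - z/w \<noteq> 0" using far_point[OF assms] by auto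
  then show ?thesis by (simp add: wlog_def wfactor_def exp_add)
qed

lemma has_field_derivative_wlog:
  assumes "norm z < R" "norm w > 2 * R"
  shows "(wlog w has_field_derivative zterm w z) (at z)"
proof -
  note f = far_point[OF assms]
  have "((\<lambda>z. z / w + z\<^sup>2 / (2 * w\<^sup>2)) has_field_derivative 1 / w + z / w\<^sup>2) (at z)"
    using f(1) by (auto intro!: derivative_eq_intros simp: power2_eq_square)
  note lin = this
  have "((\<lambda>z. 1 - z / w) has_field_derivative - (1 / w)) (at z)"
    using f by (auto intro!: derivative_eq_intros)
  then have "((\<lambda>z. Ln (1 - z / w)) has_field_derivative inverse (1 - z / w) * - (1 / w)) (at z)"
    by (rule DERIV_chain2[where g = "\<lambda>z. 1 - z / w", OF has_field_derivative_Ln[OF far_re[OF assms]]])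
  moreover have "inverse (1 - z / w) * - (1 / w) = 1 / (z - w)"
    using f(1,2) by (simp add: divide_simps)
  ultimately have "((\<lambda>z. Ln (1 - z / w)) has_field_derivative 1 / (z - w)) (at z)" by (simp only:)
  from DERIV_add[OF this lin]
  have "((\<lambda>z. Ln (1 - z / w) + (z / w + z\<^sup>2 / (2 * w\<^sup>2))) has_field_derivative 1 / (z - w) + (1 / w + z / w\<^sup>2)) (at z)" .
  then show ?thesis by (simp only: wlog_def[abs_def] zterm_alt[OF f(1,2)] add.assoc)
qed

lemma norm_zterm:
  assumes "norm z < R" "norm w > 2 * R"
  shows "norm (zterm w z) \<le> 2 * R^2 * (1 / norm w ^ 3)"
proof -
  note f = far_point[OF assms]
  have "norm (zterm w z) = norm z ^ 2 / (norm w ^ 2 * norm (z - w))"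
    by (simp add: zterm_def norm_mult norm_divide norm_power)
  also have "\<dots> \<le> R^2 / (norm w ^ 2 * (norm w / 2))"
    using f assms by (intro frac_le mult_mono power_mono) auto
  also have "\<dots> = 2 * R^2 * (1 / norm w ^ 3)" by (simp add: power2_eq_square power3_eq_cube)
  finally show ?thesis .
qed

text \<open>\<open>wlog w\<close> vanishes at 0, so the estimate comes from integrating the bound
  for its derivative \<open>zterm\<close> over a segment of length at most R.\<close>

lemma norm_wlog:
  assumes "norm z < R" "norm w > 2 * R"
  shows "norm (wlog w z) \<le> 2 * R^3 * (1 / norm w ^ 3)"
proof -
  have R: "R > 0" using assms(1) by (smt (verit) norm_ge_zero)
  have "norm (wlog w z - wlog w 0) \<le> 2 * R^2 * (1 / norm w ^ 3) * norm (z - 0)"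
  proof (rule field_differentiable_bound[of "ball 0 R"])
    fix y :: complex assume "y \<in> ball 0 R"
    then have y: "norm y < R" by simp
    show "(wlog w has_field_derivative zterm w y) (at y within ball 0 R)"
      by (rule DERIV_subset[OF has_field_derivative_wlog[OF y assms(2)]]) auto
    show "norm (zterm w y) \<le> 2 * R^2 * (1 / norm w ^ 3)" by (rule norm_zterm[OF y assms(2)])
  qed (use R assms(1) in simp_all)
  also have "\<dots> \<le> 2 * R^2 * (1 / norm w ^ 3) * R" using assms R by (intro mult_left_mono) auto
  finally show ?thesis by (simp add: power2_eq_square power3_eq_cube mult_ac)
qed

lemma norm_pterm:
  assumes "norm z < R" "norm w > 2 * R"
  shows "norm (pterm w z) \<le> 10 * R * (1 / norm w ^ 3)"
proof -
  note f = far_point[OF assms]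
  have R: "R > 0" using assms(1) by (smt (verit) norm_ge_zero)
  have "pterm w z = (w\<^sup>2 - (z - w)\<^sup>2) / ((z-w)\<^sup>2 * w\<^sup>2)"
    unfolding pterm_def using f(1,2) by (subst diff_frac_eq) auto
  also have "w\<^sup>2 - (z - w)\<^sup>2 = z * (2 * w - z)" by (simp add: power2_eq_square algebra_simps)
  finally have "norm (pterm w z) = norm z * norm (2*w - z) / (norm (z - w)^2 * norm w ^ 2)"
    by (simp add: norm_mult norm_divide norm_power)
  also have "\<dots> \<le> R * (5/2 * norm w) / ((norm w / 2)^2 * norm w ^ 2)"
  proof (rule frac_le)
    have "norm (2*w - z) \<le> 2 * norm w + norm z" using norm_triangle_ineq4[of "2*w" z] by (simp add: norm_mult)
    also have "\<dots> \<le> 5/2 * norm w" using assms f(5) R by linarith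
    finally show "norm z * norm (2*w - z) \<le> R * (5/2 * norm w)" using R assms(1) by (intro mult_mono) simp_all
    show "(norm w / 2)\<^sup>2 * (norm w)\<^sup>2 \<le> (norm (z - w))\<^sup>2 * (norm w)\<^sup>2"
      using f(3) by (intro mult_right_mono power_mono) simp_all
    show "0 < (norm w / 2)\<^sup>2 * (norm w)\<^sup>2" using f(5) by simp
    show "0 \<le> R * (5 / 2 * cmod w)" using R by simp
  qed
  also have "\<dots> = 10 * R * (1 / norm w ^ 3)" using f(5) by (simp add: power2_eq_square power3_eq_cube field_simps)
  finally show ?thesis .
qed

context complex_lattice begin

text \<open>On the disc of radius R, zeros and poles can only come from \<open>near R\<close>, a
  finite set handled explicitly. The periods in \<open>far R\<close> satisfy |w - z| > |w|/2, which
  gives uniform majorants.\<close>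

definition near :: "real \<Rightarrow> complex set" where "near R = {w\<in>L - {0}. norm w \<le> 2 * R}"
definition far :: "real \<Rightarrow> complex set" where "far R = {w\<in>L - {0}. norm w > 2 * R}"

lemma near_iff [simp]: "w \<in> near R \<longleftrightarrow> w \<in> L \<and> w \<noteq> 0 \<and> norm w \<le> 2 * R"
  and far_iff [simp]: "w \<in> far R \<longleftrightarrow> w \<in> L \<and> w \<noteq> 0 \<and> norm w > 2 * R"
  by (auto simp: near_def far_def)

lemma finite_near: "finite (near R)"
  by (rule finite_subset[OF _ finite_norm_le[of "2*R"]]) auto

lemma summable_far: "(\<lambda>w. c * (1 / norm w ^ 3)) summable_on (far R)"
  by (rule summable_on_cmult_right, rule summable_on_subset_banach[OF summable_cubed]) auto

lemma near_Un_far: "near R \<union> far R = L - {0}" "near R \<inter> far R = {}" by auto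

lemma summable_from_far:
  fixes g :: "complex \<Rightarrow> complex"
  assumes le: "\<And>w. w \<in> far R \<Longrightarrow> norm (g w) \<le> c * (1 / norm w ^ 3)"
  shows "g summable_on far R" "g summable_on (L - {0})" 
    "infsum g (L - {0}) = sum g (near R) + infsum g (far R)"
proof -
  have "(\<lambda>w. norm (g w)) summable_on far R"
    using summable_far[of c R] le by (rule Infinite_Sum.abs_summable_on_comparison_test')
  then show 1: "g summable_on far R" by (rule abs_summable_summable)
  have 2: "g summable_on near R" by (rule summable_on_finite[OF finite_near])
  have "g summable_on near R \<union> far R"
    using 2 1 near_Un_far(2) by (rule summable_on_Un_disjoint)
  then show "g summable_on (L - {0})" by (simp only: near_Un_far(1))
  have "infsum g (near R \<union> far R) = infsum g (near R) + infsum g (far R)"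
    using 2 1 near_Un_far(2) by (rule infsum_Un_disjoint)
  then show "infsum g (L - {0}) = sum g (near R) + infsum g (far R)"
    by (simp only: near_Un_far(1) infsum_finite[OF finite_near])
qed

text \<open>In the limit over finite sets of periods one may restrict to sets containing
  \<open>near R\<close>. The remaining factors are then exponentials of \<open>wlog\<close>, whose
  sum converges unconditionally.\<close>

lemma lattice_sigma_local:
  assumes z: "norm z < R"
  shows "lattice_sigma L z = z * (\<Prod>w\<in>near R. wfactor w z) * exp (\<Sum>\<^sub>\<infinity>w\<in>far R. wlog w z)"
proof -
  \<comment> \<open>Setting \<open>l\<close> to 0 on \<open>near R\<close> turns the sum over
    \<open>far R\<close> into a sum over all nonzero periods, hence into a limit along the filter
    used to define sigma.\<close>
  define l where "l = (\<lambda>w. if w \<in> near R then 0 else wlog w z)"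
  define S where "S = (\<Sum>\<^sub>\<infinity>w\<in>far R. wlog w z)"
  define P where "P = (\<Prod>w\<in>near R. wfactor w z)"
  have "(\<lambda>w. wlog w z) summable_on far R"
    by (rule summable_from_far(1)[where c = "2 * R^3"], rule norm_wlog[OF z]) simp
  then have "((\<lambda>w. wlog w z) has_sum S) (far R)"
    unfolding S_def by (rule has_sum_infsum)
  also have "((\<lambda>w. wlog w z) has_sum S) (far R) \<longleftrightarrow> (l has_sum S) (L - {0})"
    by (rule has_sum_cong_neutral) (auto simp: l_def)
  finally have "(sum l \<longlongrightarrow> S) (finite_subsets_at_top (L - {0}))"
    unfolding has_sum_def .
  then have "((\<lambda>F. P * exp (sum l F)) \<longlongrightarrow> P * exp S) (finite_subsets_at_top (L - {0}))"
    by (rule tendsto_mult_left[OF tendsto_exp])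
  moreover have "\<forall>\<^sub>F F in finite_subsets_at_top (L - {0}). 
     P * exp (sum l F) = (\<Prod>w\<in>F. (1 - z / w) * exp (z / w + z\<^sup>2 / (2 * w\<^sup>2)))"
    unfolding eventually_finite_subsets_at_top
  proof (intro exI[of _ "near R"] conjI allI impI)
    show "finite (near R)" by (rule finite_near)
    show "near R \<subseteq> L - {0}" by auto
    fix Y assume Y: "finite Y \<and> near R \<subseteq> Y \<and> Y \<subseteq> L - {0}"
    have "sum l Y = (\<Sum>w\<in>Y - near R. wlog w z)"
      using Y by (intro sum.mono_neutral_cong_right) (auto simp: l_def)
    then have "exp (sum l Y) = (\<Prod>w\<in>Y - near R. exp (wlog w z))" using Y by (simp add: exp_sum)
    also have "\<dots> = (\<Prod>w\<in>Y - near R. wfactor w z)" 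
    proof (rule prod.cong[OF refl])
      fix w assume "w \<in> Y - near R"
      then have "norm w > 2 * R" using Y by auto
      then show "exp (wlog w z) = wfactor w z" by (rule exp_wlog[OF z])
    qed
    finally have "P * exp (sum l Y) = (\<Prod>w\<in>Y - near R. wfactor w z) * (\<Prod>w\<in>near R. wfactor w z)"
      by (simp only: P_def mult.commute)
    also have "\<dots> = (\<Prod>w\<in>Y. wfactor w z)" using Y by (intro prod.subset_diff[symmetric]) auto
    finally show "P * exp (sum l Y) = (\<Prod>w\<in>Y. (1 - z / w) * exp (z / w + z\<^sup>2 / (2 * w\<^sup>2)))"
      by (simp only: wfactor_def)
  qed
  ultimately have lim: "((\<lambda>F. \<Prod>w\<in>F. (1 - z / w) * exp (z / w + z\<^sup>2 / (2 * w\<^sup>2))) \<longlongrightarrow> P * exp S) (finite_subsets_at_top (L - {0}))"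
    by (rule Lim_transform_eventually)
  have "lattice_sigma L z = z * (P * exp S)"
    unfolding lattice_sigma_def by (subst tendsto_Lim[OF finite_subsets_at_top_neq_bot lim]) (rule refl)
  then show ?thesis by (simp only: S_def P_def mult.assoc)
qed

lemma lattice_sigma_nhds:
  assumes "norm z < R"
  shows "\<forall>\<^sub>F z in nhds z. z * (\<Prod>w\<in>near R. wfactor w z) * exp (\<Sum>\<^sub>\<infinity>w\<in>far R. wlog w z) = lattice_sigma L z"
proof -
  have "\<forall>\<^sub>F z in nhds z. z \<in> ball 0 R" using assms by (intro eventually_nhds_in_open) auto
  then show ?thesis by eventually_elim (simp add: lattice_sigma_local)
qed

lemma lattice_sigma_eq_0_iff: "lattice_sigma L z = 0 \<longleftrightarrow> z \<in> L"
proof -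
  let ?R = "norm z + 1"
  have "lattice_sigma L z = 0 \<longleftrightarrow> z = 0 \<or> (\<Prod>w\<in>near ?R. wfactor w z) = 0"
  proof -
    have "norm z < ?R" by simp
    from lattice_sigma_local[OF this] show ?thesis by (simp only: mult_eq_0_iff exp_not_eq_zero simp_thms)
  qed
  also have "(\<Prod>w\<in>near ?R. wfactor w z) = 0 \<longleftrightarrow> (\<exists>w\<in>near ?R. wfactor w z = 0)"
    by (rule prod_zero_iff[OF finite_near])
  also have "(\<exists>w\<in>near ?R. wfactor w z = 0) \<longleftrightarrow> z \<in> near ?R"
  proof -
    have "wfactor w z = 0 \<longleftrightarrow> z = w" if "w \<in> near ?R" for w
      using that by (intro wfactor_eq_0_iff) simp
    then have "(\<exists>w\<in>near ?R. wfactor w z = 0) \<longleftrightarrow> (\<exists>w\<in>near ?R. z = w)" by (simp only: cong: bex_cong)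
    also have "\<dots> \<longleftrightarrow> z \<in> near ?R" by metis
    finally show ?thesis .
  qed
  also have "z = 0 \<or> z \<in> near ?R \<longleftrightarrow> z \<in> L"
  proof -
    have "norm z \<le> 2 * ?R" using norm_ge_zero[of z] by (simp add: algebra_simps)
    then show ?thesis unfolding near_iff using zero_mem by blast
  qed
  finally show ?thesis .
qed

lemma has_field_derivative_wlog_sum:
  assumes z: "norm z < R"
  shows "((\<lambda>z. \<Sum>\<^sub>\<infinity>w\<in>far R. wlog w z) has_field_derivative (\<Sum>\<^sub>\<infinity>w\<in>far R. zterm w z)) (at z)"
proof (rule has_field_derivative_infsum(1)[of "ball 0 R"])
  show "(\<lambda>w. 2 * R^3 * (1 / norm w ^ 3)) summable_on far R" by (rule summable_far)
  fix w y :: complex assume "w \<in> far R" "y \<in> ball 0 R"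
  then have yw: "norm y < R" "norm w > 2 * R" by auto
  show "norm (wlog w y) \<le> 2 * R^3 * (1 / norm w ^ 3)" by (rule norm_wlog[OF yw])
  show "(wlog w has_field_derivative zterm w y) (at y)" by (rule has_field_derivative_wlog[OF yw])
qed (use z in auto)

lemma has_field_derivative_prod_log:
  assumes "finite F" "\<And>w. w \<in> F \<Longrightarrow> w \<noteq> 0 \<and> z \<noteq> w"
  shows "((\<lambda>z. \<Prod>w\<in>F. wfactor w z) has_field_derivative (\<Prod>w\<in>F. wfactor w z) * (\<Sum>w\<in>F. zterm w z)) (at z)"
  using assms
proof (induction F rule: finite_induct)
  case (insert w F)
  have "((\<lambda>z. wfactor w z * (\<Prod>w\<in>F. wfactor w z)) has_field_derivative
     wfactor w z * ((\<Prod>w\<in>F. wfactor w z) * (\<Sum>w\<in>F. zterm w z)) + (wfactor w z * zterm w z) * (\<Prod>w\<in>F. wfactor w z)) (at z)"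
    using insert by (intro DERIV_mult' has_field_derivative_wfactor) auto
  then show ?case using insert by (simp add: algebra_simps)
qed auto

lemma holomorphic_lattice_sigma: "lattice_sigma L holomorphic_on UNIV"
proof -
  have "lattice_sigma L field_differentiable at z" for z
  proof -
    define R where "R = norm z + 1"
    have "((\<lambda>z. z * (\<Prod>w\<in>near R. wfactor w z) * exp (\<Sum>\<^sub>\<infinity>w\<in>far R. wlog w z)) holomorphic_on (ball 0 R))"
    proof (intro holomorphic_intros)
      show "(\<lambda>z. \<Sum>\<^sub>\<infinity>w\<in>far R. wlog w z) holomorphic_on ball 0 R"
        unfolding holomorphic_on_open[OF open_ball]
        by (intro ballI exI, rule has_field_derivative_wlog_sum) simp
      show "wfactor w holomorphic_on ball 0 R" if "w \<in> near R" for w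
        unfolding wfactor_def using that by (auto intro!: holomorphic_intros)
    qed
    then have "lattice_sigma L holomorphic_on (ball 0 R)"
      by (rule holomorphic_transform) (auto simp: lattice_sigma_local)
    then show ?thesis by (rule holomorphic_on_imp_differentiable_at) (auto simp: R_def)
  qed
  then show ?thesis by (simp add: holomorphic_on_def field_differentiable_at_within)
qed

lemma deriv_sigma: "(lattice_sigma L has_field_derivative deriv (lattice_sigma L) z) (at z)"
  by (rule holomorphic_derivI[OF holomorphic_lattice_sigma]) auto

lemma infsum_zterm_split:
  assumes "norm z < R"
  shows "(\<Sum>\<^sub>\<infinity>w\<in>L - {0}. zterm w z) = (\<Sum>w\<in>near R. zterm w z) + (\<Sum>\<^sub>\<infinity>w\<in>far R. zterm w z)"
  by (rule summable_from_far(3)[where c = "2 * R^2"], rule norm_zterm[OF assms]) simp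

lemma infsum_pterm_split:
  assumes "norm z < R"
  shows "(\<Sum>\<^sub>\<infinity>w\<in>L - {0}. pterm w z) = (\<Sum>w\<in>near R. pterm w z) + (\<Sum>\<^sub>\<infinity>w\<in>far R. pterm w z)"
  by (rule summable_from_far(3)[where c = "10 * R"], rule norm_pterm[OF assms]) simp

lemma lattice_zeta_eq:
  assumes "z \<notin> L" shows "lattice_zeta L z = 1 / z + (\<Sum>\<^sub>\<infinity>w\<in>L - {0}. zterm w z)"
proof -
  define R where "R = norm z + 1"
  have z: "norm z < R" by (auto simp: R_def)
  define P where "P = (\<lambda>z. \<Prod>w\<in>near R. wfactor w z)"
  define S where "S = (\<lambda>z. \<Sum>\<^sub>\<infinity>w\<in>far R. wlog w z)"
  have z0: "z \<noteq> 0" using assms by auto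
  have "((\<lambda>z. z * P z * exp (S z)) has_field_derivative
     z * P z * exp (S z) * (1 / z + (\<Sum>w\<in>near R. zterm w z) + (\<Sum>\<^sub>\<infinity>w\<in>far R. zterm w z))) (at z)"
  proof -
    have P: "(P has_field_derivative P z * (\<Sum>w\<in>near R. zterm w z)) (at z)"
      unfolding P_def using assms by (intro has_field_derivative_prod_log finite_near) auto
    have S: "((\<lambda>z. exp (S z)) has_field_derivative exp (S z) * (\<Sum>\<^sub>\<infinity>w\<in>far R. zterm w z)) (at z)"
      unfolding S_def by (intro DERIV_fun_exp has_field_derivative_wlog_sum z)
    show ?thesis
    proof (rule DERIV_cong[OF DERIV_mult'[OF DERIV_mult'[OF DERIV_ident P] S]])
      have "z * p * (e * a) + (z * (p * b) + 1 * p) * e = z * p * e * (1 / z + b + a)" for p e a b :: complex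
        using z0 by (simp add: ring_distribs mult_ac)
      then show "z * P z * (exp (S z) * (\<Sum>\<^sub>\<infinity>w\<in>far R. zterm w z)) + (z * (P z * (\<Sum>w\<in>near R. zterm w z)) + 1 * P z) * exp (S z) =
        z * P z * exp (S z) * (1 / z + (\<Sum>w\<in>near R. zterm w z) + (\<Sum>\<^sub>\<infinity>w\<in>far R. zterm w z))" .
    qed
  qed
  then have "(lattice_sigma L has_field_derivative
     z * P z * exp (S z) * (1 / z + (\<Sum>w\<in>near R. zterm w z) + (\<Sum>\<^sub>\<infinity>w\<in>far R. zterm w z))) (at z)"
    unfolding P_def S_def by (rule DERIV_cong_ev[OF refl lattice_sigma_nhds[OF z] refl, THEN iffD1])
  then have "(lattice_sigma L has_field_derivative
     lattice_sigma L z * (1 / z + ((\<Sum>w\<in>near R. zterm w z) + (\<Sum>\<^sub>\<infinity>w\<in>far R. zterm w z)))) (at z)"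
    by (simp only: lattice_sigma_local[OF z] P_def S_def add.assoc)
  then have "deriv (lattice_sigma L) z = lattice_sigma L z * (1 / z + (\<Sum>\<^sub>\<infinity>w\<in>L-{0}. zterm w z))"
    unfolding infsum_zterm_split[OF z] by (rule DERIV_imp_deriv)
  then show ?thesis using assms by (simp add: lattice_zeta_def lattice_sigma_eq_0_iff)
qed

lemma deriv_sigma_0 [simp]: "deriv (lattice_sigma L) 0 = 1"
proof -
  define P where "P = (\<lambda>z. (\<Prod>w\<in>near 1. wfactor w z))"
  have P: "(P has_field_derivative P 0 * (\<Sum>w\<in>near 1. zterm w 0)) (at 0)"
    unfolding P_def by (intro has_field_derivative_prod_log finite_near) auto
  have "((\<lambda>z. z * P z * exp (\<Sum>\<^sub>\<infinity>w\<in>far 1. wlog w z)) has_field_derivative 1) (at 0)"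
    by (rule derivative_eq_intros refl has_field_derivative_wlog_sum P | simp)+ (simp add: P_def)
  then have "(lattice_sigma L has_field_derivative 1) (at 0)"
    unfolding P_def by (rule DERIV_cong_ev[OF refl lattice_sigma_nhds refl, THEN iffD1, rotated]) simp
  then show ?thesis by (rule DERIV_imp_deriv)
qed

lemma lattice_sigma_uminus: "lattice_sigma L (- z) = - lattice_sigma L z"
proof -
  define R where "R = norm z + 1"
  have z: "norm z < R" by (auto simp: R_def)
  have "(\<Prod>w\<in>near R. wfactor w (-z)) = (\<Prod>w\<in>near R. wfactor w z)"
    by (rule prod.reindex_bij_witness[of _ uminus uminus]) (auto simp: wfactor_def)
  moreover have "(\<Sum>\<^sub>\<infinity>w\<in>far R. wlog w (-z)) = (\<Sum>\<^sub>\<infinity>w\<in>far R. wlog w z)"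
    by (rule infsum_reindex_bij_witness[of _ uminus uminus]) (auto simp: wlog_def)
  ultimately show ?thesis using z lattice_sigma_local[of z R] lattice_sigma_local[of "-z" R] by simp
qed

lemma deriv_zeta:
  assumes z: "z \<notin> L"
  shows "(lattice_zeta L has_field_derivative - (1 / z\<^sup>2 + (\<Sum>\<^sub>\<infinity>w\<in>L - {0}. pterm w z))) (at z)"
proof -
  define R where "R = norm z + 1"
  have zR: "norm z < R" by (auto simp: R_def)
  have zt: "(zterm w has_field_derivative - pterm w y) (at y)" if "w \<noteq> 0" "y \<noteq> w" for w y
  proof -
    have "((\<lambda>z. 1 / (z - w) + 1 / w + z / w\<^sup>2) has_field_derivative - pterm w y) (at y)"
      using that by (auto intro!: derivative_eq_intros simp: pterm_def power2_eq_square)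
    then show ?thesis
      by (rule DERIV_cong_ev[OF refl _ refl, THEN iffD1, rotated])
         (rule eventually_mono[OF eventually_nhds_in_open[of "-{w}" y]], use that in \<open>auto simp: zterm_alt\<close>)
  qed
  have A: "((\<lambda>z. \<Sum>\<^sub>\<infinity>w\<in>far R. zterm w z) has_field_derivative (\<Sum>\<^sub>\<infinity>w\<in>far R. - pterm w z)) (at z)"
  proof (rule has_field_derivative_infsum(1)[of "ball 0 R"])
    show "(\<lambda>w. 2 * R^2 * (1 / norm w ^ 3)) summable_on far R" by (rule summable_far)
    fix w y :: complex assume "w \<in> far R" "y \<in> ball 0 R"
    then have yw: "norm y < R" "norm w > 2 * R" by auto
    show "norm (zterm w y) \<le> 2 * R^2 * (1 / norm w ^ 3)" by (rule norm_zterm[OF yw])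
    show "(zterm w has_field_derivative - pterm w y) (at y)" by (rule zt[OF far_point(1,2)[OF yw]])
  qed (use zR in auto)
  have B: "((\<lambda>z. \<Sum>w\<in>near R. zterm w z) has_field_derivative (\<Sum>w\<in>near R. - pterm w z)) (at z)"
    using z by (intro DERIV_sum zt) auto
  have z0: "z \<noteq> 0" using z by auto
  have "((\<lambda>z. 1/z + ((\<Sum>w\<in>near R. zterm w z) + (\<Sum>\<^sub>\<infinity>w\<in>far R. zterm w z))) has_field_derivative
     - (1 / z\<^sup>2 + ((\<Sum>w\<in>near R. pterm w z) + (\<Sum>\<^sub>\<infinity>w\<in>far R. pterm w z)))) (at z)"
  proof -
    have "((\<lambda>z. 1/z) has_field_derivative - (1 / z\<^sup>2)) (at z)"
      using z0 by (auto intro!: derivative_eq_intros simp: power2_eq_square)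
    from DERIV_add[OF this DERIV_add[OF B A]] show ?thesis
      by (simp add: sum_negf infsum_uminus)
  qed
  then have "(lattice_zeta L has_field_derivative
     - (1 / z\<^sup>2 + ((\<Sum>w\<in>near R. pterm w z) + (\<Sum>\<^sub>\<infinity>w\<in>far R. pterm w z)))) (at z)"
  proof (rule DERIV_cong_ev[OF refl _ refl, THEN iffD1, rotated])
    have "\<forall>\<^sub>F x in nhds z. x \<in> ball 0 R \<inter> (-L)"
      using z zR by (intro eventually_nhds_in_open open_Int open_compl) auto
    then show "\<forall>\<^sub>F x in nhds z. 1 / x + ((\<Sum>w\<in>near R. zterm w x) + (\<Sum>\<^sub>\<infinity>w\<in>far R. zterm w x)) = lattice_zeta L x"
    proof eventually_elim
      case (elim x)
      then have "norm x < R" "x \<notin> L" by auto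
      then show ?case by (simp add: lattice_zeta_eq infsum_zterm_split)
    qed
  qed
  then show ?thesis by (simp only: infsum_pterm_split[OF zR])
qed

lemma lattice_wp_eq:
  assumes z: "z \<notin> L" shows "lattice_wp L z = 1 / z\<^sup>2 + (\<Sum>\<^sub>\<infinity>w\<in>L - {0}. pterm w z)"
  using DERIV_imp_deriv[OF deriv_zeta[OF z]] by (simp add: lattice_wp_def)

lemma summable_pterm: "(\<lambda>w. pterm w z) summable_on (L - {0})"
  by (rule summable_from_far(2)[where c = "10 * (norm z + 1)" and R = "norm z + 1"], rule norm_pterm) auto

lemma has_field_derivative_zeta:
  "z \<notin> L \<Longrightarrow> (lattice_zeta L has_field_derivative - lattice_wp L z) (at z)"
  using deriv_zeta[of z] lattice_wp_eq[of z] by simp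

lemma holomorphic_zeta: "lattice_zeta L holomorphic_on - L"
  by (auto simp: holomorphic_on_open open_compl intro!: exI has_field_derivative_zeta)

lemma holomorphic_wp: "lattice_wp L holomorphic_on - L"
  unfolding lattice_wp_def by (intro holomorphic_intros holomorphic_zeta open_compl)

lemma has_field_derivative_wp:
  "z \<notin> L \<Longrightarrow> (lattice_wp L has_field_derivative deriv (lattice_wp L) z) (at z)"
  by (rule holomorphic_derivI[OF holomorphic_wp open_compl]) auto

lemma has_field_derivative_wp':
  "z \<notin> L \<Longrightarrow> (deriv (lattice_wp L) has_field_derivative deriv (deriv (lattice_wp L)) z) (at z)"
  by (rule holomorphic_derivI[OF holomorphic_deriv[OF holomorphic_wp open_compl] open_compl]) auto

lemma has_field_derivative_sigma: 
  "z \<notin> L \<Longrightarrow> (lattice_sigma L has_field_derivative lattice_sigma L z * lattice_zeta L z) (at z)"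
  using deriv_sigma[of z] by (simp add: lattice_zeta_def lattice_sigma_eq_0_iff)

lemma lattice_wp_uminus: assumes "z \<notin> L" shows "lattice_wp L (- z) = lattice_wp L z"
proof -
  have "(\<Sum>\<^sub>\<infinity>w\<in>L - {0}. pterm w (-z)) = (\<Sum>\<^sub>\<infinity>w\<in>L - {0}. pterm w z)"
    by (rule infsum_reindex_bij_witness[of _ uminus uminus]) (auto simp: pterm_def power2_commute algebra_simps power2_eq_square)
  then show ?thesis using assms by (simp add: lattice_wp_eq)
qed

end

section \<open>Periodicity and elliptic functions\<close>

context complex_lattice begin

lemma ex_not_mem: "\<exists>z. z \<notin> L"
proof (rule ccontr)
  assume "\<not> (\<exists>z. z \<notin> L)"
  then have "L = UNIV" by auto
  then show False using countable_lattice uncountable_UNIV_complex by simp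
qed

text \<open>The period 0 is included, with subtracted term 0, so that the index set is the whole
  lattice and is mapped to itself by translations.\<close>

lemma lattice_wp_has_sum:
  assumes z: "z \<notin> L"
  shows "((\<lambda>w. 1 / (z - w)\<^sup>2 - (if w = 0 then 0 else 1 / w\<^sup>2)) has_sum lattice_wp L z) L"
proof -
  let ?q = "\<lambda>w. 1 / (z - w)\<^sup>2 - (if w = 0 then 0 else 1 / w\<^sup>2)"
  have "((\<lambda>w. pterm w z) has_sum (\<Sum>\<^sub>\<infinity>w\<in>L - {0}. pterm w z)) (L - {0})"
    by (rule has_sum_infsum[OF summable_pterm])
  also have "((\<lambda>w. pterm w z) has_sum (\<Sum>\<^sub>\<infinity>w\<in>L - {0}. pterm w z)) (L - {0}) \<longleftrightarrow>
      (?q has_sum (\<Sum>\<^sub>\<infinity>w\<in>L - {0}. pterm w z)) (L - {0})"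
    by (rule has_sum_cong) (simp add: pterm_def)
  finally have "(?q has_sum (?q 0 + (\<Sum>\<^sub>\<infinity>w\<in>L - {0}. pterm w z))) (insert 0 (L - {0}))"
    by (rule has_sum_insert[rotated]) simp
  moreover have "insert 0 (L - {0}) = L" by (rule insert_Diff) simp
  ultimately show ?thesis by (simp add: lattice_wp_eq[OF z])
qed

text \<open>Reindexing shows that wp(z + w0) - wp(z) is the sum of c v - c (v + w0), which is
  independent of z. Evenness turns its value at -z - w0 into the negative of its value at z, so the
  constant is 0.\<close>

lemma lattice_wp_periodic:
  assumes z: "z \<notin> L" and w0: "w0 \<in> L"
  shows "lattice_wp L (z + w0) = lattice_wp L z"
proof -
  define c where "c = (\<lambda>w::complex. if w = 0 then 0 else 1 / w\<^sup>2)"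
  have K: "((\<lambda>v. c v - c (v + w0)) has_sum (lattice_wp L (z + w0) - lattice_wp L z)) L" if z: "z \<notin> L" for z
  proof -
    have zw: "z + w0 \<notin> L" using z w0 by (simp add: add_mem_iff)
    have bij: "bij_betw (\<lambda>v. v + w0) L L"
      by (rule bij_betwI[where g = "\<lambda>v. v - w0"]) (auto intro: add_mem diff_mem w0)
    have "((\<lambda>w. 1 / (z + w0 - w)\<^sup>2 - c w) has_sum lattice_wp L (z + w0)) L"
      using lattice_wp_has_sum[OF zw] by (simp only: c_def)
    then have "((\<lambda>v. 1 / (z + w0 - (v + w0))\<^sup>2 - c (v + w0)) has_sum lattice_wp L (z + w0)) L"
      by (subst has_sum_reindex_bij_betw[OF bij, of "\<lambda>w. 1 / (z + w0 - w)\<^sup>2 - c w"])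
    then have 1: "((\<lambda>v. 1 / (z - v)\<^sup>2 - c (v + w0)) has_sum lattice_wp L (z + w0)) L" by simp
    have 2: "((\<lambda>v. - (1 / (z - v)\<^sup>2 - c v)) has_sum - lattice_wp L z) L"
      using lattice_wp_has_sum[OF z] by (subst has_sum_uminus) (simp only: c_def minus_minus)
    from has_sum_add[OF 1 2] show ?thesis by simp
  qed
  have e: "- z - w0 = - (z + w0)" "- z - w0 + w0 = - z" by simp_all
  have z': "- z - w0 \<notin> L" using add_mem_iff[OF w0, of z] uminus_mem_iff[of "z + w0"] z by simp
  have "lattice_wp L (z + w0) - lattice_wp L z = lattice_wp L (- z - w0 + w0) - lattice_wp L (- z - w0)"
    using K[OF z] K[OF z'] by (rule has_sum_unique)
  also have "\<dots> = lattice_wp L (- z) - lattice_wp L (- (z + w0))" unfolding e(2) unfolding e(1) by (rule refl)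
  also have "\<dots> = lattice_wp L z - lattice_wp L (z + w0)"
    using z z' lattice_wp_uminus[of z] lattice_wp_uminus[of "z + w0"] uminus_mem_iff[of "z + w0"] by simp
  finally show ?thesis by (simp add: algebra_simps)
qed

lemma periodic_deriv:
  assumes f: "f holomorphic_on - L" and per: "\<And>z w. z \<notin> L \<Longrightarrow> w \<in> L \<Longrightarrow> f (z + w) = f z"
    and z: "z \<notin> L" and w: "w \<in> L"
  shows "deriv f (z + w) = deriv f z"
proof -
  have "z + w \<notin> L" using z w by (simp add: add_mem_iff)
  then have "(f has_field_derivative deriv f (z + w)) (at (z + w))"
    by (intro holomorphic_derivI[OF f open_compl]) auto
  then have "((\<lambda>z. f (z + w)) has_field_derivative deriv f (z + w)) (at z)"
    by (simp only: DERIV_shift)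
  moreover have "\<forall>\<^sub>F x in nhds z. f (x + w) = f x"
    by (rule eventually_mono[OF eventually_nhds_in_open[OF open_compl]]) (use z per w in auto)
  ultimately have "(f has_field_derivative deriv f (z + w)) (at z)"
    by (rule DERIV_cong_ev[OF refl _ refl, THEN iffD1, rotated])
  then show ?thesis by (simp add: DERIV_imp_deriv)
qed

lemma fundamental_bound: obtains R where "\<And>z. \<exists>w\<in>L. norm (z - w) \<le> R"
proof (rule basis)
  fix w1 w2 assume L: "L = {of_int m * w1 + of_int n * w2 | m n :: int. True}" and im: "Im (w2/w1) \<noteq> 0"
  define \<tau> where "\<tau> = w2/w1"
  have w1: "w1 \<noteq> 0" using im by auto
  have w2: "w2 = w1 * \<tau>" using w1 by (simp add: \<tau>_def)
  have "\<exists>w\<in>L. norm (z - w) \<le> norm w1 + norm w2" for z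
  proof -
    define t where "t = Im (z/w1) / Im \<tau>"
    define s where "s = Re (z/w1) - t * Re \<tau>"
    have "Im \<tau> \<noteq> 0" using im by (simp add: \<tau>_def)
    then have "z / w1 = of_real s + of_real t * \<tau>"
      by (simp add: complex_eq_iff s_def t_def)
    then have z: "z = of_real s * w1 + of_real t * w2" using w1 by (simp add: w2 field_simps)
    let ?w = "of_int \<lfloor>s\<rfloor> * w1 + of_int \<lfloor>t\<rfloor> * w2"
    have "z - ?w = of_real (frac s) * w1 + of_real (frac t) * w2"
      by (simp add: z frac_def algebra_simps)
    also have "norm \<dots> \<le> norm (of_real (frac s) * w1) + norm (of_real (frac t) * w2)" by (rule norm_triangle_ineq)
    also have "\<dots> \<le> 1 * norm w1 + 1 * norm w2"
      unfolding norm_mult using frac_lt_1[of s] frac_lt_1[of t] frac_ge_0[of s] frac_ge_0[of t]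
      by (intro add_mono mult_right_mono) auto
    finally show ?thesis using L by (intro bexI[of _ ?w]) auto
  qed
  then show ?thesis by (rule that)
qed

text \<open>Only the behaviour at 0 must be checked: periodicity carries the removable singularity
  to every period. The resulting entire function takes all its values on one compact disc, so
  Liouville's theorem applies.\<close>

lemma elliptic_const:
  assumes f: "f holomorphic_on - L" and per: "\<And>z w. z \<notin> L \<Longrightarrow> w \<in> L \<Longrightarrow> f (z + w) = f z"
    and lim: "(f \<longlongrightarrow> l) (at 0)" and z: "z \<notin> L"
  shows "f z = l"
proof -
  define g where "g = (\<lambda>z. if z \<in> L then l else f z)"
  obtain r where r: "r > 0" "\<And>w. w \<in> L \<Longrightarrow> w \<noteq> 0 \<Longrightarrow> r \<le> norm w" by (rule small_ball) blast
  have gper: "g (z + w) = g z" if "w \<in> L" for z w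
    using that per by (auto simp: g_def add_mem_iff)
  have "(\<lambda>y. if y = 0 then l else f y) holomorphic_on ball 0 r"
  proof (rule removable_singularity)
    show "f holomorphic_on ball 0 r - {0}"
      by (rule holomorphic_on_subset[OF f]) (use r(2) in force)
  qed (use lim in auto)
  then have g0: "g holomorphic_on ball 0 r"
    by (rule holomorphic_transform) (use r(2) in \<open>force simp: g_def\<close>)
  have "g field_differentiable at x" for x
  proof (cases "x \<in> L")
    case True
    have "g field_differentiable at 0"
      by (rule holomorphic_on_imp_differentiable_at[OF g0]) (use r in auto)
    then obtain D where "(g has_field_derivative D) (at (x + - x))" by (auto simp: field_differentiable_def)
    then have "((\<lambda>z. g (z + - x)) has_field_derivative D) (at x)" by (simp only: DERIV_shift)
    moreover have "(\<lambda>z. g (z + - x)) = g" using gper[of "-x"] True by auto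
    ultimately show ?thesis by (auto simp: field_differentiable_def)
  next
    case False
    have "g holomorphic_on - L" by (rule holomorphic_transform[OF f]) (auto simp: g_def)
    then show ?thesis using False by (intro holomorphic_on_imp_differentiable_at[OF _ open_compl]) auto
  qed
  then have g: "g holomorphic_on UNIV" by (simp add: holomorphic_on_def field_differentiable_at_within)
  obtain R where R: "\<And>z. \<exists>w\<in>L. norm (z - w) \<le> R" by (rule fundamental_bound) blast
  have "range g \<subseteq> g ` cball 0 R"
  proof clarify
    fix x obtain w where w: "w \<in> L" "norm (x - w) \<le> R" using R by blast
    have "g x = g (x - w)" using gper[OF w(1), of "x - w"] by simp
    then show "g x \<in> g ` cball 0 R" using w by auto
  qed
  moreover have "compact (g ` cball 0 R)"
    by (intro compact_continuous_image holomorphic_on_imp_continuous_on holomorphic_on_subset[OF g]) auto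
  ultimately have "bounded (range g)" using bounded_subset compact_imp_bounded by blast
  then have "g constant_on UNIV" by (rule Liouville_theorem[OF g])
  then have "g z = g 0" by (auto simp: constant_on_def)
  then show ?thesis using z by (simp add: g_def)
qed

end

section \<open>Laurent expansion and differential equations\<close>

text \<open>The tool for showing that a Laurent expansion has no pole at 0 and for reading off its
  limit there, as \<open>elliptic_const\<close> demands.\<close>

lemma tendsto_fps_quotient:
  fixes f :: "complex \<Rightarrow> complex"
  assumes f: "f has_fps_expansion F" and 0: "\<And>k. k < n \<Longrightarrow> fps_nth F k = 0"
  shows "((\<lambda>z. f z / z ^ n) \<longlongrightarrow> fps_nth F n) (at 0)"
proof (cases "F = 0")
  case True
  have "\<forall>\<^sub>F z in nhds 0. f z = 0" using f unfolding True has_fps_expansion_def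
    by (auto elim: eventually_mono)
  then have "\<forall>\<^sub>F z in at 0. f z / z ^ n = 0"
    unfolding eventually_at_filter by (rule eventually_mono) simp
  then show ?thesis unfolding True fps_zero_nth by (rule tendsto_eventually)
next
  case False
  have "(\<lambda>x. if x = 0 then fps_nth F n else f x / x ^ n) has_fps_expansion (fps_shift n F)"
    by (rule has_fps_expansion_shift[OF f subdegree_geI[OF False]]) (use 0 in auto)
  from has_fps_expansion_imp_continuous[OF this, of UNIV]
  have "((\<lambda>x. if x = 0 then fps_nth F n else f x / x ^ n) \<longlongrightarrow> fps_nth F n) (at 0)"
    by (simp add: continuous_within)
  then show ?thesis
    by (rule Lim_transform_eventually) (simp add: eventually_at_filter)
qed

definition lattice_G :: "complex set \<Rightarrow> nat \<Rightarrow> complex" where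
  "lattice_G L k = (\<Sum>\<^sub>\<infinity>w\<in>L - {0}. 1 / w ^ k)"

lemma lattice_g2_eq: "lattice_g2 L = 60 * lattice_G L 4"
  and lattice_g3_eq: "lattice_g3 L = 140 * lattice_G L 6"
  by (simp_all add: lattice_g2_def lattice_g3_def lattice_G_def)

text \<open>The part of wp left after removing the double pole at 0. Unlike
  \<open>lattice_wp\<close>, it is holomorphic through 0.\<close>

definition wp_reg :: "complex set \<Rightarrow> complex \<Rightarrow> complex" where
  "wp_reg L z = (\<Sum>\<^sub>\<infinity>w\<in>L - {0}. pterm w z)"

context complex_lattice begin

lemma lattice_G_odd: assumes "odd k" shows "lattice_G L k = 0"
proof -
  have "lattice_G L k = (\<Sum>\<^sub>\<infinity>w\<in>L - {0}. 1 / (- w) ^ k)"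
    unfolding lattice_G_def by (rule infsum_uminus_lattice)
  also have "\<dots> = (\<Sum>\<^sub>\<infinity>w\<in>L - {0}. - (1 / w ^ k))"
    using assms by (intro infsum_cong) (simp add: power_minus_odd)
  also have "\<dots> = - lattice_G L k" unfolding lattice_G_def by (rule infsum_uminus)
  finally show ?thesis by simp
qed

lemma wp_reg_derivs:
  obtains R where "R > 0" "\<And>z. z \<in> ball 0 R \<Longrightarrow> z \<noteq> 0 \<Longrightarrow> z \<notin> L"
    "wp_reg L holomorphic_on ball 0 R"
    "\<And>k. k \<ge> 1 \<Longrightarrow> (deriv ^^ k) (wp_reg L) 0 = fact (k + 1) * lattice_G L (k + 2)"
proof -
  obtain r where r: "r > 0" "\<And>w. w \<in> L \<Longrightarrow> w \<noteq> 0 \<Longrightarrow> r \<le> norm w" by (rule small_ball) blast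
  \<comment> \<open>Every nonzero period then has norm greater than 2R, so the estimates for far
    periods apply to all of them on the ball of radius R.\<close>
  define R where "R = r / 3"
  have R: "R > 0" using r by (simp add: R_def)
  have far: "norm w > 2 * R" if "w \<in> L - {0}" for w using r(2)[of w] r(1) that by (simp add: R_def)
  \<comment> \<open>The k-th z-derivative of \<open>pterm w\<close>. The case k = 0 is separate
    because the subtracted constant 1/w^2 disappears only after the first derivative.\<close>
  define t where "t = (\<lambda>k w z::complex. if k = 0 then pterm w z else (-1)^k * fact (k+1) / (z - w)^(k+2))"
  define D where "D = (\<lambda>k z. \<Sum>\<^sub>\<infinity>w\<in>L - {0}. t k w z)"
  have der_t: "(t k w has_field_derivative t (Suc k) w z) (at z)" if "z \<noteq> w" for k w z
  proof -
    have inv: "((\<lambda>z. 1 / (z - w) ^ Suc n) has_field_derivative - of_nat (Suc n) / (z - w) ^ Suc (Suc n)) (at z)" for n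
    proof -
      have "((\<lambda>z. inverse ((z - w) ^ Suc n)) has_field_derivative
          - (inverse ((z - w) ^ Suc n) * (of_nat (Suc n) * (z - w) ^ n) * inverse ((z - w) ^ Suc n))) (at z)"
        by (rule DERIV_inverse'[OF DERIV_cong[OF DERIV_power[OF DERIV_diff[OF DERIV_ident DERIV_const]]]]) (use that in auto)
      also have "- (inverse ((z - w) ^ Suc n) * (of_nat (Suc n) * (z - w) ^ n) * inverse ((z - w) ^ Suc n))
         = - of_nat (Suc n) / (z - w) ^ Suc (Suc n)"
        using that by (simp add: divide_simps)
      finally show ?thesis by (simp only: inverse_eq_divide)
    qed
    show ?thesis
    proof (cases "k = 0")
      case True
      have "((\<lambda>z. 1 / (z - w) ^ Suc 1 - 1 / w\<^sup>2) has_field_derivative - of_nat (Suc 1) / (z - w) ^ Suc (Suc 1) - 0) (at z)"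
        by (intro DERIV_diff inv DERIV_const)
      then show ?thesis using True by (simp add: t_def pterm_def[abs_def] numeral_2_eq_2 numeral_3_eq_3)
    next
      case False
      have "((\<lambda>z. ((-1)^k * fact (k+1)) * (1 / (z - w) ^ Suc (k+1))) has_field_derivative
         ((-1)^k * fact (k+1)) * (- of_nat (Suc (k+1)) / (z - w) ^ Suc (Suc (k+1)))) (at z)"
        by (rule DERIV_cmult[OF inv])
      moreover have "s * f * (- n / p) = (-1 * s) * (n * f) / p" for s f n p :: complex by simp
      ultimately have "((\<lambda>z. (-1)^k * fact (k+1) * (1 / (z - w) ^ Suc (k+1))) has_field_derivative
         (-1)^Suc k * fact (Suc (k+1)) / (z - w) ^ Suc (Suc (k+1))) (at z)"
        by (simp only: power_Suc fact_Suc)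
      then show ?thesis using False by (simp add: t_def[abs_def] del: fact_Suc power_Suc)
    qed
  qed
  have der: "(D k has_field_derivative D (Suc k) z) (at z)" if z: "z \<in> ball 0 R" for k z
  proof -
    have fp: "norm (z - w) > norm w / 2" "norm w > 0" "z \<noteq> w" if "z \<in> ball 0 R" "w \<in> L - {0}" for z w
      using far_point[OF _ far[OF that(2)], of z] that(1) by auto
    have "\<exists>M. M summable_on (L - {0}) \<and> (\<forall>w\<in>L - {0}. \<forall>z\<in>ball 0 R. norm (t k w z) \<le> M w)"
    proof (cases "k = 0")
      case True
      have "norm (pterm w z) \<le> 10 * R * (1 / norm w ^ 3)" if "w \<in> L - {0}" "z \<in> ball 0 R" for w z
        using norm_pterm[OF _ far[OF that(1)], of z] that(2) by simp
      then show ?thesis using True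
        by (intro exI[of _ "\<lambda>w. 10 * R * (1 / norm w ^ 3)"] conjI summable_on_cmult_right summable_cubed)
           (auto simp: t_def)
    next
      case False
      let ?c = "fact (k+1) * 2^(k+2) :: real"
      have "norm (t k w z) \<le> ?c * (1 / norm w ^ (k+2))" if "w \<in> L - {0}" "z \<in> ball 0 R" for w z
      proof -
        have "norm (t k w z) = fact (k+1) / norm (z - w) ^ (k+2)"
          using False by (simp add: t_def norm_divide norm_mult norm_power del: fact_Suc)
        also have "\<dots> \<le> fact (k+1) / (norm w / 2) ^ (k+2)"
          using fp[OF that(2,1)] by (intro divide_left_mono power_mono mult_pos_pos zero_less_power) auto
        also have "\<dots> = ?c * (1 / norm w ^ (k+2))" by (simp add: power_divide del: fact_Suc)
        finally show ?thesis .
      qed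
      then show ?thesis using False
        by (intro exI[of _ "\<lambda>w. ?c * (1 / norm w ^ (k+2))"] conjI summable_on_cmult_right summable_high_power) auto
    qed
    then obtain M where M: "M summable_on (L - {0})" "\<And>w z. w \<in> L - {0} \<Longrightarrow> z \<in> ball 0 R \<Longrightarrow> norm (t k w z) \<le> M w" by blast
    show ?thesis unfolding D_def
      by (rule has_field_derivative_infsum(1)[OF open_ball z M(1)]) (use M(2) fp der_t in blast)+
  qed
  have hD: "(deriv ^^ k) (wp_reg L) z = D k z" if "z \<in> ball 0 R" for k z
    using that
  proof (induction k arbitrary: z)
    case 0
    then show ?case by (simp add: D_def wp_reg_def t_def)
  next
    case (Suc k)
    have "\<forall>\<^sub>F y in nhds z. (deriv ^^ k) (wp_reg L) y = D k y"
      by (rule eventually_mono[OF eventually_nhds_in_open[OF open_ball Suc.prems]]) (rule Suc.IH)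
    then have "deriv ((deriv ^^ k) (wp_reg L)) z = deriv (D k) z" by (rule deriv_cong_ev) simp
    then show ?case using DERIV_imp_deriv[OF der[OF Suc.prems]] by simp
  qed
  show ?thesis
  proof (rule that[OF R])
    show "z \<notin> L" if "z \<in> ball 0 R" "z \<noteq> 0" for z
      using far[of z] that R by auto
    have eq: "wp_reg L = D 0" using hD[of _ 0] by (auto simp: D_def wp_reg_def t_def)
    show "wp_reg L holomorphic_on ball 0 R"
      unfolding eq holomorphic_on_open[OF open_ball] by (intro ballI exI, rule der)
    show "(deriv ^^ k) (wp_reg L) 0 = fact (k + 1) * lattice_G L (k + 2)" if "k \<ge> 1" for k
    proof -
      have "t k w 0 = fact (k+1) * (1 / w ^ (k+2))" for w
        using that by (cases "even k") (auto simp: t_def power_minus_odd simp del: fact_Suc)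
      then have "D k 0 = fact (k+1) * lattice_G L (k+2)"
        unfolding D_def lattice_G_def by (simp only: infsum_cmult_right')
      then show ?thesis using hD[of 0 k] R by simp
    qed
  qed
qed

definition wpF :: "complex fps" where "wpF = fps_expansion (wp_reg L) 0"

lemma wp_reg_0 [simp]: "wp_reg L 0 = 0" by (simp add: wp_reg_def pterm_def)

lemma wp_reg_expansion: "wp_reg L has_fps_expansion wpF"
proof (rule wp_reg_derivs)
  fix R assume "R > 0" "wp_reg L holomorphic_on ball 0 R"
  then have "wp_reg L analytic_on {0}" by (auto simp: analytic_at intro!: exI[of _ "ball 0 R"])
  then show ?thesis unfolding wpF_def by (rule analytic_at_imp_has_fps_expansion_0)
qed

lemma wpF_nth:
  assumes "k \<ge> 1" shows "fps_nth wpF k = of_nat (k + 1) * lattice_G L (k + 2)"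
proof -
  have "(deriv ^^ k) (wp_reg L) 0 = fact (k + 1) * lattice_G L (k + 2)"
    by (rule wp_reg_derivs) (use assms in blast)
  moreover have "fact (k + 1) = (of_nat (k + 1) * fact k :: complex)" by simp
  ultimately show ?thesis using fps_nth_fps_expansion[OF wp_reg_expansion, of k] by simp
qed

lemma wpF_0: "fps_nth wpF 0 = 0"
  using fps_nth_fps_expansion[OF wp_reg_expansion, of 0] by simp

text \<open>The coefficients are 3 G_4 and 5 G_6, while g2 = 60 G_4 and g3 = 140 G_6.\<close>

lemma wpF_small: "fps_nth wpF (Suc 0) = 0" "fps_nth wpF 2 = lattice_g2 L / 20" "fps_nth wpF 3 = 0"
  "fps_nth wpF 4 = lattice_g3 L / 28"
  using wpF_nth[of 1] wpF_nth[of 2] wpF_nth[of 3] wpF_nth[of 4] lattice_G_odd[of 3] lattice_G_odd[of 5] lattice_G_odd[of "Suc (Suc (Suc 0))"]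
  by (simp_all add: lattice_g2_eq lattice_g3_eq)

lemma wp_near_0:
  obtains R where "R > 0" "\<And>z. z \<in> ball 0 R \<Longrightarrow> z \<noteq> 0 \<Longrightarrow> z \<notin> L"
    "wp_reg L holomorphic_on ball 0 R"
    "\<And>z. z \<in> ball 0 R \<Longrightarrow> z \<noteq> 0 \<Longrightarrow> lattice_wp L z = 1 / z\<^sup>2 + wp_reg L z"
    "\<And>z. z \<in> ball 0 R \<Longrightarrow> z \<noteq> 0 \<Longrightarrow> deriv (lattice_wp L) z = - 2 / z ^ 3 + deriv (wp_reg L) z"
    "\<And>z. z \<in> ball 0 R \<Longrightarrow> z \<noteq> 0 \<Longrightarrow> deriv (deriv (lattice_wp L)) z = 6 / z ^ 4 + deriv (deriv (wp_reg L)) z"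
proof (rule wp_reg_derivs)
  fix R assume R: "R > 0" and nL: "\<And>z. z \<in> ball 0 R \<Longrightarrow> z \<noteq> 0 \<Longrightarrow> z \<notin> L"
    and hol: "wp_reg L holomorphic_on ball 0 R"
  have op: "open (ball 0 R - {0::complex})" by auto
  have 0: "lattice_wp L z = 1 / z\<^sup>2 + wp_reg L z" if "z \<in> ball 0 R - {0}" for z
    using lattice_wp_eq[OF nL] that by (simp add: wp_reg_def)
  have 1: "deriv (lattice_wp L) z = - 2 / z ^ 3 + deriv (wp_reg L) z" if z: "z \<in> ball 0 R - {0}" for z
  proof -
    have "((\<lambda>z. 1 / z\<^sup>2 + wp_reg L z) has_field_derivative - 2 / z ^ 3 + deriv (wp_reg L) z) (at z)"
    proof (rule DERIV_add)
      show "((\<lambda>z. 1 / z\<^sup>2) has_field_derivative - 2 / z ^ 3) (at z)"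
        using z by (auto intro!: derivative_eq_intros simp: field_simps power2_eq_square power3_eq_cube)
      show "(wp_reg L has_field_derivative deriv (wp_reg L) z) (at z)"
        using z by (intro holomorphic_derivI[OF hol]) auto
    qed
    then have "deriv (\<lambda>z. 1 / z\<^sup>2 + wp_reg L z) z = - 2 / z ^ 3 + deriv (wp_reg L) z" by (rule DERIV_imp_deriv)
    moreover have "deriv (lattice_wp L) z = deriv (\<lambda>z. 1 / z\<^sup>2 + wp_reg L z) z"
      by (rule deriv_cong_ev[OF eventually_mono[OF eventually_nhds_in_open[OF op z] 0] refl])
    ultimately show ?thesis by simp
  qed
  have 2: "deriv (deriv (lattice_wp L)) z = 6 / z ^ 4 + deriv (deriv (wp_reg L)) z" if z: "z \<in> ball 0 R - {0}" for z
  proof -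
    have "((\<lambda>z. - 2 / z ^ 3 + deriv (wp_reg L) z) has_field_derivative 6 / z ^ 4 + deriv (deriv (wp_reg L)) z) (at z)"
    proof (rule DERIV_add)
      show "((\<lambda>z. - 2 / z ^ 3) has_field_derivative 6 / z ^ 4) (at z)"
        using z by (auto intro!: derivative_eq_intros simp: divide_simps)
      show "(deriv (wp_reg L) has_field_derivative deriv (deriv (wp_reg L)) z) (at z)"
        using z by (intro holomorphic_derivI[OF holomorphic_deriv[OF hol]]) auto
    qed
    then have "deriv (\<lambda>z. - 2 / z ^ 3 + deriv (wp_reg L) z) z = 6 / z ^ 4 + deriv (deriv (wp_reg L)) z" by (rule DERIV_imp_deriv)
    moreover have "deriv (deriv (lattice_wp L)) z = deriv (\<lambda>z. - 2 / z ^ 3 + deriv (wp_reg L) z) z"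
      by (rule deriv_cong_ev[OF eventually_mono[OF eventually_nhds_in_open[OF op z] 1] refl])
    ultimately show ?thesis by simp
  qed
  show ?thesis
    by (rule that[OF R nL hol]) (use 0 1 2 in auto)
qed

lemma eventually_at_0_ball: "R > 0 \<Longrightarrow> \<forall>\<^sub>F z in at (0::complex). z \<in> ball 0 R \<and> z \<noteq> 0"
  by (auto simp: eventually_at dist_norm intro!: exI[of _ R])

lemma wp_reg_limits:
  shows "((\<lambda>z. wp_reg L z) \<longlongrightarrow> 0) (at 0)"
    and "((\<lambda>z. deriv (wp_reg L) z) \<longlongrightarrow> 0) (at 0)"
    and "((\<lambda>z. deriv (deriv (wp_reg L)) z) \<longlongrightarrow> lattice_g2 L / 10) (at 0)"
    and "((\<lambda>z. wp_reg L z / z ^ 2) \<longlongrightarrow> lattice_g2 L / 20) (at 0)"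
    and "((\<lambda>z. (wp_reg L z - lattice_g2 L / 20 * z ^ 2) / z ^ 4) \<longlongrightarrow> lattice_g3 L / 28) (at 0)"
    and "((\<lambda>z. (deriv (wp_reg L) z - lattice_g2 L / 10 * z) / z ^ 3) \<longlongrightarrow> lattice_g3 L / 7) (at 0)"
proof -
  note F = wp_reg_expansion and F1 = has_fps_expansion_deriv[OF wp_reg_expansion]
  note F2 = has_fps_expansion_deriv[OF F1]
  show "((\<lambda>z. wp_reg L z) \<longlongrightarrow> 0) (at 0)"
    using tendsto_fps_quotient[OF F, of 0] by (simp add: wpF_0)
  show "((\<lambda>z. deriv (wp_reg L) z) \<longlongrightarrow> 0) (at 0)"
    using tendsto_fps_quotient[OF F1, of 0] by (simp add: wpF_small)
  show "((\<lambda>z. deriv (deriv (wp_reg L)) z) \<longlongrightarrow> lattice_g2 L / 10) (at 0)"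
    using tendsto_fps_quotient[OF F2, of 0] by (simp add: wpF_small numeral_2_eq_2[symmetric])
  show "((\<lambda>z. wp_reg L z / z ^ 2) \<longlongrightarrow> lattice_g2 L / 20) (at 0)"
  proof -
    have "fps_nth wpF k = 0" if "k < 2" for k using that by (auto simp: less_2_cases_iff wpF_0 wpF_small)
    then have "((\<lambda>z. wp_reg L z / z ^ 2) \<longlongrightarrow> fps_nth wpF 2) (at 0)" by (rule tendsto_fps_quotient[OF F])
    then show ?thesis by (simp add: wpF_small)
  qed
  have "(\<lambda>z. wp_reg L z - lattice_g2 L / 20 * z ^ 2) has_fps_expansion wpF - fps_const (lattice_g2 L / 20) * fps_X ^ 2"
    by (intro fps_expansion_intros F)
  note exp4 = this
  have "fps_nth (wpF - fps_const (lattice_g2 L / 20) * fps_X ^ 2) k = 0" if "k < 4" for k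
  proof -
    have "k = 0 \<or> k = Suc 0 \<or> k = 2 \<or> k = 3" using that by arith
    then show ?thesis by (elim disjE) (simp_all add: wpF_small wpF_0 fps_X_power_nth)
  qed
  from tendsto_fps_quotient[where n = 4, OF exp4 this]
  show "((\<lambda>z. (wp_reg L z - lattice_g2 L / 20 * z ^ 2) / z ^ 4) \<longlongrightarrow> lattice_g3 L / 28) (at 0)"
    by (simp add: wpF_small fps_X_power_nth)
  have exp3: "(\<lambda>z. deriv (wp_reg L) z - lattice_g2 L / 10 * z) has_fps_expansion fps_deriv wpF - fps_const (lattice_g2 L / 10) * fps_X"
    by (intro fps_expansion_intros F1)
  have "fps_nth (fps_deriv wpF - fps_const (lattice_g2 L / 10) * fps_X) k = 0" if "k < 3" for k
  proof -
    have "k = 0 \<or> k = Suc 0 \<or> k = 2" using that by arith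
    then show ?thesis using wpF_small by (elim disjE) (simp_all add: numeral_2_eq_2 numeral_3_eq_3 mult.commute)
  qed
  from tendsto_fps_quotient[OF exp3 this]
  have "((\<lambda>z. (deriv (wp_reg L) z - lattice_g2 L / 10 * z) / z ^ 3) \<longlongrightarrow>
      fps_nth (fps_deriv wpF - fps_const (lattice_g2 L / 10) * fps_X) 3) (at 0)" .
  moreover have "fps_nth (fps_deriv wpF - fps_const (lattice_g2 L / 10) * fps_X) 3 = lattice_g3 L / 7"
    using wpF_small(4) by (simp add: mult.commute)
  ultimately show "((\<lambda>z. (deriv (wp_reg L) z - lattice_g2 L / 10 * z) / z ^ 3) \<longlongrightarrow> lattice_g3 L / 7) (at 0)"
    by (simp only:)
qed

lemma holomorphic_wp': "deriv (lattice_wp L) holomorphic_on - L"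
  and holomorphic_wp'': "deriv (deriv (lattice_wp L)) holomorphic_on - L"
  by (intro holomorphic_deriv holomorphic_wp open_compl)+

lemma wp'_periodic: "z \<notin> L \<Longrightarrow> w \<in> L \<Longrightarrow> deriv (lattice_wp L) (z + w) = deriv (lattice_wp L) z"
  by (rule periodic_deriv[OF holomorphic_wp lattice_wp_periodic])

lemma wp''_periodic: "z \<notin> L \<Longrightarrow> w \<in> L \<Longrightarrow> deriv (deriv (lattice_wp L)) (z + w) = deriv (deriv (lattice_wp L)) z"
  by (rule periodic_deriv[OF holomorphic_wp' wp'_periodic])

text \<open>The defect \<open>D\<close> is elliptic, its poles at 0 cancel, and its limit there is
  g2/10 - 12 g2/20 + g2/2 = 0. Differentiating the first-order equation instead would involve a
  division by wp'.\<close>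

lemma wp_ode2:
  assumes "z \<notin> L"
  shows "deriv (deriv (lattice_wp L)) z = 6 * lattice_wp L z ^ 2 - lattice_g2 L / 2"
proof -
  define D where "D = (\<lambda>z. deriv (deriv (lattice_wp L)) z - 6 * lattice_wp L z ^ 2 + lattice_g2 L / 2)"
  have "D z = 0"
  proof (rule elliptic_const[OF _ _ _ assms])
    show "D holomorphic_on - L" unfolding D_def by (intro holomorphic_intros holomorphic_wp holomorphic_wp'')
    show "D (z + w) = D z" if "z \<notin> L" "w \<in> L" for z w
      by (simp only: D_def wp''_periodic[OF that] lattice_wp_periodic[OF that])
    have "((\<lambda>z. deriv (deriv (wp_reg L)) z - 12 * (wp_reg L z / z ^ 2) - 6 * wp_reg L z ^ 2 + lattice_g2 L / 2)
       \<longlongrightarrow> lattice_g2 L / 10 - 12 * (lattice_g2 L / 20) - 6 * 0 ^ 2 + lattice_g2 L / 2) (at 0)"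
      by (intro tendsto_intros wp_reg_limits)
    moreover have "lattice_g2 L / 10 - 12 * (lattice_g2 L / 20) - 6 * 0 ^ 2 + lattice_g2 L / 2 = 0" by simp
    moreover have "\<forall>\<^sub>F z in at 0. deriv (deriv (wp_reg L)) z - 12 * (wp_reg L z / z ^ 2) - 6 * wp_reg L z ^ 2 + lattice_g2 L / 2 = D z"
    proof (rule wp_near_0)
      fix R assume R: "R > 0"
        and wp: "\<And>z. z \<in> ball 0 R \<Longrightarrow> z \<noteq> 0 \<Longrightarrow> lattice_wp L z = 1 / z\<^sup>2 + wp_reg L z"
          "\<And>z. z \<in> ball 0 R \<Longrightarrow> z \<noteq> 0 \<Longrightarrow> deriv (deriv (lattice_wp L)) z = 6 / z ^ 4 + deriv (deriv (wp_reg L)) z"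
      have alg: "d - 12 * (h / z\<^sup>2) - 6 * h\<^sup>2 + c = 6 / z ^ 4 + d - 6 * (1 / z\<^sup>2 + h)\<^sup>2 + c" for d h c z :: complex
      proof -
        \<comment> \<open>With i in place of 1/z the claim becomes a polynomial identity.\<close>
        define i where "i = 1 / z"
        have p: "1 / z ^ n = i ^ n" "x / z ^ n = x * i ^ n" for x n by (simp_all add: i_def power_divide)
        have "d - 12 * (h * i\<^sup>2) - 6 * h\<^sup>2 + c = 6 * i ^ 4 + d - 6 * (i\<^sup>2 + h)\<^sup>2 + c"
          by (simp add: algebra_simps power2_eq_square power4_eq_xxxx)
        then show ?thesis by (simp only: p mult_1)
      qed
      show ?thesis
        using eventually_at_0_ball[OF R]
      proof eventually_elim
        case (elim z)
        then have "z \<in> ball 0 R" "z \<noteq> 0" by auto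
        then show ?case by (simp only: D_def wp alg simp_thms)
      qed
    qed
    ultimately show "(D \<longlongrightarrow> 0) (at 0)" by (simp only: Lim_transform_eventually)
  qed
  then show ?thesis by (simp add: D_def algebra_simps)
qed

lemma wp_ode1:
  assumes "z \<notin> L"
  shows "deriv (lattice_wp L) z ^ 2 = 4 * lattice_wp L z ^ 3 - lattice_g2 L * lattice_wp L z - lattice_g3 L"
proof -
  define D where "D = (\<lambda>z. deriv (lattice_wp L) z ^ 2 - (4 * lattice_wp L z ^ 3 - lattice_g2 L * lattice_wp L z - lattice_g3 L))"
  have "D z = 0"
  proof (rule elliptic_const[OF _ _ _ assms])
    show "D holomorphic_on - L" unfolding D_def by (intro holomorphic_intros holomorphic_wp holomorphic_wp')
    show "D (z + w) = D z" if "z \<notin> L" "w \<in> L" for z w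
      by (simp only: D_def wp'_periodic[OF that] lattice_wp_periodic[OF that])
    let ?h = "wp_reg L"
    \<comment> \<open>The products of wp_reg with z^-4 and of its derivative with z^-3 are singular.
      Their leading terms are split off, leaving quotients with limits g3/28 and g3/7; the leading
      terms cancel against g2 / z^2.\<close>
    let ?u = "\<lambda>z. (?h z - lattice_g2 L / 20 * z ^ 2) / z ^ 4" and ?v = "\<lambda>z. (deriv ?h z - lattice_g2 L / 10 * z) / z ^ 3"
    let ?E = "\<lambda>z. - 4 * ?v z + deriv ?h z ^ 2 - 12 * ?u z - 12 * (?h z * (?h z / z^2)) - 4 * ?h z ^ 3 + lattice_g2 L * ?h z + lattice_g3 L"
    have "(?E \<longlongrightarrow> - 4 * (lattice_g3 L / 7) + 0 ^ 2 - 12 * (lattice_g3 L / 28) - 12 * (0 * (lattice_g2 L / 20)) - 4 * 0 ^ 3 + lattice_g2 L * 0 + lattice_g3 L) (at 0)"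
      by (intro tendsto_intros wp_reg_limits)
    moreover have "- 4 * (lattice_g3 L / 7) + 0 ^ 2 - 12 * (lattice_g3 L / 28) - 12 * (0 * (lattice_g2 L / 20)) - 4 * 0 ^ 3 + lattice_g2 L * 0 + lattice_g3 L = 0"
      by simp
    moreover have "\<forall>\<^sub>F z in at 0. ?E z = D z"
    proof (rule wp_near_0)
      fix R assume R: "R > 0"
        and wp: "\<And>z. z \<in> ball 0 R \<Longrightarrow> z \<noteq> 0 \<Longrightarrow> lattice_wp L z = 1 / z\<^sup>2 + wp_reg L z"
          "\<And>z. z \<in> ball 0 R \<Longrightarrow> z \<noteq> 0 \<Longrightarrow> deriv (lattice_wp L) z = - 2 / z ^ 3 + deriv (wp_reg L) z"
      have alg: "- 4 * ((d - a / 10 * z) / z ^ 3) + d ^ 2 - 12 * ((h - a / 20 * z ^ 2) / z ^ 4) - 12 * (h * (h / z^2)) - 4 * h ^ 3 + a * h + b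
        = (- 2 / z ^ 3 + d) ^ 2 - (4 * (1 / z ^ 2 + h) ^ 3 - a * (1 / z ^ 2 + h) - b)" if "z \<noteq> 0" for d h a b z :: complex
      proof -
        define i where "i = 1 / z"
        have zi: "z * i = 1" using that by (simp add: i_def)
        have p: "1 / z ^ n = i ^ n" "x / z ^ n = x * i ^ n" for x n by (simp_all add: i_def power_divide)
        have "z * i ^ 3 = (z * i) * i ^ 2" "z ^ 2 * i ^ 4 = (z * i) ^ 2 * i ^ 2"
          by (simp_all add: power2_eq_square power3_eq_cube power4_eq_xxxx)
        then have r: "z * i ^ 3 = i ^ 2" "z ^ 2 * i ^ 4 = i ^ 2" by (simp_all add: zi)
        have "- 4 * ((d - a / 10 * z) * i ^ 3) + d ^ 2 - 12 * ((h - a / 20 * z ^ 2) * i ^ 4) - 12 * (h * (h * i^2)) - 4 * h ^ 3 + a * h + b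
          = - 4 * d * i^3 + 2 / 5 * a * (z * i ^ 3) + d ^ 2 - 12 * h * i^4 + 3 / 5 * a * (z ^ 2 * i ^ 4) - 12 * (h * (h * i^2)) - 4 * h ^ 3 + a * h + b"
          by (simp add: algebra_simps)
        also have "\<dots> = (- 2 * i ^ 3 + d) ^ 2 - (4 * (i ^ 2 + h) ^ 3 - a * (i ^ 2 + h) - b)"
          unfolding r by (simp add: algebra_simps power2_eq_square power3_eq_cube power4_eq_xxxx)
        finally show ?thesis by (simp only: p mult_1)
      qed
      show ?thesis
        using eventually_at_0_ball[OF R]
      proof eventually_elim
        case (elim z)
        then have "z \<in> ball 0 R" "z \<noteq> 0" by auto
        then show ?case by (simp only: D_def wp alg simp_thms)
      qed
    qed
    ultimately show "(D \<longlongrightarrow> 0) (at 0)" by (simp only: Lim_transform_eventually)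
  qed
  then show ?thesis by (simp add: D_def algebra_simps)
qed

end

section \<open>The addition theorem and its consequences\<close>

lemma DERIV_even_at_0:
  fixes f :: "complex \<Rightarrow> complex"
  assumes "(f has_field_derivative D) (at 0)" "\<And>z. f (- z) = f z"
  shows "D = 0"
proof -
  have "((\<lambda>z. f (- z)) has_field_derivative D * (- 1)) (at 0)"
    by (rule DERIV_chain2[where g = uminus]) (use assms(1) in \<open>auto intro!: derivative_eq_intros\<close>)
  then have "(f has_field_derivative D * (- 1)) (at 0)" by (simp only: assms(2))
  from DERIV_unique[OF assms(1) this] show ?thesis by simp
qed

context complex_lattice begin

lemma holomorphic_sigma_compose [holomorphic_intros]:
  "f holomorphic_on A \<Longrightarrow> (\<lambda>x. lattice_sigma L (f x)) holomorphic_on A"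
  using holomorphic_on_compose_gen[OF _ holomorphic_lattice_sigma, of f A] by (simp add: o_def)

lemma sigma_0 [simp]: "lattice_sigma L 0 = 0" by (simp add: lattice_sigma_eq_0_iff)

lemma sigma_nonzero: "z \<notin> L \<Longrightarrow> lattice_sigma L z \<noteq> 0" by (simp add: lattice_sigma_eq_0_iff)

lemma zeta_shift:
  assumes w: "w \<in> L"
  obtains \<eta> where "\<And>z. z \<notin> L \<Longrightarrow> lattice_zeta L (z + w) = lattice_zeta L z + \<eta>"
proof -
  have "((\<lambda>z. lattice_zeta L (z + w) - lattice_zeta L z) has_field_derivative 0) (at z)" if z: "z \<in> - L" for z
  proof -
    have zw: "z + w \<notin> L" "z \<notin> L" using z w by (auto simp: add_mem_iff)
    have 1: "((\<lambda>z. lattice_zeta L (z + w)) has_field_derivative - lattice_wp L (z + w)) (at z)"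
      using has_field_derivative_zeta[OF zw(1)] by (simp only: DERIV_shift)
    show ?thesis using DERIV_diff[OF 1 has_field_derivative_zeta[OF zw(2)]] lattice_wp_periodic[OF zw(2) w] by simp
  qed
  then have "(\<lambda>z. lattice_zeta L (z + w) - lattice_zeta L z) constant_on (- L)"
    by (intro has_field_derivative_0_imp_constant_on connected_compl open_compl)
  then obtain \<eta> where "\<And>z. z \<in> - L \<Longrightarrow> lattice_zeta L (z + w) - lattice_zeta L z = \<eta>" by (auto simp: constant_on_def)
  then show ?thesis by (intro that[of \<eta>]) (auto simp: algebra_simps)
qed

text \<open>The function \<open>\<phi>\<close> has zero derivative by \<open>zeta_shift\<close>,
  hence is constant on the connected complement of the lattice. The constant \<open>C\<close> stays
  unevaluated since it cancels in every quotient used later.\<close>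

lemma sigma_shift:
  assumes w: "w \<in> L"
  obtains \<eta> C where "C \<noteq> 0" "\<And>z. lattice_sigma L (z + w) = C * exp (\<eta> * z) * lattice_sigma L z"
proof -
  obtain \<eta> where \<eta>: "\<And>z. z \<notin> L \<Longrightarrow> lattice_zeta L (z + w) = lattice_zeta L z + \<eta>" using zeta_shift[OF w] by blast
  define \<phi> where "\<phi> = (\<lambda>z. lattice_sigma L (z + w) * exp (- \<eta> * z) / lattice_sigma L z)"
  have "(\<phi> has_field_derivative 0) (at z)" if z: "z \<in> - L" for z
  proof -
    have zw: "z + w \<notin> L" "z \<notin> L" using z w by (auto simp: add_mem_iff)
    have s0: "lattice_sigma L z \<noteq> 0" using zw by (intro sigma_nonzero)
    have 1: "((\<lambda>z. lattice_sigma L (z + w)) has_field_derivative lattice_sigma L (z + w) * lattice_zeta L (z + w)) (at z)"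
      using has_field_derivative_sigma[OF zw(1)] by (simp only: DERIV_shift)
    have 2: "((\<lambda>z. exp (- \<eta> * z)) has_field_derivative exp (- \<eta> * z) * (- \<eta>)) (at z)"
      by (auto intro!: derivative_eq_intros)
    have eq: "((s' * (e * (- \<eta>)) + s' * (x + \<eta>) * e) * s - s' * e * (s * x)) / (s * s) = 0" for s' e x s :: complex
      by (simp add: algebra_simps)
    show ?thesis unfolding \<phi>_def
      by (rule DERIV_cong[OF DERIV_divide[OF DERIV_mult'[OF 1 2] has_field_derivative_sigma[OF zw(2)] s0]])
         (simp only: \<eta>[OF zw(2)] eq)
  qed
  then have "\<phi> constant_on (- L)"
    by (intro has_field_derivative_0_imp_constant_on connected_compl open_compl)
  then obtain C where C: "\<And>z. z \<in> - L \<Longrightarrow> \<phi> z = C" by (auto simp: constant_on_def)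
  show ?thesis
  proof (rule that)
    obtain z where z: "z \<notin> L" using ex_not_mem by blast
    then have "lattice_sigma L (z + w) \<noteq> 0" using w by (simp add: lattice_sigma_eq_0_iff add_mem_iff)
    then show "C \<noteq> 0" using C[of z] z sigma_nonzero[OF z] by (auto simp: \<phi>_def)
    show "lattice_sigma L (z + w) = C * exp (\<eta> * z) * lattice_sigma L z" for z
    proof (cases "z \<in> L")
      case True
      then have "z + w \<in> L" using w by (simp add: add_mem_iff)
      with True show ?thesis by (simp add: lattice_sigma_eq_0_iff[THEN iffD2])
    next
      case False
      then have "lattice_sigma L (z + w) * exp (- \<eta> * z) = C * lattice_sigma L z"
        using C[of z] sigma_nonzero[OF False] by (simp add: \<phi>_def field_simps)
      then have "lattice_sigma L (z + w) * (exp (- \<eta> * z) * exp (\<eta> * z)) = C * exp (\<eta> * z) * lattice_sigma L z"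
        by (simp add: mult_ac)
      then show ?thesis by (simp flip: exp_add)
    qed
  qed
qed

text \<open>For fixed b, the quotient of the two sides' sigma parts plus wp a is elliptic in a. Once
  it is bounded at 0 it is constant, and putting a = b, where sigma(a - b) = 0, identifies the
  constant as wp b.\<close>

lemma lattice_sigma_add:
  assumes a: "a \<notin> L" and b: "b \<notin> L"
  shows "lattice_sigma L (a + b) * lattice_sigma L (a - b)
    = lattice_sigma L a ^ 2 * lattice_sigma L b ^ 2 * (lattice_wp L b - lattice_wp L a)"
proof -
  let ?\<sigma> = "lattice_sigma L"
  have b0: "?\<sigma> b \<noteq> 0" using b by (rule sigma_nonzero)
  define D where "D = (\<lambda>a. ?\<sigma> (a + b) * ?\<sigma> (a - b) / (?\<sigma> a ^ 2 * ?\<sigma> b ^ 2) + lattice_wp L a)"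
  have holD: "D holomorphic_on - L"
    unfolding D_def using b0 by (intro holomorphic_intros holomorphic_wp) (auto simp: lattice_sigma_eq_0_iff)
  have perD: "D (z + w) = D z" if z: "z \<notin> L" and w: "w \<in> L" for z w
  proof (rule sigma_shift[OF w])
    fix \<eta> C assume C: "C \<noteq> 0" and sh: "\<And>z. ?\<sigma> (z + w) = C * exp (\<eta> * z) * ?\<sigma> z"
    have e: "exp (\<eta> * (z + b)) * exp (\<eta> * (z - b)) = exp (\<eta> * z) ^ 2"
      by (simp add: algebra_simps power2_eq_square flip: exp_add)
    have "?\<sigma> (z + w + b) = C * exp (\<eta> * (z + b)) * ?\<sigma> (z + b)" "?\<sigma> (z + w - b) = C * exp (\<eta> * (z - b)) * ?\<sigma> (z - b)"
      using sh[of "z + b"] sh[of "z - b"] by (simp_all add: algebra_simps)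
    then have "?\<sigma> (z + w + b) * ?\<sigma> (z + w - b) = C^2 * (exp (\<eta> * (z + b)) * exp (\<eta> * (z - b))) * (?\<sigma> (z + b) * ?\<sigma> (z - b))"
      by (simp only: power2_eq_square mult_ac)
    also have "\<dots> = (C * exp (\<eta> * z)) ^ 2 * (?\<sigma> (z + b) * ?\<sigma> (z - b))"
      unfolding e by (simp only: power_mult_distrib)
    finally have "?\<sigma> (z + w + b) * ?\<sigma> (z + w - b) / (?\<sigma> (z + w) ^ 2 * ?\<sigma> b ^ 2) =
      (C * exp (\<eta> * z)) ^ 2 * (?\<sigma> (z + b) * ?\<sigma> (z - b)) / ((C * exp (\<eta> * z)) ^ 2 * (?\<sigma> z ^ 2 * ?\<sigma> b ^ 2))"
      by (simp only: sh power_mult_distrib mult.assoc)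
    also have "\<dots> = ?\<sigma> (z + b) * ?\<sigma> (z - b) / (?\<sigma> z ^ 2 * ?\<sigma> b ^ 2)"
      using C by (intro mult_divide_mult_cancel_left) simp
    finally show ?thesis by (simp only: D_def lattice_wp_periodic[OF z w])
  qed
  \<comment> \<open>sigma(z)/z with its removable singularity filled in; its square \<open>s\<close>
    is the denominator left after clearing the double pole.\<close>
  define q where "q = (\<lambda>z. if z = 0 then 1 else ?\<sigma> z / z ^ 1)"
  define s where "s = (\<lambda>z. q z ^ 2)"
  define u where "u = (\<lambda>z. ?\<sigma> (b + z) * ?\<sigma> (b - z) / ?\<sigma> b ^ 2)"
  \<comment> \<open>Near 0, \<open>D\<close> is N / (z^2 s). Since N is even and vanishes at 0, it
    vanishes to second order, so the quotient has a limit.\<close>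
  define N where "N = (\<lambda>z. s z * (1 + z ^ 2 * wp_reg L z) - u z)"
  define S where "S = fps_expansion ?\<sigma> 0"
  have S: "?\<sigma> has_fps_expansion S" unfolding S_def
    by (rule analytic_at_imp_has_fps_expansion_0)
       (auto simp: analytic_at intro!: exI[of _ UNIV] holomorphic_lattice_sigma)
  have S0: "fps_nth S 0 = 0" "fps_nth S 1 = 1"
    using fps_nth_fps_expansion[OF S, of 0] fps_nth_fps_expansion[OF S, of 1] by simp_all
  have "q has_fps_expansion fps_shift 1 S"
    unfolding q_def by (rule has_fps_expansion_shift[OF S subdegree_geI]) (use S0 in auto)
  then have s: "s has_fps_expansion fps_shift 1 S ^ 2" unfolding s_def power2_eq_square by (intro fps_expansion_intros)
  define U where "U = fps_expansion u 0"
  have "u holomorphic_on UNIV" unfolding u_def using b0 by (intro holomorphic_intros) auto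
  then have U: "u has_fps_expansion U" unfolding U_def
    by (intro analytic_at_imp_has_fps_expansion_0) (auto simp: analytic_at intro!: exI[of _ UNIV])
  define FN where "FN = fps_shift 1 S ^ 2 * (1 + fps_X ^ 2 * wpF) - U"
  have FN: "N has_fps_expansion FN" unfolding N_def FN_def
    by (intro fps_expansion_intros s U wp_reg_expansion)
  have "N 0 = 0" using b0 by (simp add: N_def s_def q_def u_def power2_eq_square)
  then have FN0: "fps_nth FN 0 = 0" using fps_nth_fps_expansion[OF FN, of 0] by simp
  have evN: "N (- z) = N z" for z
  proof -
    have "wp_reg L (- z) = wp_reg L z" unfolding wp_reg_def
      by (rule infsum_reindex_bij_witness[of _ uminus uminus]) (auto simp: pterm_def power2_commute power2_eq_square algebra_simps)
    then show ?thesis by (simp add: N_def s_def q_def u_def lattice_sigma_uminus)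
  qed
  have "(eval_fps FN has_field_derivative eval_fps (fps_deriv FN) 0) (at 0)"
    by (rule has_field_derivative_eval_fps) (use FN in \<open>auto simp: has_fps_expansion_def zero_ereal_def\<close>)
  moreover have "\<forall>\<^sub>F z in nhds 0. eval_fps FN z = N z" using FN by (simp add: has_fps_expansion_def)
  ultimately have "(N has_field_derivative eval_fps (fps_deriv FN) 0) (at 0)"
    using DERIV_cong_ev[OF refl, of "eval_fps FN" N 0] by simp
  then have "eval_fps (fps_deriv FN) 0 = 0" by (rule DERIV_even_at_0) (rule evN)
  then have FN1: "fps_nth FN (Suc 0) = 0" by (simp add: eval_fps_at_0)
  have "((\<lambda>z. N z / z ^ 2) \<longlongrightarrow> fps_nth FN 2) (at 0)"
    by (rule tendsto_fps_quotient[OF FN]) (auto simp: less_2_cases_iff FN0 FN1)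
  moreover have "(s \<longlongrightarrow> 1) (at 0)"
    using has_fps_expansion_imp_continuous[OF s, of UNIV] by (simp add: continuous_within s_def q_def)
  ultimately have lim: "((\<lambda>z. N z / z ^ 2 / s z) \<longlongrightarrow> fps_nth FN 2 / 1) (at 0)"
    by (rule tendsto_divide) simp
  have "\<forall>\<^sub>F z in at 0. N z / z ^ 2 / s z = D z"
  proof (rule wp_near_0)
    fix R assume R: "R > 0" and nL: "\<And>z. z \<in> ball 0 R \<Longrightarrow> z \<noteq> 0 \<Longrightarrow> z \<notin> L"
      and wp: "\<And>z. z \<in> ball 0 R \<Longrightarrow> z \<noteq> 0 \<Longrightarrow> lattice_wp L z = 1 / z\<^sup>2 + wp_reg L z"
    show ?thesis
      using eventually_at_0_ball[OF R]
    proof eventually_elim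
      case (elim z)
      then have z: "z \<in> ball 0 R" "z \<noteq> 0" by auto
      have s0: "?\<sigma> z \<noteq> 0" using nL[OF z] by (rule sigma_nonzero)
      have sz: "s z = ?\<sigma> z ^ 2 / z ^ 2" using z by (simp add: s_def q_def power_divide)
      have m: "?\<sigma> (z - b) = - ?\<sigma> (b - z)" using lattice_sigma_uminus[of "b - z"] by simp
      have "N z / z ^ 2 / s z = (1 + z ^ 2 * wp_reg L z) / z ^ 2 - u z / ?\<sigma> z ^ 2"
        using z s0 by (simp add: N_def sz field_simps)
      also have "(1 + z ^ 2 * wp_reg L z) / z ^ 2 = lattice_wp L z"
        using z wp[OF z] by (simp add: field_simps)
      also have "lattice_wp L z - u z / ?\<sigma> z ^ 2 = D z"
        by (simp add: D_def u_def m add.commute)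
      finally show ?case .
    qed
  qed
  from Lim_transform_eventually[OF lim this] have limD: "(D \<longlongrightarrow> fps_nth FN 2) (at 0)" by simp
  \<comment> \<open>The limit \<open>fps_nth FN 2\<close> is never computed: comparing the values at
    a and b eliminates it.\<close>
  have "D a = fps_nth FN 2" "D b = fps_nth FN 2"
    using elliptic_const[OF holD perD limD a] elliptic_const[OF holD perD limD b] by auto
  then have "D a = lattice_wp L b" by (simp add: D_def)
  then have "?\<sigma> (a + b) * ?\<sigma> (a - b) / (?\<sigma> a ^ 2 * ?\<sigma> b ^ 2) = lattice_wp L b - lattice_wp L a"
    by (simp add: D_def algebra_simps)
  then show ?thesis using b0 sigma_nonzero[OF a] by (simp add: field_simps)
qed

lemma lattice_wp_eqD:
  assumes "u \<notin> L" "v \<notin> L" "lattice_wp L u = lattice_wp L v"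
  shows "u + v \<in> L \<or> u - v \<in> L"
  using lattice_sigma_add[OF assms(1,2)] assms(3) by (simp add: lattice_sigma_eq_0_iff)

text \<open>Differentiate the addition formula in b at b = z. On the left only the derivative of the
  vanishing factor sigma(z - b) survives, and sigma'(0) = 1.\<close>

lemma lattice_sigma_double:
  assumes z: "z \<notin> L"
  shows "lattice_sigma L (2 * z) = - deriv (lattice_wp L) z * lattice_sigma L z ^ 4"
proof -
  let ?\<sigma> = "lattice_sigma L"
  have d1: "((\<lambda>b. ?\<sigma> (z + b)) has_field_derivative deriv ?\<sigma> (z + z) * 1) (at z)"
    by (rule DERIV_chain2[OF deriv_sigma]) (auto intro!: derivative_eq_intros)
  have d2: "((\<lambda>b. ?\<sigma> (z - b)) has_field_derivative deriv ?\<sigma> (z - z) * (- 1)) (at z)"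
    by (rule DERIV_chain2[OF deriv_sigma]) (auto intro!: derivative_eq_intros)
  have l: "((\<lambda>b. ?\<sigma> (z + b) * ?\<sigma> (z - b)) has_field_derivative - ?\<sigma> (2 * z)) (at z)"
    by (rule DERIV_cong[OF DERIV_mult'[OF d1 d2]]) simp
  have "((\<lambda>b. ?\<sigma> z ^ 2 * ?\<sigma> b ^ 2 * (lattice_wp L b - lattice_wp L z)) has_field_derivative
      deriv (lattice_wp L) z * ?\<sigma> z ^ 4) (at z)"
    by (rule DERIV_cong[OF DERIV_mult'[OF DERIV_cmult[OF DERIV_power[OF deriv_sigma]] DERIV_diff[OF has_field_derivative_wp[OF z] DERIV_const]]])
       (simp add: power2_eq_square power4_eq_xxxx)
  moreover have "\<forall>\<^sub>F b in nhds z. ?\<sigma> z ^ 2 * ?\<sigma> b ^ 2 * (lattice_wp L b - lattice_wp L z) = ?\<sigma> (z + b) * ?\<sigma> (z - b)"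
    by (rule eventually_mono[OF eventually_nhds_in_open[OF open_compl, of z]]) (use z lattice_sigma_add[OF z] in auto)
  ultimately have "((\<lambda>b. ?\<sigma> (z + b) * ?\<sigma> (z - b)) has_field_derivative deriv (lattice_wp L) z * ?\<sigma> z ^ 4) (at z)"
    by (rule DERIV_cong_ev[OF refl _ refl, THEN iffD1, rotated])
  from DERIV_unique[OF l this] have "lattice_sigma L (2 * z) = - (deriv (lattice_wp L) z * ?\<sigma> z ^ 4)"
    by (metis minus_minus)
  then show ?thesis by simp
qed

lemma wp'_eq_0_iff: "z \<notin> L \<Longrightarrow> deriv (lattice_wp L) z = 0 \<longleftrightarrow> 2 * z \<in> L"
  using lattice_sigma_double[of z] sigma_nonzero[of z] lattice_sigma_eq_0_iff[of "2 * z"] by auto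

lemma lattice_zeta_uminus: "lattice_zeta L (- z) = - lattice_zeta L z"
proof -
  have "((\<lambda>z. lattice_sigma L (- z)) has_field_derivative deriv (lattice_sigma L) (- z) * (- 1)) (at z)"
    by (rule DERIV_chain2[OF deriv_sigma]) (auto intro!: derivative_eq_intros)
  moreover have "((\<lambda>z. - lattice_sigma L z) has_field_derivative - deriv (lattice_sigma L) z) (at z)"
    by (rule DERIV_minus[OF deriv_sigma])
  ultimately have "deriv (lattice_sigma L) (- z) * (- 1) = - deriv (lattice_sigma L) z"
    unfolding lattice_sigma_uminus by (rule DERIV_unique)
  then show ?thesis by (simp add: lattice_zeta_def lattice_sigma_uminus)
qed

lemma eventually_not_mem:
  assumes "z \<notin> L" "z + b \<notin> L" "z - b \<notin> L"
  shows "\<forall>\<^sub>F x in nhds z. x \<notin> L \<and> x + b \<notin> L \<and> x - b \<notin> L"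
proof -
  have op: "open {x. x + c \<notin> L}" for c
  proof -
    have "{x. x + c \<notin> L} = (\<lambda>x. x + c) -` (- L)" by auto
    moreover have "open ((\<lambda>x. x + c) -` (- L))"
      by (intro continuous_open_vimage open_compl) (auto intro!: continuous_intros)
    ultimately show ?thesis by simp
  qed
  have "\<forall>\<^sub>F x in nhds z. x \<in> {x. x + 0 \<notin> L} \<inter> {x. x + b \<notin> L} \<inter> {x. x + - b \<notin> L}"
    using assms by (intro eventually_nhds_in_open open_Int op) auto
  then show ?thesis by eventually_elim auto
qed

text \<open>The logarithmic derivative in a of the addition formula for sigma; the first conclusion
  makes the denominator nonzero.\<close>

lemma lattice_zeta_add:
  assumes a: "a \<notin> L" and b: "b \<notin> L" and ab: "a + b \<notin> L" "a - b \<notin> L"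
  shows "lattice_wp L a \<noteq> lattice_wp L b"
    "lattice_zeta L (a + b) + lattice_zeta L (a - b) - 2 * lattice_zeta L a = deriv (lattice_wp L) a / (lattice_wp L a - lattice_wp L b)"
proof -
  let ?\<sigma> = "lattice_sigma L" and ?Z = "lattice_zeta L" and ?p = "lattice_wp L"
  have nz: "?\<sigma> a \<noteq> 0" "?\<sigma> b \<noteq> 0" "?\<sigma> (a + b) \<noteq> 0" "?\<sigma> (a - b) \<noteq> 0" by (rule sigma_nonzero[OF a] sigma_nonzero[OF b] sigma_nonzero[OF ab(1)] sigma_nonzero[OF ab(2)])+
  show ne: "?p a \<noteq> ?p b" using lattice_sigma_add[OF a b] nz by auto
  have d1: "((\<lambda>x. ?\<sigma> (x + b)) has_field_derivative ?\<sigma> (a + b) * ?Z (a + b)) (at a)"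
    using has_field_derivative_sigma[OF ab(1)] by (simp only: DERIV_shift)
  have d2: "((\<lambda>x. ?\<sigma> (x - b)) has_field_derivative ?\<sigma> (a - b) * ?Z (a - b)) (at a)"
    using has_field_derivative_sigma[of "a + - b"] ab(2) DERIV_shift[of ?\<sigma> _ a "- b"] by simp
  note l = DERIV_mult'[OF d1 d2]
  have r: "((\<lambda>x. ?\<sigma> x ^ 2 * ?\<sigma> b ^ 2 * (?p b - ?p x)) has_field_derivative
      ?\<sigma> a ^ 2 * ?\<sigma> b ^ 2 * (?p b - ?p a) * (2 * ?Z a) - ?\<sigma> a ^ 2 * ?\<sigma> b ^ 2 * deriv ?p a) (at a)"
    by (rule DERIV_cong[OF DERIV_mult'[OF DERIV_cmult_right[OF DERIV_power[OF has_field_derivative_sigma[OF a]]] DERIV_diff[OF DERIV_const has_field_derivative_wp[OF a]]]])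
       (simp add: power2_eq_square algebra_simps)
  have "\<forall>\<^sub>F x in nhds a. ?\<sigma> x ^ 2 * ?\<sigma> b ^ 2 * (?p b - ?p x) = ?\<sigma> (x + b) * ?\<sigma> (x - b)"
    by (rule eventually_mono[OF eventually_nhds_in_open[OF open_compl, of a]]) (use a b lattice_sigma_add in auto)
  from DERIV_cong_ev[OF refl this refl, THEN iffD1, OF r]
  have "?\<sigma> (a + b) * (?\<sigma> (a - b) * ?Z (a - b)) + ?\<sigma> (a + b) * ?Z (a + b) * ?\<sigma> (a - b) =
     ?\<sigma> a ^ 2 * ?\<sigma> b ^ 2 * (?p b - ?p a) * (2 * ?Z a) - ?\<sigma> a ^ 2 * ?\<sigma> b ^ 2 * deriv ?p a"
    by (rule DERIV_unique[OF l])
  then have "(?\<sigma> (a + b) * ?\<sigma> (a - b)) * (?Z (a + b) + ?Z (a - b)) =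
     ?\<sigma> a ^ 2 * ?\<sigma> b ^ 2 * ((?p b - ?p a) * (2 * ?Z a) - deriv ?p a)"
    by (simp add: algebra_simps)
  then have "(?p b - ?p a) * (?Z (a + b) + ?Z (a - b)) = (?p b - ?p a) * (2 * ?Z a) - deriv ?p a"
    unfolding lattice_sigma_add[OF a b] using nz by (simp add: mult.assoc)
  then have "(?Z (a + b) + ?Z (a - b) - 2 * ?Z a) * (?p a - ?p b) = deriv ?p a"
    by (simp add: algebra_simps)
  then show "?Z (a + b) + ?Z (a - b) - 2 * ?Z a = deriv ?p a / (?p a - ?p b)"
    using ne by (simp add: nonzero_eq_divide_eq)
qed

text \<open>One more derivative in a. The symmetric sum over a + b and a - b is kept because a Somos
  recurrence compares the translates of a point by both signs of \<kappa>.\<close>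

lemma lattice_wp_add:
  assumes a: "a \<notin> L" and b: "b \<notin> L" and ab: "a + b \<notin> L" "a - b \<notin> L"
  shows "lattice_wp L (a + b) + lattice_wp L (a - b) = 2 * lattice_wp L a
    - deriv (deriv (lattice_wp L)) a / (lattice_wp L a - lattice_wp L b)
    + deriv (lattice_wp L) a ^ 2 / (lattice_wp L a - lattice_wp L b) ^ 2"
proof -
  let ?Z = "lattice_zeta L" and ?p = "lattice_wp L"
  have ne: "?p a - ?p b \<noteq> 0" using lattice_zeta_add(1)[OF assms] by simp
  have d1: "((\<lambda>x. ?Z (x + b)) has_field_derivative - ?p (a + b)) (at a)"
    using has_field_derivative_zeta[OF ab(1)] by (simp only: DERIV_shift)
  have d2: "((\<lambda>x. ?Z (x - b)) has_field_derivative - ?p (a - b)) (at a)"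
    using has_field_derivative_zeta[of "a + - b"] ab(2) DERIV_shift[of ?Z _ a "- b"] by simp
  note l = DERIV_diff[OF DERIV_add[OF d1 d2] DERIV_cmult[OF has_field_derivative_zeta[OF a], of 2]]
  note r = DERIV_divide[OF has_field_derivative_wp'[OF a] DERIV_diff[OF has_field_derivative_wp[OF a] DERIV_const[of "?p b"]] ne]
  have "\<forall>\<^sub>F x in nhds a. deriv ?p x / (?p x - ?p b) = ?Z (x + b) + ?Z (x - b) - 2 * ?Z x"
    using eventually_not_mem[OF a ab] by eventually_elim (use lattice_zeta_add(2)[OF _ b] in auto)
  from DERIV_unique[OF l DERIV_cong_ev[OF refl this refl, THEN iffD1, OF r]]
  have "- ?p (a + b) + - ?p (a - b) - 2 * - ?p a =
    (deriv (deriv ?p) a * (?p a - ?p b) - deriv ?p a * (deriv ?p a - 0)) / ((?p a - ?p b) * (?p a - ?p b))" .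
  also have "\<dots> = deriv (deriv ?p) a / (?p a - ?p b) - deriv ?p a ^ 2 / (?p a - ?p b) ^ 2"
    using ne by (simp add: diff_divide_distrib power2_eq_square)
  finally show ?thesis by (simp add: algebra_simps)
qed

lemma wp_ode3:
  assumes z: "z \<notin> L"
  shows "(deriv (deriv (lattice_wp L)) has_field_derivative 12 * lattice_wp L z * deriv (lattice_wp L) z) (at z)"
proof -
  have "((\<lambda>z. 6 * lattice_wp L z ^ 2 - lattice_g2 L / 2) has_field_derivative 12 * lattice_wp L z * deriv (lattice_wp L) z) (at z)"
    by (rule DERIV_cong[OF DERIV_diff[OF DERIV_cmult[OF DERIV_power[OF has_field_derivative_wp[OF z]]] DERIV_const]])
       (simp add: power2_eq_square)
  moreover have "\<forall>\<^sub>F x in nhds z. 6 * lattice_wp L x ^ 2 - lattice_g2 L / 2 = deriv (deriv (lattice_wp L)) x"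
    by (rule eventually_mono[OF eventually_nhds_in_open[OF open_compl, of z]]) (use z wp_ode2 in auto)
  ultimately show ?thesis by (rule DERIV_cong_ev[OF refl _ refl, THEN iffD1, rotated])
qed

text \<open>The slope of the tangent to the cubic at the point (wp z, wp' z), as in the
  chord-tangent duplication law.\<close>

definition wp_slope :: "complex \<Rightarrow> complex" where
  "wp_slope z = deriv (deriv (lattice_wp L)) z / deriv (lattice_wp L) z"

lemma has_field_derivative_wp_slope:
  assumes z: "z \<notin> L" "2 * z \<notin> L"
  shows "(wp_slope has_field_derivative 12 * lattice_wp L z - wp_slope z ^ 2) (at z)"
proof -
  have nz: "deriv (lattice_wp L) z \<noteq> 0" using z by (simp add: wp'_eq_0_iff)
  show ?thesis unfolding wp_slope_def
    by (rule DERIV_cong[OF DERIV_divide[OF wp_ode3[OF z(1)] has_field_derivative_wp'[OF z(1)] nz]])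
       (use nz in \<open>simp add: diff_divide_distrib power2_eq_square\<close>)
qed

lemma eventually_not_mem_double:
  assumes "z \<notin> L" "2 * z \<notin> L"
  shows "\<forall>\<^sub>F x in nhds z. x \<notin> L \<and> 2 * x \<notin> L"
proof -
  have "open ((\<lambda>x. 2 * x) -` (- L))"
    by (intro continuous_open_vimage open_compl) (auto intro!: continuous_intros)
  then have "\<forall>\<^sub>F x in nhds z. x \<in> - L \<inter> (\<lambda>x. 2 * x) -` (- L)"
    using assms by (intro eventually_nhds_in_open open_Int open_compl) auto
  then show ?thesis by eventually_elim auto
qed

text \<open>The logarithmic derivative of the duplication formula for sigma. Two further derivatives
  give those for wp and wp', with \<open>has_field_derivative_wp_slope\<close> keeping every
  expression polynomial in wp, wp' and the slope.\<close>

lemma lattice_zeta_double: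
  assumes z: "z \<notin> L" "2 * z \<notin> L"
  shows "2 * lattice_zeta L (2 * z) = wp_slope z + 4 * lattice_zeta L z"
proof -
  let ?\<sigma> = "lattice_sigma L" and ?Z = "lattice_zeta L" and ?p = "lattice_wp L"
  have nz: "deriv ?p z \<noteq> 0" "?\<sigma> z \<noteq> 0" using z by (auto simp: wp'_eq_0_iff sigma_nonzero)
  have l: "((\<lambda>x. ?\<sigma> (2 * x)) has_field_derivative ?\<sigma> (2 * z) * ?Z (2 * z) * 2) (at z)"
    by (rule DERIV_chain2[where g = "\<lambda>x. 2 * x", OF has_field_derivative_sigma[OF z(2)]]) (auto intro!: derivative_eq_intros)
  note r = DERIV_mult'[OF DERIV_minus[OF has_field_derivative_wp'[OF z(1)]] DERIV_power[OF has_field_derivative_sigma[OF z(1)], of 4]]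
  have "\<forall>\<^sub>F x in nhds z. - deriv ?p x * ?\<sigma> x ^ 4 = ?\<sigma> (2 * x)"
    by (rule eventually_mono[OF eventually_nhds_in_open[OF open_compl, of z]]) (use z lattice_sigma_double in auto)
  from DERIV_unique[OF l DERIV_cong_ev[OF refl this refl, THEN iffD1, OF r]]
  have "?\<sigma> (2 * z) * ?Z (2 * z) * 2 = - deriv ?p z * (of_nat 4 * (?\<sigma> z * ?Z z * ?\<sigma> z ^ (4 - Suc 0))) + - deriv (deriv ?p) z * ?\<sigma> z ^ 4" .
  also have "\<dots> = - (?\<sigma> z ^ 4) * (4 * deriv ?p z * ?Z z + deriv (deriv ?p) z)"
    by (simp add: power4_eq_xxxx power3_eq_cube algebra_simps)
  finally have "- (?\<sigma> z ^ 4) * (deriv ?p z * (2 * ?Z (2 * z))) = - (?\<sigma> z ^ 4) * (4 * deriv ?p z * ?Z z + deriv (deriv ?p) z)"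
    unfolding lattice_sigma_double[OF z(1)] by (simp only: mult_minus_left mult_minus_right mult_ac)
  then have "deriv ?p z * (2 * ?Z (2 * z)) = 4 * deriv ?p z * ?Z z + deriv (deriv ?p) z" using nz(2) by simp
  then show ?thesis using nz(1) by (simp add: wp_slope_def field_simps)
qed

lemma lattice_wp_double:
  assumes z: "z \<notin> L" "2 * z \<notin> L"
  shows "lattice_wp L (2 * z) = - 2 * lattice_wp L z + wp_slope z ^ 2 / 4"
proof -
  have l: "((\<lambda>x. 2 * lattice_zeta L (2 * x)) has_field_derivative 2 * (- lattice_wp L (2 * z) * 2)) (at z)"
    by (intro DERIV_cmult DERIV_chain2[where g = "\<lambda>x. 2 * x", OF has_field_derivative_zeta[OF z(2)]]) (auto intro!: derivative_eq_intros)
  have r: "((\<lambda>x. wp_slope x + 4 * lattice_zeta L x) has_field_derivative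
      (12 * lattice_wp L z - wp_slope z ^ 2) + 4 * - lattice_wp L z) (at z)"
    by (intro DERIV_add DERIV_cmult has_field_derivative_wp_slope has_field_derivative_zeta z)
  have ev: "\<forall>\<^sub>F x in nhds z. wp_slope x + 4 * lattice_zeta L x = 2 * lattice_zeta L (2 * x)"
    using eventually_not_mem_double[OF z] by eventually_elim (use lattice_zeta_double in auto)
  have "2 * (- lattice_wp L (2 * z) * 2) = (12 * lattice_wp L z - wp_slope z ^ 2) + 4 * - lattice_wp L z"
    by (rule DERIV_unique[OF l DERIV_cong_ev[OF refl ev refl, THEN iffD1, OF r]])
  then show ?thesis by (simp add: field_simps)
qed

lemma wp'_double:
  assumes z: "z \<notin> L" "2 * z \<notin> L"
  shows "deriv (lattice_wp L) (2 * z) = - deriv (lattice_wp L) z + wp_slope z * (3 * lattice_wp L z - wp_slope z ^ 2 / 4)"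
proof -
  have l: "((\<lambda>x. lattice_wp L (2 * x)) has_field_derivative deriv (lattice_wp L) (2 * z) * 2) (at z)"
    by (rule DERIV_chain2[where g = "\<lambda>x. 2 * x", OF has_field_derivative_wp[OF z(2)]]) (auto intro!: derivative_eq_intros)
  have r: "((\<lambda>x. - 2 * lattice_wp L x + wp_slope x ^ 2 / 4) has_field_derivative
      - 2 * deriv (lattice_wp L) z + (of_nat 2 * ((12 * lattice_wp L z - wp_slope z ^ 2) * wp_slope z ^ (2 - Suc 0))) / 4) (at z)"
    by (intro DERIV_add DERIV_cmult DERIV_cdivide DERIV_power has_field_derivative_wp_slope has_field_derivative_wp z)
  have ev: "\<forall>\<^sub>F x in nhds z. - 2 * lattice_wp L x + wp_slope x ^ 2 / 4 = lattice_wp L (2 * x)"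
    using eventually_not_mem_double[OF z] by eventually_elim (use lattice_wp_double in auto)
  have "deriv (lattice_wp L) (2 * z) * 2 =
      - 2 * deriv (lattice_wp L) z + (of_nat 2 * ((12 * lattice_wp L z - wp_slope z ^ 2) * wp_slope z ^ (2 - Suc 0))) / 4"
    by (rule DERIV_unique[OF l DERIV_cong_ev[OF refl ev refl, THEN iffD1, OF r]])
  note eq = this
  have "deriv (lattice_wp L) (2 * z) = (deriv (lattice_wp L) (2 * z) * 2) / 2" by simp
  also have "\<dots> = - deriv (lattice_wp L) z + wp_slope z * (3 * lattice_wp L z - wp_slope z ^ 2 / 4)"
    unfolding eq by (simp add: field_simps)
  finally show ?thesis .
qed

text \<open>The three half-periods are zeros of wp', so their wp-values are roots of the cubic. They
  are distinct because no sum or difference of two different half-periods is a period.\<close>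

lemma discriminant_nonzero: "lattice_g2 L ^ 3 - 27 * lattice_g3 L ^ 2 \<noteq> 0"
proof (rule basis)
  fix w1 w2 assume L: "L = {of_int m * w1 + of_int n * w2 | m n :: int. True}" and im: "Im (w2/w1) \<noteq> 0"
  have w1: "w1 \<noteq> 0" using im by auto
  have notL: "of_int i / 2 * w1 + of_int j / 2 * w2 \<notin> L" if "odd i \<or> odd j" for i j
  proof
    assume "of_int i / 2 * w1 + of_int j / 2 * w2 \<in> L"
    then obtain m n where "of_int i / 2 * w1 + of_int j / 2 * w2 = of_int m * w1 + of_int n * w2" using L by auto
    then have "of_int (i - 2 * m) * w1 + of_int (j - 2 * n) * w2 = 0" by (simp add: field_simps)
    then have "of_int (i - 2 * m) + of_int (j - 2 * n) * (w2 / w1) = 0" using w1 by (simp add: field_simps del: of_int_diff)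
    moreover define \<tau> where "\<tau> = w2 / w1"
    ultimately have e: "of_real (of_int (i - 2 * m)) + of_real (of_int (j - 2 * n)) * \<tau> = 0" by simp
    then have "Im (of_real (of_int (i - 2 * m)) + of_real (of_int (j - 2 * n)) * \<tau>) = 0" by (simp only: zero_complex.sel)
    then have "real_of_int (j - 2 * n) = 0" using im by (simp add: \<tau>_def[symmetric] del: of_int_diff)
    then have j: "j - 2 * n = 0" by simp
    with e have "real_of_int (i - 2 * m) = 0" by (simp del: of_int_diff)
    then have "i - 2 * m = 0" by simp
    with j that show False by presburger
  qed
  have root: "4 * e ^ 3 - lattice_g2 L * e - lattice_g3 L = 0"
    if "e = lattice_wp L a" "a \<notin> L" "2 * a \<in> L" for e a
    using wp_ode1[OF that(2)] wp'_eq_0_iff[OF that(2)] that by simp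
  define a b c where "a = w1 / 2" and "b = w2 / 2" and "c = (w1 + w2) / 2"
  have abcL: "a \<notin> L" "b \<notin> L" "c \<notin> L" "a + b \<notin> L" "a - b \<notin> L" "a + c \<notin> L" "a - c \<notin> L" "b + c \<notin> L" "b - c \<notin> L"
    using notL[of 1 0] notL[of 0 1] notL[of 1 1] notL[of 1 "- 1"] notL[of 2 1] notL[of 0 "- 1"] notL[of 1 2] notL[of "- 1" 0]
    by (simp_all add: a_def b_def c_def field_simps)
  have "of_int 1 * w1 + of_int 0 * w2 \<in> L" "of_int 0 * w1 + of_int 1 * w2 \<in> L" "of_int 1 * w1 + of_int 1 * w2 \<in> L"
    unfolding L by blast+
  then have "w1 \<in> L" "w2 \<in> L" "w1 + w2 \<in> L" by simp_all
  moreover have "2 * a = w1" "2 * b = w2" "2 * c = w1 + w2" by (simp_all add: a_def b_def c_def)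
  ultimately have L2: "2 * a \<in> L" "2 * b \<in> L" "2 * c \<in> L" by simp_all
  define e1 e2 e3 where "e1 = lattice_wp L a" and "e2 = lattice_wp L b" and "e3 = lattice_wp L c"
  have d: "e1 \<noteq> e2" "e1 \<noteq> e3" "e2 \<noteq> e3"
    unfolding e1_def e2_def e3_def using lattice_wp_eqD abcL by blast+
  define g2 g3 where "g2 = lattice_g2 L" and "g3 = lattice_g3 L"
  have r: "4 * e1 ^ 3 - g2 * e1 - g3 = 0" "4 * e2 ^ 3 - g2 * e2 - g3 = 0" "4 * e3 ^ 3 - g2 * e3 - g3 = 0"
    unfolding g2_def g3_def
    using root[OF e1_def abcL(1) L2(1)] root[OF e2_def abcL(2) L2(2)] root[OF e3_def abcL(3) L2(3)] by auto
  have "(e1 - e2) * (4 * (e1^2 + e1 * e2 + e2^2) - g2) = 0" using r(1,2) by algebra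
  then have 12: "g2 = 4 * (e1^2 + e1 * e2 + e2^2)" using d by auto
  have "(e1 - e3) * (4 * (e1^2 + e1 * e3 + e3^2) - g2) = 0" using r(1,3) by algebra
  then have 13: "g2 = 4 * (e1^2 + e1 * e3 + e3^2)" using d by auto
  \<comment> \<open>Subtracting the two expressions for g2 gives 4 (e2 - e3) (e1 + e2 + e3) = 0,
    which is how the vanishing of the root sum is obtained.\<close>
  have "(e2 - e3) * (e1 + e2 + e3) = 0" using 12 13 by algebra
  then have "e1 + e2 + e3 = 0" using d(3) by (simp only: mult_eq_0_iff right_minus_eq simp_thms)
  moreover have "e3 = (e1 + e2 + e3) - e1 - e2" by simp
  ultimately have e3: "e3 = - e1 - e2" by simp
  have g3: "g3 = 4 * e1 ^ 3 - g2 * e1" using r(1) by (simp add: algebra_simps)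
  \<comment> \<open>After e3 = - e1 - e2, the last two factors are e1 - e3 and e2 - e3, so the right
    side is 16 times the squared product of root differences.\<close>
  have "g2 ^ 3 - 27 * g3 ^ 2 = 16 * ((e1 - e2) * (2 * e1 + e2) * (e1 + 2 * e2)) ^ 2"
    unfolding g3 12 by algebra
  moreover have "2 * e1 + e2 \<noteq> 0" "e1 + 2 * e2 \<noteq> 0"
    using d(2,3) unfolding e3 by (auto simp: algebra_simps add_eq_0_iff2)
  ultimately show ?thesis using d(1) by (simp add: g2_def g3_def)
qed

end

section \<open>Every nonsingular cubic has a period lattice\<close>

lemma ln_sin_expansion:
  "((\<lambda>t::real. (ln (sin t / t) + t^2 / 6) / t^4) \<longlongrightarrow> - 1 / 180) (at_right 0)"
  "((\<lambda>t::real. (ln (sin t / t) + t^2 / 6 + t^4 / 180) / t^6) \<longlongrightarrow> - 1 / 2835) (at_right 0)"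
proof -
  show "((\<lambda>t::real. (ln (sin t / t) + t^2 / 6) / t^4) \<longlongrightarrow> - 1 / 180) (at_right 0)" by real_asymp
  show "((\<lambda>t::real. (ln (sin t / t) + t^2 / 6 + t^4 / 180) / t^6) \<longlongrightarrow> - 1 / 2835) (at_right 0)" by real_asymp
qed

lemma filterlim_pi_times: "filterlim (\<lambda>z. pi * z) (at_right 0) (at_right (0::real))"
  by real_asymp

lemma ln_sin_expansion_limit4:
  "((\<lambda>z::real. (ln (sin (pi*z) / (pi*z)) + pi^2/6 * z^2) / z^4) \<longlongrightarrow> - (pi^4/180)) (at_right 0)"
  using tendsto_mult_left[OF filterlim_compose[OF ln_sin_expansion(1) filterlim_pi_times], of "pi^4"]
  by (simp add: power_mult_distrib)

lemma ln_sin_expansion_limit6: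
  "((\<lambda>z::real. (ln (sin (pi*z) / (pi*z)) + pi^2/6 * z^2 + pi^4/180 * z^4) / z^6) \<longlongrightarrow> - (pi^6/2835)) (at_right 0)"
  using tendsto_mult_left[OF filterlim_compose[OF ln_sin_expansion(2) filterlim_pi_times], of "pi^6"]
  by (simp add: power_mult_distrib)

text \<open>Compares the expansions at \<open>0\<close> of the two sides of the logarithm of Euler's product for the sine.\<close>

lemma zeta_sums:
  "(\<Sum>k. 1 / (real k + 1) ^ 4) = pi ^ 4 / 90" "(\<Sum>k. 1 / (real k + 1) ^ 6) = pi ^ 6 / 945"
proof -
  define S where "S = (\<lambda>j. \<Sum>k. 1 / (real k + 1) ^ j)"
  have sq: "summable (\<lambda>k. 1 / (real k + 1) ^ 2)" using inverse_squares_sums by (auto simp: sums_iff add.commute)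
  have summ: "summable (\<lambda>k. 1 / (real k + 1) ^ j)" if "j \<ge> 2" for j
  proof (rule summable_comparison_test'[OF sq])
    fix k :: nat
    have "(real k + 1) ^ 2 \<le> (real k + 1) ^ j" using that by (intro power_increasing) auto
    then show "norm (1 / (real k + 1) ^ j) \<le> 1 / (real k + 1) ^ 2" by (simp add: frac_le)
  qed
  have S2: "S 2 = pi^2 / 6" using inverse_squares_sums by (simp add: S_def sums_iff add.commute)
  define f where "f = (\<lambda>z. ln (sin (pi*z) / (pi*z)))"
  \<comment> \<open>The remainder of ln(1 - y) beyond y^3. Put y = z^2/k^2: the three removed terms
    carry the zeta values at 2, 4 and 6, and the bound 2 y^4 sums to an error of order z^8.\<close>
  define r where "r = (\<lambda>y::real. ln (1 - y) + y + y^2/2 + y^3/3)"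
  have r_bound: "\<bar>r y\<bar> \<le> 2 * y ^ 4" if y: "0 \<le> y" "y \<le> 1/4" for y
  proof -
    have d: "(r has_real_derivative - (x^3 / (1 - x))) (at x within {0..y})" if "x \<in> {0..y}" for x
    proof -
      have "(r has_real_derivative (- 1) / (1 - x) + 1 + x + x^2) (at x within {0..y})"
        unfolding r_def using that y by (auto intro!: derivative_eq_intros)
      moreover have "(- 1) / (1 - x) + 1 + x + x^2 = - (x^3 / (1 - x))"
        using that y by (simp add: divide_simps) (simp add: algebra_simps power2_eq_square power3_eq_cube)
      ultimately show ?thesis by simp
    qed
    have "norm (r y - r 0) \<le> 2 * y^3 * norm (y - 0)"
    proof (rule field_differentiable_bound[of "{0..y}", OF _ d])
      fix x assume x: "x \<in> {0..y}"
      have "x^3 / (1 - x) \<le> y^3 / (1/2)" using x y by (intro frac_le power_mono) auto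
      moreover have "x^3 / (1 - x) \<ge> 0" using x y by auto
      moreover have "y^3 / (1/2) = 2 * y^3" for y :: real by simp
      ultimately have "\<bar>x^3 / (1 - x)\<bar> \<le> 2 * y^3" by (metis abs_of_nonneg)
      then show "norm (- (x^3 / (1 - x))) \<le> 2 * y^3" by (simp only: norm_minus_cancel real_norm_def)
    qed (use y in auto)
    then show ?thesis using y by (simp add: r_def power3_eq_cube power4_eq_xxxx)
  qed
  have key: "\<bar>f z + z^2 * S 2 + z^4 * S 4 / 2 + z^6 * S 6 / 3\<bar> \<le> 2 * S 8 * z^8" if z: "0 < z" "z < 1/2" for z
  proof -
    have y: "0 \<le> z^2 / (real k + 1)^2" "z^2 / (real k + 1)^2 \<le> 1/4" for k
    proof -
      have "z^2 \<le> (1/2)^2" using z by (intro power_mono) auto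
      moreover have "(real k + 1)^2 \<ge> 1" by simp
      ultimately have "z^2 / (real k + 1)^2 \<le> (1/4) / 1" by (intro frac_le) (auto simp: power2_eq_square)
      then show "z^2 / (real k + 1)^2 \<le> 1/4" by simp
    qed simp
    have sin0: "sin (pi * z) / (pi * z) > 0" using z by (intro divide_pos_pos sin_gt_zero) (auto simp: pi_gt_zero)
    have "(\<lambda>n. \<Prod>k=1..n. 1 - z^2 / of_nat k^2) \<longlonglongrightarrow> sin (pi * z) / (pi * z)"
      using sin_product_formula_real'[of z] z by simp
    then have "(\<lambda>n. ln (\<Prod>k=1..n. 1 - z^2 / of_nat k^2)) \<longlonglongrightarrow> f z"
      unfolding f_def using sin0 by (intro tendsto_ln) auto
    moreover have "ln (\<Prod>k=1..n. 1 - z^2 / of_nat k^2) = (\<Sum>k<n. ln (1 - z^2 / (real k + 1)^2))" for n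
    proof -
      have "(\<Prod>k=1..n. 1 - z^2 / of_nat k^2) = (\<Prod>k<n. 1 - z^2 / (real k + 1)^2)"
        by (rule prod.reindex_bij_witness[of _ Suc "\<lambda>k. k - 1"]) (auto simp: add.commute)
      moreover have nz: "1 - z^2 / (real k + 1)^2 \<noteq> 0" for k using y(2)[of k] by linarith
      have "ln (\<Prod>k<n. 1 - z^2 / (real k + 1)^2) = (\<Sum>k<n. ln (1 - z^2 / (real k + 1)^2))"
        by (intro ln_prod finite_lessThan nz)
      ultimately show ?thesis by (simp only:)
    qed
    ultimately have s1: "(\<lambda>k. ln (1 - z^2 / (real k + 1)^2)) sums f z" by (simp add: sums_def)
    have sj: "(\<lambda>k. c * (1 / (real k + 1) ^ j)) sums (c * S j)" if "j \<ge> 2" for j c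
      unfolding S_def using summ[OF that] by (intro sums_mult summable_sums)
    have "(\<lambda>k. ln (1 - z^2 / (real k + 1)^2) + z^2 * (1 / (real k + 1) ^ 2) + (z^4/2) * (1 / (real k + 1) ^ 4) + (z^6/3) * (1 / (real k + 1) ^ 6))
      sums (f z + z^2 * S 2 + (z^4/2) * S 4 + (z^6/3) * S 6)"
      by (intro sums_add s1 sj) auto
    also have "(\<lambda>k. ln (1 - z^2 / (real k + 1)^2) + z^2 * (1 / (real k + 1) ^ 2) + (z^4/2) * (1 / (real k + 1) ^ 4) + (z^6/3) * (1 / (real k + 1) ^ 6))
      = (\<lambda>k. r (z^2 / (real k + 1)^2))"
      by (rule ext) (simp add: r_def power_divide flip: power_mult)
    finally have sr: "(\<lambda>k. r (z^2 / (real k + 1)^2)) sums (f z + z^2 * S 2 + z^4 * S 4 / 2 + z^6 * S 6 / 3)" by simp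
    have "norm (\<Sum>k. r (z^2 / (real k + 1)^2)) \<le> (\<Sum>k. 2 * z^8 * (1 / (real k + 1) ^ 8))"
    proof (rule norm_suminf_le)
      show "norm (r (z^2 / (real k + 1)^2)) \<le> 2 * z^8 * (1 / (real k + 1) ^ 8)" for k
        using r_bound[OF y[of k]] by (simp add: power_divide flip: power_mult)
      show "summable (\<lambda>k. 2 * z^8 * (1 / (real k + 1) ^ 8))" by (intro summable_mult summ) simp
    qed
    also have "(\<Sum>k. 2 * z^8 * (1 / (real k + 1) ^ 8)) = 2 * z^8 * S 8" using sj[of 8 "2 * z^8"] by (simp add: sums_iff)
    finally show ?thesis using sr by (simp add: sums_iff mult_ac)
  qed
  have ev: "\<forall>\<^sub>F z in at_right 0. 0 < z \<and> z < (1/2::real)"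
    using eventually_at_right_real[of 0 "1/2::real"] by simp
  have lim: "(g \<longlongrightarrow> - c) (at_right 0)"
    if "\<And>z. 0 < z \<Longrightarrow> z < 1/2 \<Longrightarrow> \<bar>g z + c\<bar> \<le> C * z^2" for g :: "real \<Rightarrow> real" and c C
  proof -
    have "((\<lambda>z. C * z^2) \<longlongrightarrow> C * 0^2) (at_right (0::real))" by (intro tendsto_intros)
    then have l0: "((\<lambda>z. C * z^2) \<longlongrightarrow> 0) (at_right (0::real))" by simp
    have "\<forall>\<^sub>F z in at_right 0. norm (g z + c) \<le> C * z^2"
      using ev by eventually_elim (simp add: that)
    from Lim_null_comparison[OF this l0] have "((\<lambda>z. g z + c) \<longlongrightarrow> 0) (at_right 0)" .
    from tendsto_diff[OF this tendsto_const[of c]] show ?thesis by simp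
  qed
  have nb: "at_right (0::real) \<noteq> bot" by simp
  have "((\<lambda>z. (f z + pi^2/6 * z^2) / z^4) \<longlongrightarrow> - (S 4 / 2)) (at_right 0)"
  proof (rule lim[of _ _ "S 6 / 3 + 2 * S 8"])
    fix z :: real assume z: "0 < z" "z < 1/2"
    have "S 6 \<ge> 0" "S 8 \<ge> 0" unfolding S_def by (intro suminf_nonneg summ; simp)+
    have "\<bar>f z + z^2 * S 2 + z^4 * S 4 / 2\<bar> \<le> 2 * S 8 * z^8 + \<bar>z^6 * S 6 / 3\<bar>" using key[OF z] by linarith
    also have "\<bar>z^6 * S 6 / 3\<bar> = z^6 * S 6 / 3" using z \<open>S 6 \<ge> 0\<close> by simp
    also have "z^8 \<le> z^6" using z by (intro power_decreasing) auto
    then have "2 * S 8 * z^8 \<le> 2 * S 8 * z^6" using \<open>S 8 \<ge> 0\<close> by (intro mult_left_mono) auto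
    finally have "\<bar>f z + z^2 * S 2 + z^4 * S 4 / 2\<bar> \<le> (S 6 / 3 + 2 * S 8) * z^6" by (simp add: algebra_simps)
    also have "\<dots> = (S 6 / 3 + 2 * S 8) * z^2 * z^4" by (simp flip: power_add)
    finally have "\<bar>f z + z^2 * S 2 + z^4 * S 4 / 2\<bar> / z^4 \<le> (S 6 / 3 + 2 * S 8) * z^2"
      using z by (simp add: pos_divide_le_eq)
    also have "\<bar>f z + z^2 * S 2 + z^4 * S 4 / 2\<bar> / z^4 = \<bar>(f z + z^2 * S 2 + z^4 * S 4 / 2) / z^4\<bar>" by simp
    also have "(f z + z^2 * S 2 + z^4 * S 4 / 2) / z^4 = (f z + pi^2/6 * z^2) / z^4 + S 4 / 2"
      using z by (simp add: S2 add_divide_distrib mult.commute)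
    finally show "\<bar>(f z + pi^2/6 * z^2) / z^4 + S 4 / 2\<bar> \<le> (S 6 / 3 + 2 * S 8) * z^2" .
  qed
  moreover have "((\<lambda>z. (f z + pi^2/6 * z^2) / z^4) \<longlongrightarrow> - (pi^4 / 180)) (at_right 0)"
    unfolding f_def by (rule ln_sin_expansion_limit4)
  ultimately have "- (S 4 / 2) = - (pi^4 / 180)" by (rule tendsto_unique[OF nb])
  then have S4: "S 4 = pi^4 / 90" by simp
  have "((\<lambda>z. (f z + pi^2/6 * z^2 + pi^4/180 * z^4) / z^6) \<longlongrightarrow> - (S 6 / 3)) (at_right 0)"
  proof (rule lim[of _ _ "2 * S 8"])
    fix z :: real assume z: "0 < z" "z < 1/2"
    have "\<bar>f z + z^2 * S 2 + z^4 * S 4 / 2 + z^6 * S 6 / 3\<bar> \<le> 2 * S 8 * z^2 * z^6" 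
      using key[OF z] by (simp add: mult.assoc flip: power_add)
    then have "\<bar>f z + z^2 * S 2 + z^4 * S 4 / 2 + z^6 * S 6 / 3\<bar> / z^6 \<le> 2 * S 8 * z^2"
      using z by (simp add: pos_divide_le_eq)
    also have "\<bar>f z + z^2 * S 2 + z^4 * S 4 / 2 + z^6 * S 6 / 3\<bar> / z^6 = \<bar>(f z + z^2 * S 2 + z^4 * S 4 / 2 + z^6 * S 6 / 3) / z^6\<bar>" by simp
    also have "(f z + z^2 * S 2 + z^4 * S 4 / 2 + z^6 * S 6 / 3) / z^6 = (f z + pi^2/6 * z^2 + pi^4/180 * z^4) / z^6 + S 6 / 3"
      using z by (simp add: S2 S4 add_divide_distrib mult.commute)
    finally show "\<bar>(f z + pi^2/6 * z^2 + pi^4/180 * z^4) / z^6 + S 6 / 3\<bar> \<le> 2 * S 8 * z^2" .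
  qed
  moreover have "((\<lambda>z. (f z + pi^2/6 * z^2 + pi^4/180 * z^4) / z^6) \<longlongrightarrow> - (pi^6 / 2835)) (at_right 0)"
    unfolding f_def by (rule ln_sin_expansion_limit6)
  ultimately have "- (S 6 / 3) = - (pi^6 / 2835)" by (rule tendsto_unique[OF nb])
  then have "S 6 = pi^6 / 945" by simp
  with S4 show "(\<Sum>k. 1 / (real k + 1) ^ 4) = pi ^ 4 / 90" "(\<Sum>k. 1 / (real k + 1) ^ 6) = pi ^ 6 / 945"
    by (simp_all add: S_def)
qed

section \<open>Eisenstein series and their limit at the cusp\<close>

definition tau_lattice :: "complex \<Rightarrow> complex set" where
  "tau_lattice \<tau> = {of_int m + of_int n * \<tau> | m n :: int. True}"

abbreviation index_set :: "(int \<times> int) set" where "index_set \<equiv> UNIV - {(0, 0)}"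

text \<open>The sum runs over integer pairs instead of periods, so the index set stays fixed while
  \<tau> varies and termwise differentiation applies.\<close>

definition eis :: "nat \<Rightarrow> complex \<Rightarrow> complex" where
  "eis k \<tau> = (\<Sum>\<^sub>\<infinity>p\<in>index_set. 1 / (of_int (fst p) + of_int (snd p) * \<tau>) ^ k)"

abbreviation imax :: "int \<times> int \<Rightarrow> real" where "imax p \<equiv> real_of_int (max \<bar>fst p\<bar> \<bar>snd p\<bar>)"

lemma summable_imax: "(\<lambda>p. c * (1 / imax p ^ 3)) summable_on index_set"
  using summable_on_max_cubed by (intro summable_on_cmult_right) (simp add: case_prod_unfold)

lemma imax_ge_1: "p \<in> index_set \<Longrightarrow> imax p \<ge> 1"
  by (cases p) auto

lemma is_lattice_tau: "Im \<tau> \<noteq> 0 \<Longrightarrow> is_lattice (tau_lattice \<tau>)"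
  unfolding is_lattice_def tau_lattice_def by (intro exI[of _ 1] exI[of _ \<tau>]) simp

lemma lattice_G_tau:
  assumes "Im \<tau> \<noteq> 0" shows "lattice_G (tau_lattice \<tau>) k = eis k \<tau>"
proof -
  let ?f = "\<lambda>p::int \<times> int. of_int (fst p) + of_int (snd p) * \<tau>"
  have inj: "inj ?f"
  proof (rule injI)
    fix p q :: "int \<times> int" assume e: "?f p = ?f q"
    then have "Im (?f p) = Im (?f q)" by (simp only:)
    then have "snd p = snd q" using assms by simp
    with e show "p = q" by (simp add: prod_eq_iff)
  qed
  have ran: "range ?f = tau_lattice \<tau>"
  proof
    show "tau_lattice \<tau> \<subseteq> range ?f"
    proof
      fix x assume "x \<in> tau_lattice \<tau>"
      then obtain m n where "x = of_int m + of_int n * \<tau>" by (auto simp: tau_lattice_def)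
      then show "x \<in> range ?f" by (intro range_eqI[of _ _ "(m, n)"]) simp
    qed
  qed (auto simp: tau_lattice_def)
  have "bij_betw ?f UNIV (tau_lattice \<tau>)" using inj ran by (auto simp: bij_betw_def)
  then have "bij_betw ?f index_set (tau_lattice \<tau> - {0})"
    by (rule bij_betw_DiffI)
       (use complex_lattice.zero_mem[OF complex_lattice.intro[OF is_lattice_tau[OF assms]]] in \<open>auto simp: bij_betw_def\<close>)
  from infsum_reindex_bij_betw[OF this, of "\<lambda>w. 1 / w ^ k"]
  show ?thesis by (simp add: lattice_G_def eis_def)
qed

lemma eis_term_bound:
  assumes "\<bar>Im \<tau>\<bar> \<ge> \<epsilon>" "\<epsilon> > 0" "\<bar>Re \<tau>\<bar> \<le> R" and p: "p \<in> index_set"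
  defines "w \<equiv> of_int (fst p) + of_int (snd p) * \<tau>" and "K \<equiv> 1 + (1 + R) / \<epsilon>"
  shows "norm w \<ge> imax p / K" "K > 0" "norm w > 0" "w \<noteq> 0"
proof -
  have "R \<ge> 0" using assms by linarith
  then show K: "K > 0" unfolding K_def using assms by (intro add_pos_nonneg divide_nonneg_pos) auto
  show "norm w \<ge> imax p / K"
    using int_combination_bound[OF assms(1-3), of "fst p" "snd p"] K
    by (simp add: w_def K_def[symmetric] pos_divide_le_eq mult.commute)
  moreover have "imax p / K > 0" using imax_ge_1[OF p] K by (intro divide_pos_pos) auto
  ultimately show "norm w > 0" by linarith
  then show "w \<noteq> 0" by auto
qed

lemma holomorphic_eis:
  assumes k: "k \<ge> 3" shows "eis k holomorphic_on {\<tau>. Im \<tau> > 0}"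
proof -
  have "\<exists>D. (eis k has_field_derivative D) (at \<tau>0)" if \<tau>0: "Im \<tau>0 > 0" for \<tau>0
  proof -
    \<comment> \<open>Halving Im \<tau>0 and enlarging the real range by 1 leaves an open
      neighbourhood on which \<open>int_combination_bound\<close> holds with one constant.\<close>
    define \<epsilon> R where "\<epsilon> = Im \<tau>0 / 2" and "R = \<bar>Re \<tau>0\<bar> + 1"
    have e: "\<epsilon> > 0" using \<tau>0 by (simp add: \<epsilon>_def)
    define A where "A = {\<tau>. Im \<tau> > \<epsilon>} \<inter> {\<tau>. Re \<tau> < R} \<inter> {\<tau>. Re \<tau> > - R}"
    have A: "open A" unfolding A_def by (intro open_Int open_halfspace_Im_gt open_halfspace_Re_lt open_halfspace_Re_gt)
    have inA: "\<tau>0 \<in> A" using \<tau>0 by (auto simp: A_def \<epsilon>_def R_def)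
    define K where "K = 1 + (1 + R) / \<epsilon>"
    have b: "norm (of_int (fst p) + of_int (snd p) * \<tau>) \<ge> imax p / K" "K > 0"
        "of_int (fst p) + of_int (snd p) * \<tau> \<noteq> 0" if "\<tau> \<in> A" "p \<in> index_set" for \<tau> p
    proof -
      have "\<bar>Re \<tau>\<bar> \<le> R" "\<epsilon> \<le> \<bar>Im \<tau>\<bar>" using that(1) by (auto simp: A_def)
      then show "norm (of_int (fst p) + of_int (snd p) * \<tau>) \<ge> imax p / K" "K > 0"
        "of_int (fst p) + of_int (snd p) * \<tau> \<noteq> 0"
        unfolding K_def using eis_term_bound[of \<epsilon> \<tau> R p] that(2) e by blast+
    qed
    let ?f' = "\<lambda>p \<tau>. - (of_nat k * of_int (snd p)) / (of_int (fst p) + of_int (snd p) * \<tau>) ^ (k + 1)"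
    have "((\<lambda>\<tau>. \<Sum>\<^sub>\<infinity>p\<in>index_set. 1 / (of_int (fst p) + of_int (snd p) * \<tau>) ^ k) has_field_derivative
       (\<Sum>\<^sub>\<infinity>p\<in>index_set. ?f' p \<tau>0)) (at \<tau>0)"
    proof (rule has_field_derivative_infsum(1)[OF A inA summable_imax[of "K ^ k"]])
      fix p \<tau> assume p: "p \<in> index_set" and \<tau>: "\<tau> \<in> A"
      let ?w = "of_int (fst p) + of_int (snd p) * \<tau>"
      note b = b[OF \<tau> p] and m = imax_ge_1[OF p]
      have "norm (1 / ?w ^ k) = 1 / norm ?w ^ k" by (simp add: norm_divide norm_power)
      also have "\<dots> \<le> 1 / (imax p / K) ^ k"
        using b m by (intro divide_left_mono power_mono mult_pos_pos zero_less_power divide_pos_pos) auto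
      also have "\<dots> = K ^ k * (1 / imax p ^ k)" by (simp add: power_divide)
      also have "\<dots> \<le> K ^ k * (1 / imax p ^ 3)"
        using b m k by (intro mult_left_mono divide_left_mono power_increasing mult_pos_pos zero_less_power) auto
      finally show "norm (1 / ?w ^ k) \<le> K ^ k * (1 / imax p ^ 3)" .
      obtain j where j: "k = Suc j" using k by (cases k) auto
      have "((\<lambda>\<tau>. inverse ((of_int (fst p) + of_int (snd p) * \<tau>) ^ Suc j)) has_field_derivative
          - (inverse (?w ^ Suc j) * (of_nat (Suc j) * (of_int (snd p) * ?w ^ (Suc j - Suc 0))) * inverse (?w ^ Suc j))) (at \<tau>)"
      proof (rule DERIV_inverse'[OF DERIV_power])
        show "((\<lambda>\<tau>. of_int (fst p) + of_int (snd p) * \<tau>) has_field_derivative of_int (snd p)) (at \<tau>)"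
          by (auto intro!: derivative_eq_intros)
      qed (use b in simp)
      also have "- (inverse (?w ^ Suc j) * (of_nat (Suc j) * (of_int (snd p) * ?w ^ (Suc j - Suc 0))) * inverse (?w ^ Suc j)) = ?f' p \<tau>"
        using b(3) unfolding j by (simp add: divide_simps)
      finally show "((\<lambda>\<tau>. 1 / (of_int (fst p) + of_int (snd p) * \<tau>) ^ k) has_field_derivative ?f' p \<tau>) (at \<tau>)"
        by (simp only: inverse_eq_divide j)
    qed
    then show ?thesis by (auto simp: eis_def[abs_def])
  qed
  then show ?thesis by (simp add: holomorphic_on_open open_halfspace_Im_gt)
qed

text \<open>The row of integers in an Eisenstein sum, twice the zeta value for even k; it is the
  value at the cusp.\<close>

definition zeta2 :: "nat \<Rightarrow> complex" where
  "zeta2 k = (\<Sum>\<^sub>\<infinity>m\<in>UNIV - {0::int}. 1 / of_int m ^ k)"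

text \<open>The row of pairs (m, 0) contributes \<open>zeta2\<close> exactly. Every other term has a
  denominator of norm at least Im \<tau>, so one of its k >= 4 powers pays for the factor 1 / Im
  \<tau> and at least three remain for summability.\<close>

lemma eis_limit_bound:
  assumes k: "k \<ge> 4"
  obtains C where "\<And>\<tau>. \<bar>Re \<tau>\<bar> \<le> 1/2 \<Longrightarrow> Im \<tau> \<ge> 1 \<Longrightarrow> norm (eis k \<tau> - zeta2 k) \<le> C / Im \<tau>"
proof -
  define K :: real where "K = 1 + (1 + 1/2) / 1"
  define A where "A = {p::int \<times> int. snd p = 0 \<and> fst p \<noteq> 0}"
  define B where "B = {p::int \<times> int. snd p \<noteq> 0}"
  have AB: "index_set = A \<union> B" "A \<inter> B = {}" by (auto simp: A_def B_def)
  define C where "C = (\<Sum>\<^sub>\<infinity>p\<in>B. K ^ 3 * (1 / imax p ^ 3))"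
  have sumB: "(\<lambda>p. c * (1 / imax p ^ 3)) summable_on B" for c
    by (rule summable_on_subset_banach[OF summable_imax]) (auto simp: B_def)
  have "norm (eis k \<tau> - zeta2 k) \<le> C / Im \<tau>" if re: "\<bar>Re \<tau>\<bar> \<le> 1/2" and im: "Im \<tau> \<ge> 1" for \<tau>
  proof -
    let ?w = "\<lambda>p::int \<times> int. of_int (fst p) + of_int (snd p) * \<tau>"
    let ?t = "\<lambda>p::int \<times> int. 1 / ?w p ^ k"
    have b: "norm (?w p) \<ge> imax p / K" "K > 0" "norm (?w p) > 0" if "p \<in> index_set" for p
      using eis_term_bound[of 1 \<tau> "1/2" p] that re im by (auto simp: K_def)
    have K0: "K > 0" by (simp add: K_def)
    have pw: "1 / norm (?w p) ^ 3 \<le> K ^ 3 * (1 / imax p ^ 3)" if p: "p \<in> index_set" for p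
    proof -
      have "1 / norm (?w p) ^ 3 \<le> 1 / (imax p / K) ^ 3"
        using b[OF p] imax_ge_1[OF p] by (intro divide_left_mono power_mono mult_pos_pos zero_less_power divide_pos_pos) auto
      then show ?thesis by (simp add: power_divide)
    qed
    have leB: "norm (?t p) \<le> K ^ 3 / Im \<tau> * (1 / imax p ^ 3)" if p: "p \<in> B" for p
    proof -
      have pi: "p \<in> index_set" using p AB by auto
      have "1 * Im \<tau> \<le> \<bar>real_of_int (snd p)\<bar> * Im \<tau>" using p im by (intro mult_right_mono) (auto simp: B_def)
      also have "\<dots> = \<bar>Im (?w p)\<bar>" using im by (simp add: abs_mult)
      also have "\<dots> \<le> norm (?w p)" by (rule abs_Im_le_cmod)
      finally have w: "Im \<tau> \<le> norm (?w p)" by simp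
      have "norm (?w p) ^ 1 \<le> norm (?w p) ^ (k - 3)" using w im k by (intro power_increasing) auto
      then have "Im \<tau> * norm (?w p) ^ 3 \<le> norm (?w p) ^ (k - 3) * norm (?w p) ^ 3" using w by (intro mult_right_mono) auto
      also have "\<dots> = norm (?w p) ^ k" using k by (simp flip: power_add)
      finally have "1 / norm (?w p) ^ k \<le> 1 / (Im \<tau> * norm (?w p) ^ 3)"
        using im b(3)[OF pi] by (intro divide_left_mono mult_pos_pos zero_less_power) auto
      also have "\<dots> = 1 / Im \<tau> * (1 / norm (?w p) ^ 3)" by simp
      also have "\<dots> \<le> 1 / Im \<tau> * (K ^ 3 * (1 / imax p ^ 3))" using pw[OF pi] im by (intro mult_left_mono) auto
      finally show ?thesis by (simp add: norm_divide norm_power)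
    qed
    have sB: "?t summable_on B"
      by (rule abs_summable_summable, rule Infinite_Sum.abs_summable_on_comparison_test'[OF sumB leB])
    have sA: "?t summable_on A"
    proof (rule abs_summable_summable, rule Infinite_Sum.abs_summable_on_comparison_test')
      show "(\<lambda>p. K ^ 3 * (1 / imax p ^ 3)) summable_on A"
        by (rule summable_on_subset_banach[OF summable_imax]) (auto simp: A_def)
      fix p assume p: "p \<in> A"
      then have pi: "p \<in> index_set" using AB by auto
      have w: "?w p = of_int (fst p)" using p by (simp add: A_def)
      have "\<bar>fst p\<bar> \<ge> 1" using p by (auto simp: A_def)
      then have "real_of_int \<bar>fst p\<bar> \<ge> 1" by linarith
      then have "norm (?w p) \<ge> 1" by (simp add: w)
      then have "norm (?w p) ^ 3 \<le> norm (?w p) ^ k" using k by (intro power_increasing) auto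
      then have "1 / norm (?w p) ^ k \<le> 1 / norm (?w p) ^ 3"
        using b(3)[OF pi] by (intro divide_left_mono mult_pos_pos zero_less_power) auto
      then show "norm (?t p) \<le> K ^ 3 * (1 / imax p ^ 3)" using pw[OF pi] by (simp add: norm_divide norm_power)
    qed
    have "eis k \<tau> = infsum ?t A + infsum ?t B"
      unfolding eis_def AB(1) by (rule infsum_Un_disjoint[OF sA sB AB(2)])
    also have "infsum ?t A = zeta2 k" unfolding zeta2_def
      by (rule infsum_reindex_bij_witness[of _ "\<lambda>m. (m, 0)" fst]) (auto simp: A_def)
    finally have "norm (eis k \<tau> - zeta2 k) = norm (infsum ?t B)" by simp
    also have "\<dots> \<le> (\<Sum>\<^sub>\<infinity>p\<in>B. K ^ 3 / Im \<tau> * (1 / imax p ^ 3))"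
      using norm_infsum_le[OF has_sum_infsum[OF sB] has_sum_infsum[OF sumB] leB] .
    also have "\<dots> = (\<Sum>\<^sub>\<infinity>p\<in>B. 1 / Im \<tau> * (K ^ 3 * (1 / imax p ^ 3)))" by simp
    also have "\<dots> = C / Im \<tau>" unfolding C_def infsum_cmult_right' by simp
    finally show ?thesis .
  qed
  then show ?thesis by (rule that)
qed

lemma zeta2_eq:
  assumes k: "even k" "k \<ge> 4" shows "zeta2 k = of_real (2 * (\<Sum>n. 1 / (real n + 1) ^ k))"
proof -
  let ?t = "\<lambda>m::int. 1 / (of_int m :: complex) ^ k"
  define S where "S = (\<Sum>n. 1 / (real n + 1) ^ k)"
  have "summable (\<lambda>n. 1 / (real n + 1) ^ k)"
  proof (rule summable_comparison_test')
    show "summable (\<lambda>n. 1 / (real n + 1) ^ 2)" using inverse_squares_sums by (auto simp: sums_iff add.commute)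
    fix n :: nat
    have "(real n + 1) ^ 2 \<le> (real n + 1) ^ k" using k by (intro power_increasing) auto
    then show "norm (1 / (real n + 1) ^ k) \<le> 1 / (real n + 1) ^ 2" by (simp add: frac_le)
  qed
  then have "((\<lambda>n. 1 / (real n + 1) ^ k) has_sum S) UNIV"
    unfolding S_def by (intro sums_nonneg_imp_has_sum summable_sums) auto
  then have hs: "((\<lambda>n. complex_of_real (1 / (real n + 1) ^ k)) has_sum of_real S) UNIV"
    by (simp only: has_sum_of_real_iff)
  have "(?t has_sum of_real S) (range (\<lambda>n. int n + 1))"
    using hs by (subst has_sum_reindex) (auto simp: inj_on_def o_def)
  moreover have "(?t has_sum of_real S) (range (\<lambda>n. - (int n + 1)))"
  proof (subst has_sum_reindex)
    have "of_int (- (int n + 1)) ^ k = (complex_of_int (int n + 1)) ^ k" for n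
      using k by (metis of_int_minus power_minus_even)
    then show "(?t \<circ> (\<lambda>n. - (int n + 1)) has_sum of_real S) UNIV" using hs by (simp add: o_def del: of_int_minus)
  qed (auto simp: inj_on_def)
  ultimately have "(?t has_sum (of_real S + of_real S)) (range (\<lambda>n. int n + 1) \<union> range (\<lambda>n. - (int n + 1)))"
    by (rule has_sum_Un_disjoint) auto
  also have "range (\<lambda>n. int n + 1) \<union> range (\<lambda>n. - (int n + 1)) = UNIV - {0}"
  proof -
    have "m \<in> range (\<lambda>n. int n + 1) \<union> range (\<lambda>n. - (int n + 1))" if "m \<noteq> 0" for m
    proof (cases "m > 0")
      case True
      then have "m = int (nat (m - 1)) + 1" by simp
      then show ?thesis by blast
    next
      case False
      then have "m = - (int (nat (- m - 1)) + 1)" using that by simp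
      then show ?thesis by blast
    qed
    then show ?thesis by auto
  qed
  finally show ?thesis by (simp add: zeta2_def infsumI S_def)
qed

text \<open>The cubic degenerates at the cusp: both terms equal (64/27) pi^12. Together with a
  nonzero g2 this forces j to tend to infinity.\<close>

lemma zeta2_discriminant: "zeta2 4 \<noteq> 0" "(60 * zeta2 4) ^ 3 - 27 * (140 * zeta2 6) ^ 2 = 0"
proof -
  have z4: "zeta2 4 = of_real (pi ^ 4 / 45)" and z6: "zeta2 6 = of_real (2 * pi ^ 6 / 945)"
    by (simp_all add: zeta2_eq zeta_sums)
  show "zeta2 4 \<noteq> 0" by (simp add: z4)
  have "(60 * zeta2 4) ^ 3 - 27 * (140 * zeta2 6) ^ 2 = of_real ((60 * (pi ^ 4 / 45)) ^ 3 - 27 * (140 * (2 * pi ^ 6 / 945)) ^ 2)"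
    unfolding z4 z6 by simp
  also have "(60 * (pi ^ 4 / 45)) ^ 3 - 27 * (140 * (2 * pi ^ 6 / 945)) ^ 2 = 0"
    by (simp add: power_mult_distrib power_divide flip: power_mult)
  finally show "(60 * zeta2 4) ^ 3 - 27 * (140 * zeta2 6) ^ 2 = 0" by simp
qed

text \<open>Klein's absolute invariant J, that is j/1728, written in g2 and g3 of the
  lattice.\<close>

definition tau_j :: "complex \<Rightarrow> complex" where
  "tau_j \<tau> = (60 * eis 4 \<tau>) ^ 3 / ((60 * eis 4 \<tau>) ^ 3 - 27 * (140 * eis 6 \<tau>) ^ 2)"

lemma tau_discriminant: "Im \<tau> > 0 \<Longrightarrow> (60 * eis 4 \<tau>) ^ 3 - 27 * (140 * eis 6 \<tau>) ^ 2 \<noteq> 0"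
  using complex_lattice.discriminant_nonzero[OF complex_lattice.intro[OF is_lattice_tau[of \<tau>]]]
  by (simp add: lattice_g2_eq lattice_g3_eq lattice_G_tau)

lemma holomorphic_tau_j: "tau_j holomorphic_on {\<tau>. Im \<tau> > 0}"
  unfolding tau_j_def using tau_discriminant by (intro holomorphic_intros holomorphic_eis) auto

lemma tau_j_at_cusp:
  obtains Y where "Y \<ge> 1" "\<And>\<tau>. \<bar>Re \<tau>\<bar> \<le> 1/2 \<Longrightarrow> Im \<tau> \<ge> Y \<Longrightarrow> norm (tau_j \<tau>) \<ge> B"
proof -
  \<comment> \<open>The approach to the cusp inside the strip |Re \<tau>| <= 1/2, expressed as a
    filter so that limits of quotients can be taken.\<close>
  define F where "F = inf (filtercomap Im at_top) (principal {\<tau>. \<bar>Re \<tau>\<bar> \<le> 1/2})"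
  have evF: "\<forall>\<^sub>F \<tau> in F. P \<tau>" if "\<And>\<tau>. \<bar>Re \<tau>\<bar> \<le> 1/2 \<Longrightarrow> Im \<tau> \<ge> c \<Longrightarrow> P \<tau>" for P c
    unfolding F_def eventually_inf_principal eventually_filtercomap_at_top_linorder using that by blast
  have Im: "filterlim Im at_top F" unfolding F_def by (rule filterlim_mono[OF filterlim_filtercomap order_refl inf_le1])
  have lim: "(eis k \<longlongrightarrow> zeta2 k) F" if k: "k \<ge> 4" for k
  proof (rule eis_limit_bound[OF k])
    fix C assume C: "\<And>\<tau>. \<bar>Re \<tau>\<bar> \<le> 1/2 \<Longrightarrow> Im \<tau> \<ge> 1 \<Longrightarrow> norm (eis k \<tau> - zeta2 k) \<le> C / Im \<tau>"
    have "((\<lambda>\<tau>. C / Im \<tau>) \<longlongrightarrow> 0) F" by (rule real_tendsto_divide_at_top[OF tendsto_const Im])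
    then have "((\<lambda>\<tau>. eis k \<tau> - zeta2 k) \<longlongrightarrow> 0) F"
      by (rule Lim_null_comparison[rotated]) (rule evF[of 1], rule C)
    then show ?thesis by (simp only: LIM_zero_iff)
  qed
  have num: "((\<lambda>\<tau>. (60 * eis 4 \<tau>) ^ 3) \<longlongrightarrow> (60 * zeta2 4) ^ 3) F" by (intro tendsto_intros lim) auto
  have "((\<lambda>\<tau>. (60 * eis 4 \<tau>) ^ 3 - 27 * (140 * eis 6 \<tau>) ^ 2) \<longlongrightarrow> (60 * zeta2 4) ^ 3 - 27 * (140 * zeta2 6) ^ 2) F"
    by (intro tendsto_intros lim) auto
  then have "((\<lambda>\<tau>. (60 * eis 4 \<tau>) ^ 3 - 27 * (140 * eis 6 \<tau>) ^ 2) \<longlongrightarrow> 0) F" by (simp only: zeta2_discriminant(2))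
  moreover have "\<forall>\<^sub>F \<tau> in F. (60 * eis 4 \<tau>) ^ 3 - 27 * (140 * eis 6 \<tau>) ^ 2 \<noteq> 0"
    by (rule evF[of 1]) (rule tau_discriminant, simp)
  ultimately have den: "filterlim (\<lambda>\<tau>. (60 * eis 4 \<tau>) ^ 3 - 27 * (140 * eis 6 \<tau>) ^ 2) (at 0) F"
    by (simp add: filterlim_at)
  have "filterlim tau_j at_infinity F" unfolding tau_j_def
    by (rule filterlim_divide_at_infinity[OF num den]) (use zeta2_discriminant(1) in simp)
  then have "\<forall>\<^sub>F \<tau> in F. norm (tau_j \<tau>) \<ge> B" by (simp add: filterlim_at_infinity_conv_norm_at_top filterlim_at_top)
  then obtain N where N: "\<And>\<tau>. Im \<tau> \<ge> N \<Longrightarrow> \<bar>Re \<tau>\<bar> \<le> 1/2 \<Longrightarrow> norm (tau_j \<tau>) \<ge> B"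
    unfolding F_def eventually_inf_principal eventually_filtercomap_at_top_linorder by blast
  show ?thesis by (rule that[of "max N 1"]) (use N in auto)
qed

section \<open>Scaling of lattices and reduced bases\<close>

lemma lattice_G_scale:
  assumes "v \<noteq> 0" shows "lattice_G ((*) v ` L) k = lattice_G L k / v ^ k"
proof -
  have "lattice_G ((*) v ` L) k = (\<Sum>\<^sub>\<infinity>w\<in>L - {0}. 1 / (v * w) ^ k)" unfolding lattice_G_def
    by (rule infsum_reindex_bij_witness[of _ "(*) v" "\<lambda>w. w / v"]) (use assms in auto)
  also have "\<dots> = (\<Sum>\<^sub>\<infinity>w\<in>L - {0}. (1 / v ^ k) * (1 / w ^ k))" by (simp add: power_mult_distrib)
  also have "\<dots> = lattice_G L k / v ^ k" unfolding lattice_G_def infsum_cmult_right' by simp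
  finally show ?thesis .
qed

lemma is_lattice_scale:
  assumes "v \<noteq> 0" "is_lattice L" shows "is_lattice ((*) v ` L)"
proof -
  obtain w1 w2 where w: "Im (w2 / w1) \<noteq> 0" "L = {of_int m * w1 + of_int n * w2 | m n :: int. True}"
    using assms(2) unfolding is_lattice_def by blast
  have "(*) v ` L = {of_int m * (v * w1) + of_int n * (v * w2) | m n :: int. True}"
  proof -
    have "(*) v ` L = {v * (of_int m * w1 + of_int n * w2) | m n :: int. True}" unfolding w(2) by auto
    then show ?thesis by (simp only: distrib_left mult.left_commute)
  qed
  moreover have "Im (v * w2 / (v * w1)) \<noteq> 0" using w(1) assms(1) by simp
  ultimately show ?thesis unfolding is_lattice_def by blast
qed

context complex_lattice begin

lemma ex_shortest:
  assumes "S \<subseteq> L" "S \<noteq> {}"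
  obtains v where "v \<in> S" "\<And>w. w \<in> S \<Longrightarrow> norm v \<le> norm w"
proof -
  obtain s where s: "s \<in> S" using assms by blast
  define T where "T = {w\<in>S. norm w \<le> norm s}"
  have fin: "finite T" by (rule finite_subset[OF _ finite_norm_le[of "norm s"]]) (use assms in \<open>auto simp: T_def\<close>)
  have "Min (norm ` T) \<in> norm ` T" by (intro Min_in) (use fin s in \<open>auto simp: T_def\<close>)
  then obtain v where v: "v \<in> T" "norm v = Min (norm ` T)" by force
  show ?thesis
  proof (rule that)
    show "v \<in> S" using v by (simp add: T_def)
    fix w assume w: "w \<in> S"
    show "norm v \<le> norm w"
    proof (cases "w \<in> T")
      case True then show ?thesis using fin by (auto simp: v(2) intro!: Min_le)
    next
      case False then show ?thesis using v w by (auto simp: T_def)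
    qed
  qed
qed

text \<open>v is a shortest nonzero period and u = v \<tau> a shortest period off the real line of
  v. Comparing u with u + v and u - v bounds Re \<tau>, and |\<tau>| >= 1 then bounds Im \<tau> from
  below.\<close>

lemma reduced_basis:
  obtains v \<tau> where "v \<noteq> 0" "L = (*) v ` tau_lattice \<tau>" "\<bar>Re \<tau>\<bar> \<le> 1/2" "Im \<tau> \<ge> 1/2"
proof -
  obtain w1 w2 where w: "Im (w2 / w1) \<noteq> 0" "L = {of_int m * w1 + of_int n * w2 | m n :: int. True}" by (rule basis)
  have "of_int 1 * w1 + of_int 0 * w2 \<in> L" "of_int 0 * w1 + of_int 1 * w2 \<in> L" unfolding w(2) by blast+
  then have wL: "w1 \<in> L" "w2 \<in> L" by simp_all
  have w1: "w1 \<noteq> 0" using w(1) by auto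
  obtain v where v: "v \<in> L - {0}" "\<And>w. w \<in> L - {0} \<Longrightarrow> norm v \<le> norm w"
    by (rule ex_shortest[of "L - {0}"]) (use wL w1 in auto)
  have v0: "v \<noteq> 0" using v by auto
  define S where "S = {w\<in>L. Im (w / v) \<noteq> 0}"
  have "S \<noteq> {}"
  proof
    assume "S = {}"
    then have "Im (w1 / v) = 0" "Im (w2 / v) = 0" using wL by (auto simp: S_def)
    then have "w1 / v \<in> \<real>" "w2 / v \<in> \<real>" by (simp_all add: complex_is_Real_iff)
    then have "(w2 / v) / (w1 / v) \<in> \<real>" by (rule Reals_divide[rotated])
    then show False using w(1) v0 by (simp add: complex_is_Real_iff)
  qed
  then obtain u' where u': "u' \<in> S" "\<And>w. w \<in> S \<Longrightarrow> norm u' \<le> norm w"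
    using ex_shortest[of S] by (auto simp: S_def)
  \<comment> \<open>The sign is chosen so that the ratio lies in the upper half plane.\<close>
  define u where "u = (if Im (u' / v) > 0 then u' else - u')"
  have u: "u \<in> L" "Im (u / v) > 0" "\<And>w. w \<in> S \<Longrightarrow> norm u \<le> norm w"
    using u' by (auto simp: u_def S_def)
  define \<tau> where "\<tau> = u / v"
  have u_eq: "u = v * \<tau>" using v0 by (simp add: \<tau>_def)
  have im: "Im \<tau> > 0" using u by (simp add: \<tau>_def)
  have min: "norm \<tau> \<le> norm z" if "v * z \<in> L" "Im z \<noteq> 0" for z
  proof -
    have "v * z \<in> S" using that v0 by (simp add: S_def)
    from u(3)[OF this] show ?thesis using v0 by (simp add: u_eq norm_mult)
  qed
  have sq: "norm z ^ 2 = Re z ^ 2 + Im z ^ 2" for z by (rule cmod_power2)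
  have \<tau>1: "norm \<tau> \<ge> 1"
  proof -
    have "u \<in> L - {0}" using u im by (auto simp: \<tau>_def)
    from v(2)[OF this] show ?thesis using v0 by (simp add: u_eq norm_mult)
  qed
  have re: "\<bar>Re \<tau>\<bar> \<le> 1/2"
  proof -
    have "v * (\<tau> + 1) \<in> L" "v * (\<tau> - 1) \<in> L"
      using add_mem[OF u(1), of v] diff_mem[OF u(1), of v] v by (auto simp: u_eq algebra_simps)
    then have "norm \<tau> \<le> norm (\<tau> + 1)" "norm \<tau> \<le> norm (\<tau> - 1)" using im by (auto intro!: min)
    then have "norm \<tau> ^ 2 \<le> norm (\<tau> + 1) ^ 2" "norm \<tau> ^ 2 \<le> norm (\<tau> - 1) ^ 2" by (auto intro!: power_mono)
    then show ?thesis unfolding sq by (simp add: power2_eq_square algebra_simps)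
  qed
  have re2: "Re \<tau> ^ 2 \<le> 1/4" using re power_mono[OF re, of 2] by (simp add: power2_eq_square)
  have "norm \<tau> ^ 2 \<ge> 1" using \<tau>1 by simp
  then have "Im \<tau> ^ 2 \<ge> (1/2)^2" using re2 sq[of \<tau>] by (simp add: power2_eq_square)
  then have im2: "Im \<tau> \<ge> 1/2" using im by (auto dest: power2_le_imp_le)
  have "L = (*) v ` tau_lattice \<tau>"
  proof
    show "(*) v ` tau_lattice \<tau> \<subseteq> L"
    proof
      fix z assume "z \<in> (*) v ` tau_lattice \<tau>"
      then obtain m n where z: "z = of_int m * v + of_int n * u" by (auto simp: tau_lattice_def u_eq algebra_simps)
      have int_mem: "of_int k * x \<in> L" if x: "x \<in> L" for k x
      proof (induction k rule: int_induct[of _ 0])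
        case (step1 i)
        from add_mem[OF x step1(2)] show ?case by (simp add: distrib_right add.commute)
      next
        case (step2 i) then show ?case using diff_mem[OF _ x] by (simp add: algebra_simps)
      qed simp
      show "z \<in> L" unfolding z using v u by (intro add_mem int_mem) auto
    qed
    show "L \<subseteq> (*) v ` tau_lattice \<tau>"
    proof
      fix x assume x: "x \<in> L"
      define t where "t = Im (x / v) / Im \<tau>"
      define s where "s = Re (x / v) - t * Re \<tau>"
      have xs: "x / v = of_real s + of_real t * \<tau>" using im by (simp add: complex_eq_iff s_def t_def)
      \<comment> \<open>Rounding to the nearest integer, with remainders at most 1/2 in absolute
        value, makes the remainder short enough to contradict minimality.\<close>
      define m n where "m = round s" and "n = round t"
      define s' t' where "s' = s - of_int m" and "t' = t - of_int n"
      have st: "\<bar>s'\<bar> \<le> 1/2" "\<bar>t'\<bar> \<le> 1/2"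
        using of_int_round_abs_le[of s] of_int_round_abs_le[of t] by (auto simp: s'_def t'_def m_def n_def abs_minus_commute)
      define z where "z = of_real s' + of_real t' * \<tau>"
      have "v * (of_int m + of_int n * \<tau>) \<in> L"
        using \<open>(*) v ` tau_lattice \<tau> \<subseteq> L\<close> by (auto simp: tau_lattice_def)
      then have "x - v * (of_int m + of_int n * \<tau>) \<in> L" using x by (intro diff_mem)
      moreover have "x - v * (of_int m + of_int n * \<tau>) = v * z"
      proof -
        have "x = v * (of_real s + of_real t * \<tau>)" using xs v0 by (simp add: field_simps)
        then show ?thesis by (simp add: z_def s'_def t'_def algebra_simps)
      qed
      ultimately have zL: "v * z \<in> L" by simp
      \<comment> \<open>Otherwise the remainder lies off the line of v, while its squared norm
        relative to v is at most 1/2 + |\<tau>|^2/4. Minimality of u would give |\<tau>|^2 <= 2/3,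
        against |\<tau>| >= 1.\<close>
      have t0: "t' = 0"
      proof (rule ccontr)
        assume t': "t' \<noteq> 0"
        then have "norm \<tau> \<le> norm z" using im by (intro min[OF zL]) (simp add: z_def)
        then have "norm \<tau> ^ 2 \<le> norm z ^ 2" by (intro power_mono) auto
        also have "norm z ^ 2 = s'^2 + 2 * (s' * t' * Re \<tau>) + t'^2 * norm \<tau> ^ 2"
          unfolding sq by (simp add: z_def power2_eq_square algebra_simps)
        also have "\<dots> \<le> 1/4 + 2 * (1/2 * (1/2) * (1/2)) + 1/4 * norm \<tau> ^ 2"
        proof (intro add_mono mult_left_mono mult_right_mono)
          have "\<bar>s'\<bar> ^ 2 \<le> (1/2)^2" "\<bar>t'\<bar> ^ 2 \<le> (1/2)^2" using st by (intro power_mono; simp)+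
          then show "s'^2 \<le> 1/4" "t'^2 \<le> 1/4" by (simp_all add: power2_eq_square)
          have "\<bar>s' * t' * Re \<tau>\<bar> \<le> 1/2 * (1/2) * (1/2)" unfolding abs_mult using st re by (intro mult_mono) auto
          then show "s' * t' * Re \<tau> \<le> 1/2 * (1/2) * (1/2)" by linarith
        qed auto
        finally have "norm \<tau> ^ 2 \<le> 2/3" by simp
        with \<open>norm \<tau> ^ 2 \<ge> 1\<close> show False by linarith
      qed
      have "z = 0"
      proof (rule ccontr)
        assume "z \<noteq> 0"
        then have "norm v \<le> norm (v * z)" using zL v0 by (intro v(2)) auto
        then have "1 \<le> norm z" using v0 by (simp add: norm_mult)
        moreover have "norm z = \<bar>s'\<bar>" by (simp add: z_def t0)
        ultimately show False using st by linarith
      qed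
      then have "s' = 0" using t0 by (simp add: z_def)
      then have "x / v = of_int m + of_int n * \<tau>" using t0 xs by (simp add: s'_def t'_def)
      then have "x = v * (of_int m + of_int n * \<tau>)" using v0 by (simp add: field_simps)
      then show "x \<in> (*) v ` tau_lattice \<tau>" by (auto simp: tau_lattice_def)
    qed
  qed
  then show ?thesis using that v0 re im2 by blast
qed

end

text \<open>A reduced basis describes the same lattice up to a factor v. Numerator and denominator
  of \<open>tau_j\<close> both scale by v^-12, so the value is unchanged.\<close>

lemma tau_j_reduced:
  assumes "Im \<tau> > 0"
  obtains \<tau>' where "\<bar>Re \<tau>'\<bar> \<le> 1/2" "Im \<tau>' \<ge> 1/2" "tau_j \<tau>' = tau_j \<tau>"
proof -
  interpret complex_lattice "tau_lattice \<tau>" by (rule complex_lattice.intro[OF is_lattice_tau]) (use assms in simp)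
  obtain v \<tau>' where v: "v \<noteq> 0" "tau_lattice \<tau> = (*) v ` tau_lattice \<tau>'" "\<bar>Re \<tau>'\<bar> \<le> 1/2" "Im \<tau>' \<ge> 1/2" by (rule reduced_basis)
  have e: "eis k \<tau> = eis k \<tau>' / v ^ k" for k
    using lattice_G_scale[OF v(1), of "tau_lattice \<tau>'" k] lattice_G_tau[of \<tau> k] lattice_G_tau[of \<tau>' k] v(2,4) assms by simp
  define c where "c = v ^ 12"
  have c: "c \<noteq> 0" using v by (simp add: c_def)
  have "tau_j \<tau> = ((60 * eis 4 \<tau>') ^ 3 / c) / (((60 * eis 4 \<tau>') ^ 3 - 27 * (140 * eis 6 \<tau>') ^ 2) / c)"
    unfolding tau_j_def e c_def by (simp add: power_divide diff_divide_distrib power_mult_distrib flip: power_mult)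
  also have "\<dots> = tau_j \<tau>'" using c by (simp add: tau_j_def)
  finally show ?thesis using that v by metis
qed

text \<open>Openness is the open mapping theorem, \<open>tau_j\<close> being unbounded and hence not
  constant. For closedness, values near a limit point c have reduced arguments of bounded height,
  hence in a compact rectangle with compact image.\<close>

lemma tau_j_surj: "tau_j ` {\<tau>. Im \<tau> > 0} = UNIV"
proof -
  let ?H = "{\<tau>. Im \<tau> > 0}"
  have H: "open ?H" "connected ?H"
    by (rule open_halfspace_Im_gt, rule convex_connected[OF convex_halfspace_Im_gt])
  have nc: "\<not> tau_j constant_on ?H"
  proof
    assume "tau_j constant_on ?H"
    then obtain c where c: "\<And>\<tau>. \<tau> \<in> ?H \<Longrightarrow> tau_j \<tau> = c" by (auto simp: constant_on_def)
    obtain Y where Y: "Y \<ge> 1" "\<And>\<tau>. \<bar>Re \<tau>\<bar> \<le> 1/2 \<Longrightarrow> Im \<tau> \<ge> Y \<Longrightarrow> norm (tau_j \<tau>) \<ge> norm c + 1"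
      using tau_j_at_cusp[of "norm c + 1"] by blast
    have "norm (tau_j (Complex 0 Y)) \<ge> norm c + 1" by (rule Y(2)) auto
    moreover have "tau_j (Complex 0 Y) = c" using Y by (intro c) auto
    ultimately show False by simp
  qed
  have op: "open (tau_j ` ?H)" by (rule open_mapping_thm[OF holomorphic_tau_j H H(1) subset_refl nc])
  have "closed (tau_j ` ?H)"
    unfolding closure_subset_eq[symmetric]
  proof
    fix c assume c: "c \<in> closure (tau_j ` ?H)"
    obtain Y where Y: "Y \<ge> 1" "\<And>\<tau>. \<bar>Re \<tau>\<bar> \<le> 1/2 \<Longrightarrow> Im \<tau> \<ge> Y \<Longrightarrow> norm (tau_j \<tau>) \<ge> norm c + 1"
      using tau_j_at_cusp[of "norm c + 1"] by blast
    \<comment> \<open>Above height Y the norm is at least |c| + 1, so a value at distance less than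
      1 from c has its reduced argument in this rectangle.\<close>
    define K where "K = cbox (Complex (-1/2) (1/2)) (Complex (1/2) Y)"
    have KH: "K \<subseteq> ?H" by (auto simp: K_def in_cbox_complex_iff)
    have "compact (tau_j ` K)"
      by (intro compact_continuous_image holomorphic_on_imp_continuous_on holomorphic_on_subset[OF holomorphic_tau_j KH])
         (simp add: K_def)
    then have cl: "closed (tau_j ` K)" by (rule compact_imp_closed)
    have "\<exists>y\<in>tau_j ` K. dist y c < e" if e: "e > 0" for e
    proof -
      have "min e 1 > 0" using e by simp
      with c obtain y where y: "y \<in> tau_j ` ?H" "dist y c < min e 1"
        unfolding closure_approachable by blast
      then obtain \<tau> where "Im \<tau> > 0" "y = tau_j \<tau>" by auto
      then obtain \<tau>' where t: "\<bar>Re \<tau>'\<bar> \<le> 1/2" "Im \<tau>' \<ge> 1/2" "tau_j \<tau>' = y"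
        by (rule_tac tau_j_reduced[of \<tau>]) auto
      have "norm y < norm c + 1" using y(2) norm_triangle_sub[of y c] by (simp add: dist_norm)
      then have "Im \<tau>' < Y" using Y(2)[OF t(1)] t(3) by force
      then have "\<tau>' \<in> K" using t by (auto simp: K_def in_cbox_complex_iff)
      then have "y \<in> tau_j ` K" using t(3) by blast
      moreover have "dist y c < e" using y(2) by simp
      ultimately show ?thesis by blast
    qed
    then have "c \<in> closure (tau_j ` K)" by (simp add: closure_approachable)
    then have "c \<in> tau_j ` K" using cl by (simp only: closure_closed)
    then show "c \<in> tau_j ` ?H" using image_mono[OF KH] by (rule set_rev_mp)
  qed
  with op have "tau_j ` ?H = {} \<or> tau_j ` ?H = UNIV" by (simp only: clopen[symmetric] simp_thms)
  moreover have "tau_j ` ?H \<noteq> {}"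
  proof -
    have "Complex 0 1 \<in> ?H" by simp
    then show ?thesis by blast
  qed
  ultimately show ?thesis by (simp only: simp_thms)
qed

section \<open>From the modular function to prescribed invariants\<close>

lemma complex_root_exists:
  assumes "n > 0" "w \<noteq> (0::complex)" obtains v where "v \<noteq> 0" "v ^ n = w"
proof (rule that)
  show "exp (Ln w / of_nat n) ^ n = w" using assms by (simp flip: exp_of_nat_mult)
qed simp

lemma nonsingular_cubic_discriminant:
  assumes "nonsingular_cubic g2 g3" shows "g2 ^ 3 - 27 * g3 ^ 2 \<noteq> 0"
proof
  assume d: "g2 ^ 3 - 27 * g3 ^ 2 = 0"
  have "\<exists>x. 0 = 4 * x ^ 3 - g2 * x - g3 \<and> 12 * x\<^sup>2 - g2 = 0"
  proof (cases "g2 = 0")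
    case True
    then show ?thesis using d by (intro exI[of _ 0]) auto
  next
    case False
    \<comment> \<open>The double root: eliminating the cube between 4x^3 - g2 x - g3 and its
      derivative leaves 2 g2 x + 3 g3 = 0.\<close>
    define x where "x = - 3 * g3 / (2 * g2)"
    have x: "2 * g2 * x = - 3 * g3" using False by (simp add: x_def)
    have "g2 ^ 2 * (12 * x^2 - g2) = 3 * (2 * g2 * x)^2 - g2^3" by (simp add: power2_eq_square power3_eq_cube algebra_simps)
    also have "\<dots> = 0" unfolding x using d by (simp add: power2_eq_square algebra_simps)
    finally have x2: "12 * x^2 - g2 = 0" using False by simp
    have "3 * (4 * x^3 - g2 * x - g3) = x * (12 * x^2 - g2) - 2 * g2 * x - 3 * g3" by (simp add: power2_eq_square power3_eq_cube algebra_simps)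
    also have "\<dots> = 0" unfolding x2 x by simp
    finally have "4 * x^3 - g2 * x - g3 = 0" by (simp only: mult_eq_0_iff) simp
    with x2 show ?thesis by (intro exI[of _ x]) simp
  qed
  then show False using assms unfolding nonsingular_cubic_def by (metis mult_zero_right zero_power2)
qed

text \<open>Equal j-values make the pair (g2, g3) a rescaling of (a, b). A fourth root adjusts g2,
  after which g3 is right up to sign; replacing v by i v keeps v^4 and flips v^6. When g2 = 0, a
  sixth root adjusts g3 directly.\<close>

lemma ex_lattice_with_invariants:
  assumes d: "g2 ^ 3 - 27 * g3 ^ 2 \<noteq> 0"
  obtains L where "is_lattice L" "lattice_g2 L = g2" "lattice_g3 L = g3"
proof -
  obtain \<tau> where \<tau>: "Im \<tau> > 0" "tau_j \<tau> = g2 ^ 3 / (g2 ^ 3 - 27 * g3 ^ 2)"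
    using tau_j_surj by (metis (no_types, lifting) UNIV_I imageE mem_Collect_eq)
  define a b where "a = 60 * eis 4 \<tau>" and "b = 140 * eis 6 \<tau>"
  have ab: "a ^ 3 - 27 * b ^ 2 \<noteq> 0" using tau_discriminant[OF \<tau>(1)] by (simp add: a_def b_def)
  have "a ^ 3 / (a ^ 3 - 27 * b ^ 2) = g2 ^ 3 / (g2 ^ 3 - 27 * g3 ^ 2)" using \<tau>(2) by (simp add: tau_j_def a_def b_def)
  then have "a ^ 3 * (g2 ^ 3 - 27 * g3 ^ 2) = g2 ^ 3 * (a ^ 3 - 27 * b ^ 2)" using d ab by (simp add: frac_eq_eq)
  then have rel: "a ^ 3 * g3 ^ 2 = g2 ^ 3 * b ^ 2" by (simp add: algebra_simps)
  have "\<exists>v. v \<noteq> 0 \<and> a / v ^ 4 = g2 \<and> b / v ^ 6 = g3"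
  proof (cases "g2 = 0")
    case True
    then have g3: "g3 \<noteq> 0" using d by auto
    then have a: "a = 0" using rel True by simp
    then have b: "b \<noteq> 0" using ab by auto
    obtain v where "v \<noteq> 0" "v ^ 6 = b / g3" by (rule complex_root_exists[of 6 "b / g3"]) (use g3 b in auto)
    then show ?thesis using a True b by (intro exI[of _ v]) auto
  next
    case False
    have a: "a \<noteq> 0"
    proof
      assume "a = 0"
      then have "b = 0" using rel False by simp
      then show False using \<open>a = 0\<close> ab by simp
    qed
    obtain v where v: "v \<noteq> 0" "v ^ 4 = a / g2" by (rule complex_root_exists[of 4 "a / g2"]) (use a False in auto)
    have v12: "v ^ 12 = a ^ 3 / g2 ^ 3" using v(2) by (simp add: power_divide[symmetric] flip: v(2) power_mult)
    have "(b / v ^ 6) ^ 2 = b ^ 2 / v ^ 12" by (simp add: power_divide flip: power_mult)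
    also have "\<dots> = g3 ^ 2" unfolding v12 using rel a False by (simp add: field_simps)
    finally consider "b / v ^ 6 = g3" | "b / v ^ 6 = - g3" by (auto simp: power2_eq_iff)
    then show ?thesis
    proof cases
      case 1
      then show ?thesis using v a by (intro exI[of _ v]) auto
    next
      case 2
      have "(\<i> * v) ^ 4 = v ^ 4" "(\<i> * v) ^ 6 = - (v ^ 6)"
      proof -
        have "\<i> ^ 4 = (\<i>\<^sup>2)\<^sup>2" "\<i> ^ 6 = (\<i>\<^sup>2) ^ 3" by (simp_all flip: power_mult)
        then show "(\<i> * v) ^ 4 = v ^ 4" "(\<i> * v) ^ 6 = - (v ^ 6)" by (simp_all add: power_mult_distrib)
      qed
      then show ?thesis using 2 v a by (intro exI[of _ "\<i> * v"]) (auto simp: minus_equation_iff)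
    qed
  qed
  then obtain v where v: "v \<noteq> 0" "a / v ^ 4 = g2" "b / v ^ 6 = g3" by blast
  show ?thesis
  proof (rule that)
    show "is_lattice ((*) v ` tau_lattice \<tau>)" using v \<tau> by (intro is_lattice_scale is_lattice_tau) auto
    show "lattice_g2 ((*) v ` tau_lattice \<tau>) = g2" "lattice_g3 ((*) v ` tau_lattice \<tau>) = g3"
      using v \<tau> by (auto simp: lattice_g2_eq lattice_g3_eq lattice_G_scale lattice_G_tau a_def b_def)
  qed
qed

section \<open>Power series in the invariants\<close>

text \<open>Taylor coefficients of wp(z) - 1/z^2, from comparing coefficients in wp'' = 6 wp^2 -
  g2/2. The divisor is n(n - 1) - 12 = (n - 4)(n + 3). It vanishes at n = 4, where g3 enters as a
  free parameter; at n = 2 the constant g2/2 enters.\<close>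

function wcoef :: "complex \<Rightarrow> complex \<Rightarrow> nat \<Rightarrow> complex" where
  "wcoef a b n = (if n = 2 then a / 20 else if n = 4 then b / 28 else if n < 4 then 0
     else 6 / of_nat ((n - 4) * (n + 3)) * (\<Sum>i\<le>n - 2. wcoef a b i * wcoef a b (n - 2 - i)))"
  by pat_completeness auto
termination by (relation "Wellfounded.measure (\<lambda>(a, b, n). n)") auto

declare wcoef.simps [simp del]

lemma wcoef_rec:
  "n \<ge> 5 \<Longrightarrow> wcoef a b n = 6 / of_nat ((n - 4) * (n + 3)) * (\<Sum>i\<le>n - 2. wcoef a b i * wcoef a b (n - 2 - i))"
  by (subst wcoef.simps) auto

lemma wcoef_small: "wcoef a b 0 = 0" "wcoef a b (Suc 0) = 0" "wcoef a b 2 = a / 20" "wcoef a b 3 = 0" "wcoef a b 4 = b / 28"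
  by (simp_all add: wcoef.simps)

lemma less_5_cases: "(n::nat) < 5 \<Longrightarrow> n = 0 \<or> n = Suc 0 \<or> n = 2 \<or> n = 3 \<or> n = 4"
  by arith

text \<open>The factor 1/12 closes the induction: the convolution has n - 1 terms of size
  C^(n+2)/144, and n - 1 <= 2 (n - 4)(n + 3), so the recursion returns at most 12/144 =
  1/12.\<close>

lemma wcoef_bound:
  assumes C: "C \<ge> 1" "norm a \<le> C" "norm b \<le> C"
  shows "norm (wcoef a b n) \<le> C ^ (n + 2) / 12"
proof (induction n rule: less_induct)
  case (less n)
  show ?case
  proof (cases "n < 5")
    case True
    have p: "C ^ 1 \<le> C ^ (2 + 2)" "C ^ 1 \<le> C ^ (4 + 2)" using C(1) by (intro power_increasing; simp)+
    have "norm a / 20 \<le> C ^ (2 + 2) / 12" "norm b / 28 \<le> C ^ (4 + 2) / 12"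
      using p[unfolded power_one_right] C norm_ge_zero[of a] norm_ge_zero[of b] by linarith+
    note ab = this
    consider "n = 2" | "n = 4" | "n = 0 \<or> n = Suc 0 \<or> n = 3" using less_5_cases[OF True] by blast
    then show ?thesis
    proof cases
      case 1
      then show ?thesis using ab(1) by (simp only: wcoef_small norm_divide norm_numeral)
    next
      case 2
      then show ?thesis using ab(2) by (simp only: wcoef_small norm_divide norm_numeral)
    next
      case 3
      then have "wcoef a b n = 0" by (auto simp: wcoef_small)
      then show ?thesis using C(1) by (simp only: norm_zero) simp
    qed
  next
    case False
    then have n: "n \<ge> 5" by simp
    have "norm (\<Sum>i\<le>n - 2. wcoef a b i * wcoef a b (n - 2 - i)) \<le> (\<Sum>i\<le>n - 2. C ^ (n + 2) / 144)"
    proof (rule sum_norm_le)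
      fix i assume i: "i \<in> {..n - 2}"
      have "norm (wcoef a b i * wcoef a b (n - 2 - i)) \<le> C ^ (i + 2) / 12 * (C ^ (n - 2 - i + 2) / 12)"
        unfolding norm_mult using i n C by (intro mult_mono less.IH) auto
      also have "\<dots> = C ^ ((i + 2) + (n - 2 - i + 2)) / 144" by (simp add: power_add)
      also have "(i + 2) + (n - 2 - i + 2) = n + 2" using i n by auto
      finally show "norm (wcoef a b i * wcoef a b (n - 2 - i)) \<le> C ^ (n + 2) / 144" .
    qed
    also have "\<dots> = real (n - 1) * (C ^ (n + 2) / 144)" using n by (simp add: of_nat_diff)
    finally have s: "norm (\<Sum>i\<le>n - 2. wcoef a b i * wcoef a b (n - 2 - i)) \<le> real (n - 1) * (C ^ (n + 2) / 144)" .
    have "n - 1 \<le> 2 * ((n - 4) * (n + 3))"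
    proof -
      have "n - 1 \<le> 1 * (n + 3)" by simp
      also have "\<dots> \<le> (n - 4) * (n + 3)" using n by (intro mult_right_mono) auto
      finally show ?thesis by (simp only: mult_2 trans_le_add1)
    qed
    then have k: "real (n - 1) \<le> 2 * real ((n - 4) * (n + 3))" by (metis of_nat_le_iff of_nat_mult of_nat_numeral)
    have p: "real ((n - 4) * (n + 3)) > 0" using n by simp
    have "norm (wcoef a b n) = 6 / real ((n - 4) * (n + 3)) * norm (\<Sum>i\<le>n - 2. wcoef a b i * wcoef a b (n - 2 - i))"
      unfolding wcoef_rec[OF n] norm_mult norm_divide norm_of_nat by simp
    also have "\<dots> \<le> 6 / real ((n - 4) * (n + 3)) * (2 * real ((n - 4) * (n + 3)) * (C ^ (n + 2) / 144))"
      using s k p C by (intro mult_left_mono order_trans[OF s] mult_right_mono) auto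
    also have "\<dots> = C ^ (n + 2) / 12" using p by (simp del: of_nat_mult)
    finally show ?thesis .
  qed
qed

text \<open>Differentiating the recursion is linear in the derivatives. The two product-rule terms,
  each with the 1/12 of \<open>wcoef_bound\<close>, give 1/6, which cancels the 6 of the recursion;
  hence the bound without a denominator.\<close>

lemma wcoef_deriv:
  assumes C: "C \<ge> 1" "norm a \<le> C" "norm b \<le> C"
  shows "\<exists>A B. ((\<lambda>p. wcoef (fst p) (snd p) n) has_derivative (\<lambda>h. A * fst h + B * snd h)) (at (a, b))
    \<and> norm A \<le> C ^ (n + 2) \<and> norm B \<le> C ^ (n + 2)"
proof (induction n rule: less_induct)
  case (less n)
  have C1: "1 \<le> C ^ k" for k using C(1) by simp
  show ?case
  proof (cases "n < 5")
    case True
    have zero: "((\<lambda>p::complex \<times> complex. 0::complex) has_derivative (\<lambda>h. 0 * fst h + 0 * snd h)) (at (a, b))" by simp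
    have d2: "((\<lambda>p::complex \<times> complex. fst p / 20) has_derivative (\<lambda>h. 1 / 20 * fst h + 0 * snd h)) (at (a, b))"
      by (auto intro!: derivative_eq_intros)
    have d4: "((\<lambda>p::complex \<times> complex. snd p / 28) has_derivative (\<lambda>h. 0 * fst h + 1 / 28 * snd h)) (at (a, b))"
      by (auto intro!: derivative_eq_intros)
    consider "n = 2" | "n = 4" | "n = 0 \<or> n = Suc 0 \<or> n = 3" using less_5_cases[OF True] by blast
    then show ?thesis
    proof cases
      case 1
      show ?thesis unfolding 1 wcoef_small
        by (intro exI conjI, rule d2) (use C1[of 4] in \<open>auto simp: norm_divide\<close>)
    next
      case 2
      show ?thesis unfolding 2 wcoef_small
        by (intro exI conjI, rule d4) (use C1[of 6] in \<open>auto simp: norm_divide\<close>)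
    next
      case 3
      then have "wcoef x y n = 0" for x y by (auto simp: wcoef_small)
      then show ?thesis by (simp only:) (intro exI conjI, rule zero, use C1[of "n + 2"] in auto)
    qed
  next
    case False
    then have n: "n \<ge> 5" by simp
    have "\<forall>i\<in>{..n - 2}. \<exists>A B. ((\<lambda>p. wcoef (fst p) (snd p) i) has_derivative (\<lambda>h. A * fst h + B * snd h)) (at (a, b))
      \<and> norm A \<le> C ^ (i + 2) \<and> norm B \<le> C ^ (i + 2)"
      using less.IH n by auto
    from bchoice[OF this] obtain A where "\<forall>i\<in>{..n - 2}. \<exists>B. ((\<lambda>p. wcoef (fst p) (snd p) i) has_derivative (\<lambda>h. A i * fst h + B * snd h)) (at (a, b))
      \<and> norm (A i) \<le> C ^ (i + 2) \<and> norm B \<le> C ^ (i + 2)" by blast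
    from bchoice[OF this] obtain B where AB: "\<And>i. i \<le> n - 2 \<Longrightarrow> ((\<lambda>p. wcoef (fst p) (snd p) i) has_derivative (\<lambda>h. A i * fst h + B i * snd h)) (at (a, b))"
      "\<And>i. i \<le> n - 2 \<Longrightarrow> norm (A i) \<le> C ^ (i + 2)" "\<And>i. i \<le> n - 2 \<Longrightarrow> norm (B i) \<le> C ^ (i + 2)"
      by (auto simp: atMost_iff)
    define c where "c = wcoef a b"
    define k where "k = (6 / of_nat ((n - 4) * (n + 3)) :: complex)"
    define comb where "comb = (\<lambda>D. k * (\<Sum>i\<le>n - 2. c i * D (n - 2 - i) + D i * c (n - 2 - i)))"
    have "((\<lambda>p. k * (\<Sum>i\<le>n - 2. wcoef (fst p) (snd p) i * wcoef (fst p) (snd p) (n - 2 - i))) has_derivative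
      (\<lambda>h. k * (\<Sum>i\<le>n - 2. c i * (A (n - 2 - i) * fst h + B (n - 2 - i) * snd h) + (A i * fst h + B i * snd h) * c (n - 2 - i)))) (at (a, b))"
    proof (intro has_derivative_mult_right has_derivative_sum)
      fix i assume "i \<in> {..n - 2}"
      then have i: "i \<le> n - 2" "n - 2 - i \<le> n - 2" by auto
      from has_derivative_mult[OF AB(1)[OF i(1)] AB(1)[OF i(2)]]
      show "((\<lambda>p. wcoef (fst p) (snd p) i * wcoef (fst p) (snd p) (n - 2 - i)) has_derivative
        (\<lambda>h. c i * (A (n - 2 - i) * fst h + B (n - 2 - i) * snd h) + (A i * fst h + B i * snd h) * c (n - 2 - i))) (at (a, b))"
        by (simp add: c_def)
    qed
    also have "(\<lambda>h. k * (\<Sum>i\<le>n - 2. c i * (A (n - 2 - i) * fst h + B (n - 2 - i) * snd h) + (A i * fst h + B i * snd h) * c (n - 2 - i)))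
      = (\<lambda>h. comb A * fst h + comb B * snd h)"
    proof
      fix h :: "complex \<times> complex"
      have "(\<Sum>i\<le>n - 2. c i * (A (n - 2 - i) * fst h + B (n - 2 - i) * snd h) + (A i * fst h + B i * snd h) * c (n - 2 - i))
        = (\<Sum>i\<le>n - 2. (c i * A (n - 2 - i) + A i * c (n - 2 - i)) * fst h + (c i * B (n - 2 - i) + B i * c (n - 2 - i)) * snd h)"
        by (intro sum.cong refl) (simp add: algebra_simps)
      then show "k * (\<Sum>i\<le>n - 2. c i * (A (n - 2 - i) * fst h + B (n - 2 - i) * snd h) + (A i * fst h + B i * snd h) * c (n - 2 - i))
        = comb A * fst h + comb B * snd h"
        unfolding comb_def by (simp only: sum.distrib[of "\<lambda>i. _ i * fst h"] sum_distrib_right[symmetric] distrib_left mult.assoc)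
    qed
    finally have d: "((\<lambda>p. wcoef (fst p) (snd p) n) has_derivative (\<lambda>h. comb A * fst h + comb B * snd h)) (at (a, b))"
      by (simp only: wcoef_rec[OF n] k_def)
    have p: "real ((n - 4) * (n + 3)) > 0" using n by simp
    have k: "real (n - 1) \<le> real ((n - 4) * (n + 3))"
    proof -
      have "n - 1 \<le> 1 * (n + 3)" by simp
      also have "\<dots> \<le> (n - 4) * (n + 3)" using n by (intro mult_right_mono) auto
      finally show ?thesis by (rule of_nat_mono)
    qed
    have bd: "norm (comb D) \<le> C ^ (n + 2)" if D: "\<And>i. i \<le> n - 2 \<Longrightarrow> norm (D i) \<le> C ^ (i + 2)" for D
    proof -
      have c: "norm (c i) \<le> C ^ (i + 2) / 12" for i unfolding c_def by (rule wcoef_bound[OF C])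
      have "norm (\<Sum>i\<le>n - 2. c i * D (n - 2 - i) + D i * c (n - 2 - i)) \<le> (\<Sum>i\<le>n - 2. C ^ (n + 2) / 6)"
      proof (rule sum_norm_le)
        fix i assume i: "i \<in> {..n - 2}"
        have e: "(i + 2) + (n - 2 - i + 2) = n + 2" using i n by auto
        have "norm (c i * D (n - 2 - i) + D i * c (n - 2 - i)) \<le> norm (c i) * norm (D (n - 2 - i)) + norm (D i) * norm (c (n - 2 - i))"
          using norm_triangle_ineq[of "c i * D (n - 2 - i)" "D i * c (n - 2 - i)"] by (simp add: norm_mult)
        also have "\<dots> \<le> C ^ (i + 2) / 12 * C ^ (n - 2 - i + 2) + C ^ (i + 2) * (C ^ (n - 2 - i + 2) / 12)"
          using i C by (intro add_mono mult_mono c D) auto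
        also have "\<dots> = C ^ ((i + 2) + (n - 2 - i + 2)) / 6" by (simp add: power_add)
        finally show "norm (c i * D (n - 2 - i) + D i * c (n - 2 - i)) \<le> C ^ (n + 2) / 6" by (simp only: e)
      qed
      also have "\<dots> = real (n - 1) * (C ^ (n + 2) / 6)" using n by (simp add: of_nat_diff)
      finally have s: "norm (\<Sum>i\<le>n - 2. c i * D (n - 2 - i) + D i * c (n - 2 - i)) \<le> real (n - 1) * (C ^ (n + 2) / 6)" .
      have "norm (comb D) = 6 / real ((n - 4) * (n + 3)) * norm (\<Sum>i\<le>n - 2. c i * D (n - 2 - i) + D i * c (n - 2 - i))"
        unfolding comb_def k_def norm_mult norm_divide norm_of_nat by simp
      also have "\<dots> \<le> 6 / real ((n - 4) * (n + 3)) * (real ((n - 4) * (n + 3)) * (C ^ (n + 2) / 6))"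
        using s k p C by (intro mult_left_mono order_trans[OF s] mult_right_mono) auto
      also have "\<dots> = C ^ (n + 2)" using p by (simp del: of_nat_mult)
      finally show ?thesis .
    qed
    show ?thesis using d bd[OF AB(2)] bd[OF AB(3)] by blast
  qed
qed

lemma fps_conv_radius_ge_bound:
  fixes F :: "complex fps"
  assumes "C > 0" "\<And>n. norm (fps_nth F n) \<le> K * C ^ n"
  shows "fps_conv_radius F \<ge> ereal (1 / C)"
  unfolding fps_conv_radius_def
proof (rule conv_radius_geI_ex')
  fix r :: real assume r: "0 < r" "ereal r < ereal (1 / C)"
  then have "C * r < 1" using assms(1) by (simp add: field_simps)
  moreover have "C * r \<ge> 0" using r assms(1) by simp
  ultimately have sm: "summable (\<lambda>n. K * (C * r) ^ n)" by (intro summable_mult summable_geometric) simp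
  have "norm (fps_nth F n * of_real r ^ n) \<le> K * (C * r) ^ n" for n
  proof -
    have "norm (fps_nth F n * of_real r ^ n) = norm (fps_nth F n) * r ^ n" using r by (simp add: norm_mult norm_power)
    also have "\<dots> \<le> K * C ^ n * r ^ n" using r by (intro mult_right_mono assms(2)) simp
    finally show ?thesis by (simp add: power_mult_distrib mult.assoc)
  qed
  then show "summable (\<lambda>n. fps_nth F n * of_real r ^ n)" by (rule summable_comparison_test'[OF sm])
qed

section \<open>The recursive coefficients as Laurent coefficients of a lattice\<close>

context complex_lattice begin

lemma wpF_eq_wcoef: "fps_nth wpF n = wcoef (lattice_g2 L) (lattice_g3 L) n"
proof -
  \<comment> \<open>z^2 times the second-order equation, written for wp(z) - 1/z^2. The poles
    cancel, so it is an identity between formal power series.\<close>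
  define E where "E = fps_X ^ 2 * fps_deriv (fps_deriv wpF) - 12 * wpF - 6 * (fps_X ^ 2 * (wpF * wpF)) + fps_const (lattice_g2 L / 2) * fps_X ^ 2"
  define f where "f = (\<lambda>z. z ^ 2 * deriv (deriv (wp_reg L)) z - 12 * wp_reg L z - 6 * (z ^ 2 * (wp_reg L z * wp_reg L z)) + lattice_g2 L / 2 * z ^ 2)"
  have F2: "deriv (deriv (wp_reg L)) has_fps_expansion fps_deriv (fps_deriv wpF)"
    by (intro has_fps_expansion_deriv wp_reg_expansion)
  have fE: "f has_fps_expansion E"
    unfolding f_def E_def by (intro fps_expansion_intros F2 wp_reg_expansion)
  have "\<forall>\<^sub>F z in nhds 0. f z = 0"
  proof (rule wp_near_0)
    fix R assume R: "R > 0" and nL: "\<And>z. z \<in> ball 0 R \<Longrightarrow> z \<noteq> 0 \<Longrightarrow> z \<notin> L"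
      and wp: "\<And>z. z \<in> ball 0 R \<Longrightarrow> z \<noteq> 0 \<Longrightarrow> lattice_wp L z = 1 / z\<^sup>2 + wp_reg L z"
        "\<And>z. z \<in> ball 0 R \<Longrightarrow> z \<noteq> 0 \<Longrightarrow> deriv (deriv (lattice_wp L)) z = 6 / z ^ 4 + deriv (deriv (wp_reg L)) z"
    have "f z = 0" if z: "z \<in> ball 0 R" for z
    proof (cases "z = 0")
      case True then show ?thesis by (simp add: f_def)
    next
      case False
      have alg: "z ^ 2 * d - 12 * h - 6 * (z ^ 2 * (h * h)) + g / 2 * z ^ 2 = z ^ 2 * ((6 / z ^ 4 + d) - (6 * (1 / z\<^sup>2 + h) ^ 2 - g / 2))" for d h g
      proof -
        define i where "i = 1 / z"
        have zi: "z ^ 2 * i ^ 2 = 1" using False by (simp add: i_def power_divide)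
        have p: "1 / z ^ n = i ^ n" "x / z ^ n = x * i ^ n" for x n by (simp_all add: i_def power_divide)
        have "z ^ 2 * ((6 * i ^ 4 + d) - (6 * (i ^ 2 + h) ^ 2 - g / 2)) = z ^ 2 * d - 12 * h * (z ^ 2 * i ^ 2) - 6 * (z ^ 2 * (h * h)) + g / 2 * z ^ 2"
          by (simp add: power2_eq_square power4_eq_xxxx algebra_simps)
        then show ?thesis by (simp add: zi p)
      qed
      show ?thesis
        unfolding f_def alg using wp_ode2[OF nL[OF z False]] by (simp add: wp(1)[OF z False] wp(2)[OF z False])
    qed
    then show ?thesis using eventually_nhds_in_open[of "ball 0 R" 0] R by (auto elim: eventually_mono)
  qed
  then have "(deriv ^^ k) f 0 = (deriv ^^ k) (\<lambda>_. 0) 0" for k by (rule higher_deriv_cong_ev) simp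
  moreover have "(deriv ^^ k) (\<lambda>_::complex. 0::complex) = (\<lambda>_. 0)" for k by (induction k) auto
  ultimately have E0: "fps_nth E k = 0" for k using fps_nth_fps_expansion[OF fE, of k] by simp
  have rec: "of_nat ((n - 4) * (n + 3)) * fps_nth wpF n = 6 * (\<Sum>i\<le>n - 2. fps_nth wpF i * fps_nth wpF (n - 2 - i))" if n: "n \<ge> 5" for n
  proof -
    obtain m where m: "n = m + 2" using n le_Suc_ex[of 2 n] by (auto simp: add.commute)
    have m2: "m \<noteq> 0" using n m by simp
    have "fps_nth (fps_X ^ 2 * G) n = fps_nth G m" for G :: "complex fps" by (simp add: m fps_X_power_mult_nth)
    then have "fps_nth E n = fps_nth (fps_deriv (fps_deriv wpF)) m - 12 * fps_nth wpF n - 6 * fps_nth (wpF * wpF) m"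
      using n unfolding E_def by (simp add: fps_X_power_nth numeral_fps_const)
    also have "fps_nth (fps_deriv (fps_deriv wpF)) m = of_nat ((m + 1) * (m + 2)) * fps_nth wpF n"
      by (simp add: m algebra_simps)
    also have "fps_nth (wpF * wpF) m = (\<Sum>i\<le>m. fps_nth wpF i * fps_nth wpF (m - i))"
      by (simp add: fps_mult_nth atLeast0AtMost)
    finally have "(of_nat ((m + 1) * (m + 2)) - 12) * fps_nth wpF n = 6 * (\<Sum>i\<le>m. fps_nth wpF i * fps_nth wpF (m - i))"
      using E0[of n] by (simp add: algebra_simps)
    also have "(of_nat ((m + 1) * (m + 2)) - 12 :: complex) = of_nat ((n - 4) * (n + 3))"
    proof -
      obtain q where q: "m = q + 3" using n m le_Suc_ex[of 3 m] by (auto simp: add.commute)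
      show ?thesis by (simp add: m q algebra_simps)
    qed
    finally show ?thesis by (simp add: m)
  qed
  show ?thesis
  proof (induction n rule: less_induct)
    case (less n)
    show ?case
    proof (cases "n < 5")
      case True
      then show ?thesis using less_5_cases[OF True] by (auto simp: wcoef_small wpF_0 wpF_small)
    next
      case False
      then have n: "n \<ge> 5" by simp
      have p: "(of_nat ((n - 4) * (n + 3)) :: complex) \<noteq> 0" using n by (simp only: of_nat_eq_0_iff) simp
      have "(\<Sum>i\<le>n - 2. fps_nth wpF i * fps_nth wpF (n - 2 - i)) =
        (\<Sum>i\<le>n - 2. wcoef (lattice_g2 L) (lattice_g3 L) i * wcoef (lattice_g2 L) (lattice_g3 L) (n - 2 - i))"
        using n by (intro sum.cong refl) (simp add: less.IH)
      then show ?thesis using rec[OF n] p unfolding wcoef_rec[OF n] by (simp add: field_simps)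
    qed
  qed
qed

text \<open>The double antiderivative of \<open>wpF\<close>. Its negative represents
  log(sigma(z)/z), since the second logarithmic derivative of sigma is -wp.\<close>

definition sigF :: "complex fps" where
  "sigF = Abs_fps (\<lambda>n. if n < 2 then 0 else fps_nth wpF (n - 2) / of_nat (n * (n - 1)))"

lemma sigma_near_0: "\<forall>\<^sub>F z in nhds 0. lattice_sigma L z = z * exp (- eval_fps sigF z)"
proof -
  obtain R0 where R0: "R0 > 0" "\<And>z. z \<in> ball 0 R0 \<Longrightarrow> z \<noteq> 0 \<Longrightarrow> z \<notin> L" by (rule wp_near_0) blast
  \<comment> \<open>With 2R < R0 no nonzero period counts as near, so sigma(z) is z times a single
    exponential on this disc.\<close>
  define R where "R = R0 / 4"
  have R: "R > 0" using R0 by (simp add: R_def)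
  have near: "near R = {}"
  proof -
    have "w \<notin> near R" for w
    proof
      assume "w \<in> near R"
      then have w: "w \<in> L" "w \<noteq> 0" "norm w \<le> 2 * R" by auto
      then have "w \<in> ball 0 R0" using R0(1) by (simp add: R_def)
      then show False using R0(2) w by blast
    qed
    then show ?thesis by blast
  qed
  have far: "far R = L - {0}" using near near_Un_far(1)[of R] by auto
  define W where "W = (\<lambda>z. \<Sum>\<^sub>\<infinity>w\<in>far R. wlog w z)"
  have sig: "lattice_sigma L z = z * exp (W z)" if "norm z < R" for z
    using lattice_sigma_local[OF that] by (simp add: near W_def)
  have W1: "(W has_field_derivative (\<Sum>\<^sub>\<infinity>w\<in>L - {0}. zterm w z)) (at z)" if "norm z < R" for z
    using has_field_derivative_wlog_sum[OF that] by (simp add: W_def far)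
  have W1': "deriv W z = (\<Sum>\<^sub>\<infinity>w\<in>L - {0}. zterm w z)" if "norm z < R" for z
    by (rule DERIV_imp_deriv[OF W1[OF that]])
  have holW: "W holomorphic_on ball 0 R" 
    unfolding holomorphic_on_open[OF open_ball] by (intro ballI exI, rule W1) simp
  define FW where "FW = fps_expansion W 0"
  have FW: "W has_fps_expansion FW" unfolding FW_def
    by (rule analytic_at_imp_has_fps_expansion_0) (use holW R in \<open>auto simp: analytic_at intro!: exI[of _ "ball 0 R"]\<close>)
  have W2: "deriv (deriv W) z = - wp_reg L z" if z: "norm z < R" "z \<noteq> 0" for z
  proof -
    have zL: "z \<notin> L" using R0(2)[of z] z R0(1) by (auto simp: R_def)
    have d: "((\<lambda>z. lattice_zeta L z - 1 / z) has_field_derivative - lattice_wp L z + 1 / z ^ 2) (at z)"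
    proof -
      have "((\<lambda>z. 1 / z) has_field_derivative - (1 / z ^ 2)) (at z)"
        using z by (auto intro!: derivative_eq_intros simp: power2_eq_square)
      from DERIV_diff[OF has_field_derivative_zeta[OF zL] this] show ?thesis by simp
    qed
    have "\<forall>\<^sub>F x in nhds z. x \<in> ball 0 R \<inter> - L"
      using z zL by (intro eventually_nhds_in_open open_Int open_compl) auto
    then have "\<forall>\<^sub>F x in nhds z. deriv W x = lattice_zeta L x - 1 / x"
      by eventually_elim (simp add: W1' lattice_zeta_eq)
    then have "deriv (deriv W) z = deriv (\<lambda>z. lattice_zeta L z - 1 / z) z" by (rule deriv_cong_ev) simp
    also have "\<dots> = - lattice_wp L z + 1 / z ^ 2" by (rule DERIV_imp_deriv[OF d])
    also have "\<dots> = - wp_reg L z" by (simp add: lattice_wp_eq[OF zL] wp_reg_def)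
    finally show ?thesis .
  qed
  have FW2: "fps_deriv (fps_deriv FW) = - wpF"
  proof -
    have e: "(\<lambda>z. deriv (deriv W) z + wp_reg L z) has_fps_expansion fps_deriv (fps_deriv FW) + wpF"
      by (intro fps_expansion_intros FW has_fps_expansion_deriv wp_reg_expansion)
    \<comment> \<open>The identity W'' = - wp_reg was derived from wp and hence off 0 only;
      continuity supplies it at 0.\<close>
    have "((\<lambda>z. deriv (deriv W) z + wp_reg L z) \<longlongrightarrow> deriv (deriv W) 0 + wp_reg L 0) (at 0)"
      using has_fps_expansion_imp_continuous[OF e, of UNIV] by (simp add: continuous_within)
    moreover have "((\<lambda>z. deriv (deriv W) z + wp_reg L z) \<longlongrightarrow> 0) (at 0)"
      by (rule tendsto_eventually, rule eventually_mono[OF eventually_at_0_ball[OF R]]) (simp add: W2)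
    ultimately have "deriv (deriv W) 0 + wp_reg L 0 = 0" by (rule LIM_unique)
    then have "deriv (deriv W) z + wp_reg L z = 0" if "z \<in> ball 0 R" for z
      using W2[of z] that by (cases "z = 0") auto
    then have "\<forall>\<^sub>F z in nhds 0. deriv (deriv W) z + wp_reg L z = 0"
      by (intro eventually_mono[OF eventually_nhds_in_open[of "ball 0 R"]]) (use R in auto)
    then have "(deriv ^^ k) (\<lambda>z. deriv (deriv W) z + wp_reg L z) 0 = (deriv ^^ k) (\<lambda>_. 0) 0" for k
      by (rule higher_deriv_cong_ev) simp
    moreover have "(deriv ^^ k) (\<lambda>_::complex. 0::complex) = (\<lambda>_. 0)" for k by (induction k) auto
    ultimately have "fps_nth (fps_deriv (fps_deriv FW) + wpF) k = 0" for k
      using fps_nth_fps_expansion[OF e, of k] by simp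
    then have "fps_deriv (fps_deriv FW) + wpF = 0" by (intro fps_ext) simp
    then show ?thesis by (simp only: add_eq_0_iff2)
  qed
  have "FW = - sigF"
  proof (rule fps_ext)
    fix n
    have 0: "fps_nth FW 0 = 0" using fps_nth_fps_expansion[OF FW, of 0] by (simp add: W_def)
    have 1: "fps_nth FW (Suc 0) = 0" using fps_nth_fps_expansion[OF FW, of 1] W1'[of 0] R by (simp add: zterm_def)
    show "fps_nth FW n = fps_nth (- sigF) n"
    proof (cases "n < 2")
      case True then show ?thesis using 0 1 by (auto simp: sigF_def less_2_cases_iff)
    next
      case False
      then have "n = Suc (Suc (n - 2))" by simp
      then obtain m where m: "n = Suc (Suc m)" by blast
      have "fps_nth (fps_deriv (fps_deriv FW)) m = of_nat (Suc m) * (of_nat (Suc (Suc m)) * fps_nth FW n)" by (simp add: m)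
      then have "of_nat (Suc m) * (of_nat (Suc (Suc m)) * fps_nth FW n) = - fps_nth wpF m" by (simp add: FW2)
      then have "of_nat (Suc (Suc m)) * of_nat (Suc m) * fps_nth FW n = - fps_nth wpF m" by (simp only: mult_ac)
      moreover have "(of_nat (Suc (Suc m)) * of_nat (Suc m) :: complex) \<noteq> 0" by (simp only: mult_eq_0_iff of_nat_eq_0_iff) simp
      ultimately have "fps_nth FW n = - fps_nth wpF m / (of_nat (Suc (Suc m)) * of_nat (Suc m))" by (subst nonzero_eq_divide_eq) (simp_all only: mult_ac not_False_eq_True)
      then show ?thesis by (simp add: sigF_def m algebra_simps)
    qed
  qed
  then have "\<forall>\<^sub>F z in nhds 0. W z = - eval_fps sigF z"
  proof -
    have "\<forall>\<^sub>F z in nhds 0. eval_fps FW z = W z" using FW by (simp add: has_fps_expansion_def)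
    moreover have "fps_conv_radius sigF > 0" using FW \<open>FW = - sigF\<close> by (simp add: has_fps_expansion_def)
    then have "\<forall>\<^sub>F z in nhds 0. z \<in> eball 0 (fps_conv_radius sigF)"
      by (intro eventually_nhds_in_open) (auto simp: zero_ereal_def)
    ultimately show ?thesis by eventually_elim (simp add: \<open>FW = - sigF\<close> eval_fps_minus)
  qed
  moreover have "\<forall>\<^sub>F z in nhds 0. z \<in> ball 0 R" using R by (intro eventually_nhds_in_open) auto
  ultimately show ?thesis by eventually_elim (simp add: sig)
qed

text \<open>The expansions hold near 0 by construction, and the coefficient bounds extend them by
  analytic continuation to a disc depending only on a bound for the invariants. As z exp(...)
  vanishes only at 0, the disc contains no other period.\<close>

lemma small_disc_expansion:
  assumes C: "C \<ge> 1" "norm (lattice_g2 L) \<le> C" "norm (lattice_g3 L) \<le> C" and z: "norm z < 1 / C"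
  shows "lattice_sigma L z = z * exp (- eval_fps sigF z)"
    and "z \<noteq> 0 \<Longrightarrow> z \<notin> L"
    and "z \<noteq> 0 \<Longrightarrow> lattice_wp L z = 1 / z ^ 2 + eval_fps wpF z"
    and "z \<noteq> 0 \<Longrightarrow> deriv (lattice_wp L) z = - 2 / z ^ 3 + eval_fps (fps_deriv wpF) z"
proof -
  have Cp: "C > 0" using C by simp
  have bF: "norm (fps_nth wpF n) \<le> C ^ 2 / 12 * C ^ n" for n
    using wcoef_bound[OF C, of n] by (simp add: wpF_eq_wcoef power_add power2_eq_square mult_ac)
  have rF: "fps_conv_radius wpF \<ge> ereal (1 / C)" by (rule fps_conv_radius_ge_bound[OF Cp bF])
  have "norm (fps_nth sigF n) \<le> 1 / 12 * C ^ n" for n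
  proof (cases "n < 2")
    case True then show ?thesis using Cp by (simp add: sigF_def)
  next
    case False
    then have "n = Suc (Suc (n - 2))" by simp
    then obtain m where m: "n = Suc (Suc m)" by blast
    have ge1: "1 \<le> real (n * (n - 1))" by (simp add: m)
    have "norm (fps_nth wpF m) / real (n * (n - 1)) \<le> norm (fps_nth wpF m) / 1"
      using ge1 by (intro frac_le norm_ge_zero order_refl) linarith+
    also have "\<dots> \<le> 1 / 12 * C ^ n" using bF[of m] by (simp add: m power2_eq_square mult_ac)
    finally show ?thesis using False by (simp add: sigF_def m norm_divide norm_mult del: of_nat_Suc of_nat_mult)
  qed
  then have rS: "fps_conv_radius sigF \<ge> ereal (1 / C)" by (rule fps_conv_radius_ge_bound[OF Cp])
  have sub: "ball (0::complex) (1 / C) \<subseteq> eball 0 (fps_conv_radius G)" if "fps_conv_radius G \<ge> ereal (1 / C)" for G :: "complex fps"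
  proof (rule subsetI)
    fix x :: complex assume "x \<in> ball 0 (1 / C)"
    then have "ereal (norm x) < ereal (1 / C)" by simp
    also have "\<dots> \<le> fps_conv_radius G" by (rule that)
    finally show "x \<in> eball 0 (fps_conv_radius G)" by (simp add: in_eball_iff)
  qed
  obtain S where S: "open S" "0 \<in> S" "\<And>z. z \<in> S \<Longrightarrow> lattice_sigma L z = z * exp (- eval_fps sigF z)"
    using sigma_near_0 by (auto simp: eventually_nhds)
  have sig: "lattice_sigma L z = z * exp (- eval_fps sigF z)" if "z \<in> ball 0 (1 / C)" for z
  proof (rule analytic_continuation_open[where s = "S \<inter> ball 0 (1 / C)" and s' = "ball 0 (1 / C)"
      and f = "lattice_sigma L" and g = "\<lambda>z. z * exp (- eval_fps sigF z)"])
    show "lattice_sigma L holomorphic_on ball 0 (1 / C)" by (rule holomorphic_on_subset[OF holomorphic_lattice_sigma]) auto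
    show "(\<lambda>z. z * exp (- eval_fps sigF z)) holomorphic_on ball 0 (1 / C)" by (intro holomorphic_intros sub rS)
    show "S \<inter> ball 0 (1 / C) \<noteq> {}" using S(2) Cp by auto
  qed (use S that in auto)
  have nL: "z \<notin> L" if "z \<in> ball 0 (1 / C)" "z \<noteq> 0" for z
    using sig[OF that(1)] that(2) lattice_sigma_eq_0_iff[of z] by auto
  let ?P = "ball 0 (1 / C) - {0::complex}"
  have opP: "open ?P" by auto
  have connP: "connected ?P" by (rule connected_open_delete) auto
  obtain R where R: "R > 0" "\<And>z. z \<in> ball 0 R \<Longrightarrow> z \<noteq> 0 \<Longrightarrow> lattice_wp L z = 1 / z\<^sup>2 + wp_reg L z" by (rule wp_near_0) blast
  obtain T where T: "open T" "0 \<in> T" "\<And>z. z \<in> T \<Longrightarrow> eval_fps wpF z = wp_reg L z"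
    using wp_reg_expansion by (auto simp: has_fps_expansion_def eventually_nhds)
  have "open (T \<inter> ball 0 R \<inter> ball 0 (1 / C))" using T(1) by (intro open_Int open_ball)
  moreover have "0 \<in> T \<inter> ball 0 R \<inter> ball 0 (1 / C)" using T(2) R(1) Cp by simp
  ultimately obtain r where r: "r > 0" "ball 0 r \<subseteq> T \<inter> ball 0 R \<inter> ball 0 (1 / C)"
    by (rule openE)
  have wp: "lattice_wp L z = 1 / z ^ 2 + eval_fps wpF z" if "z \<in> ?P" for z
  proof (rule analytic_continuation_open[where s = "ball 0 r - {0}" and s' = ?P
      and f = "lattice_wp L" and g = "\<lambda>z. 1 / z ^ 2 + eval_fps wpF z"])
    show "lattice_wp L holomorphic_on ?P" by (rule holomorphic_on_subset[OF holomorphic_wp]) (use nL in auto)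
    have "?P \<subseteq> eball 0 (fps_conv_radius wpF)" using sub[OF rF] by blast
    then show "(\<lambda>z. 1 / z ^ 2 + eval_fps wpF z) holomorphic_on ?P" by (intro holomorphic_intros) auto
    have "complex_of_real (r / 2) \<in> ball 0 r - {0}" using r by simp
    then show "ball 0 r - {0::complex} \<noteq> {}" by blast
    show "lattice_wp L z = 1 / z ^ 2 + eval_fps wpF z" if "z \<in> ball 0 r - {0}" for z
    proof -
      have "z \<in> T" "z \<in> ball 0 R" "z \<noteq> 0" using that r by auto
      then show ?thesis using R(2)[of z] T(3)[of z] by simp
    qed
  qed (use r connP that in auto)
  have zb: "z \<in> ball 0 (1 / C)" using z by simp
  show "lattice_sigma L z = z * exp (- eval_fps sigF z)" by (rule sig[OF zb])
  show "z \<notin> L" if "z \<noteq> 0" by (rule nL[OF zb that])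
  show "lattice_wp L z = 1 / z ^ 2 + eval_fps wpF z" if "z \<noteq> 0" using wp zb that by blast
  show "deriv (lattice_wp L) z = - 2 / z ^ 3 + eval_fps (fps_deriv wpF) z" if z0: "z \<noteq> 0"
  proof -
    have zP: "z \<in> ?P" using zb z0 by simp
    have "deriv (lattice_wp L) z = deriv (\<lambda>z. 1 / z ^ 2 + eval_fps wpF z) z"
      by (rule deriv_cong_ev[OF eventually_mono[OF eventually_nhds_in_open[OF opP zP]]]) (use wp in auto)
    also have "\<dots> = - 2 / z ^ 3 + eval_fps (fps_deriv wpF) z"
    proof (rule DERIV_imp_deriv, rule DERIV_add)
      show "((\<lambda>z. 1 / z\<^sup>2) has_field_derivative - 2 / z ^ 3) (at z)"
        using z0 by (auto intro!: derivative_eq_intros simp: field_simps power2_eq_square power3_eq_cube)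
      have "ereal (norm z) < fps_conv_radius wpF" using sub[OF rF] zb by (auto simp: in_eball_iff)
      then show "(eval_fps wpF has_field_derivative eval_fps (fps_deriv wpF) z) (at z)" by (rule has_field_derivative_eval_fps)
    qed
    finally show ?thesis .
  qed
qed

end

section \<open>Joint differentiability in the argument and the invariants\<close>

text \<open>\<open>has_derivative\<close> alone asks only for a real-linear derivative. Prescribing
  the form of the derivative makes it complex linear, with the three partial derivatives as
  coefficients.\<close>

definition cdiff :: "(complex \<times> complex \<times> complex \<Rightarrow> complex) \<Rightarrow> complex \<times> complex \<times> complex \<Rightarrow> bool" where
  "cdiff F p \<longleftrightarrow> (\<exists>A B C. (F has_derivative (\<lambda>h. A * fst h + B * fst (snd h) + C * snd (snd h))) (at p))"

lemma cdiffI: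
  assumes "(F has_derivative D) (at p)" "\<And>h. D h = A * fst h + B * fst (snd h) + C * snd (snd h)"
  shows "cdiff F p"
proof -
  have "D = (\<lambda>h. A * fst h + B * fst (snd h) + C * snd (snd h))" by (rule ext) (rule assms(2))
  with assms(1) show ?thesis unfolding cdiff_def by blast
qed

lemma cdiff_const: "cdiff (\<lambda>_. c) p"
  by (rule cdiffI[where D = "\<lambda>_. 0" and A = 0 and B = 0 and C = 0]) auto

lemma cdiff_proj: "cdiff fst p" "cdiff (\<lambda>p. fst (snd p)) p" "cdiff (\<lambda>p. snd (snd p)) p"
proof -
  show "cdiff fst p"
    by (rule cdiffI[where D = fst and A = 1 and B = 0 and C = 0]) (auto intro!: derivative_eq_intros)
  show "cdiff (\<lambda>p. fst (snd p)) p"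
    by (rule cdiffI[where D = "\<lambda>p. fst (snd p)" and A = 0 and B = 1 and C = 0]) (auto intro!: derivative_eq_intros)
  show "cdiff (\<lambda>p. snd (snd p)) p"
    by (rule cdiffI[where D = "\<lambda>p. snd (snd p)" and A = 0 and B = 0 and C = 1]) (auto intro!: derivative_eq_intros)
qed

lemma cdiff_add:
  assumes "cdiff F p" "cdiff G p" shows "cdiff (\<lambda>p. F p + G p) p"
proof -
  obtain A B C A' B' C' where d: "(F has_derivative (\<lambda>h. A * fst h + B * fst (snd h) + C * snd (snd h))) (at p)"
    "(G has_derivative (\<lambda>h. A' * fst h + B' * fst (snd h) + C' * snd (snd h))) (at p)"
    using assms unfolding cdiff_def by blast
  show ?thesis
    by (rule cdiffI[OF has_derivative_add[OF d], where A = "A + A'" and B = "B + B'" and C = "C + C'"])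
       (simp add: algebra_simps)
qed

lemma cdiff_mult:
  assumes "cdiff F p" "cdiff G p" shows "cdiff (\<lambda>p. F p * G p) p"
proof -
  obtain A B C A' B' C' where d: "(F has_derivative (\<lambda>h. A * fst h + B * fst (snd h) + C * snd (snd h))) (at p)"
    "(G has_derivative (\<lambda>h. A' * fst h + B' * fst (snd h) + C' * snd (snd h))) (at p)"
    using assms unfolding cdiff_def by blast
  show ?thesis
    by (rule cdiffI[OF has_derivative_mult[OF d], where A = "F p * A' + A * G p" and B = "F p * B' + B * G p" and C = "F p * C' + C * G p"])
       (simp add: algebra_simps)
qed

lemma cdiff_compose:
  assumes g: "(g has_field_derivative d) (at (F p))" and F: "cdiff F p" shows "cdiff (\<lambda>p. g (F p)) p"
proof -
  obtain A B C where d: "(F has_derivative (\<lambda>h. A * fst h + B * fst (snd h) + C * snd (snd h))) (at p)"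
    using F unfolding cdiff_def by blast
  have "((\<lambda>p. g (F p)) has_derivative (\<lambda>h. d * (A * fst h + B * fst (snd h) + C * snd (snd h)))) (at p)"
    by (rule has_derivative_compose[OF d, of g "(*) d"]) (use g in \<open>simp add: has_field_derivative_def\<close>)
  then show ?thesis
    by (rule cdiffI[where A = "d * A" and B = "d * B" and C = "d * C"]) (simp add: algebra_simps)
qed

lemma cdiff_uminus: "cdiff F p \<Longrightarrow> cdiff (\<lambda>p. - F p) p"
  by (rule cdiff_compose[of uminus "-1"]) (auto intro!: derivative_eq_intros)

lemma cdiff_diff: "cdiff F p \<Longrightarrow> cdiff G p \<Longrightarrow> cdiff (\<lambda>p. F p - G p) p"
  using cdiff_add[OF _ cdiff_uminus] by simp

lemma cdiff_exp: "cdiff F p \<Longrightarrow> cdiff (\<lambda>p. exp (F p)) p"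
  by (rule cdiff_compose[OF DERIV_exp])

lemma cdiff_power: "cdiff F p \<Longrightarrow> cdiff (\<lambda>p. F p ^ n) p"
proof (induction n)
  case 0
  then show ?case unfolding power_0 by (intro cdiff_const)
next
  case (Suc n)
  then show ?case unfolding power_Suc by (intro cdiff_mult)
qed

lemma cdiff_divide:
  assumes "cdiff F p" "cdiff G p" "G p \<noteq> 0" shows "cdiff (\<lambda>p. F p / G p) p"
proof -
  have "cdiff (\<lambda>p. inverse (G p)) p" by (rule cdiff_compose[OF DERIV_inverse[OF assms(3)] assms(2)])
  from cdiff_mult[OF assms(1) this] show ?thesis by (simp only: divide_inverse)
qed

lemmas cdiff_intros = cdiff_const cdiff_proj cdiff_add cdiff_mult cdiff_uminus cdiff_diff cdiff_exp cdiff_power cdiff_divide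

lemma cdiff_cong:
  assumes "cdiff F p" "\<forall>\<^sub>F q in nhds p. F q = G q" shows "cdiff G p"
proof -
  obtain S where S: "open S" "p \<in> S" "\<And>q. q \<in> S \<Longrightarrow> F q = G q" using assms(2) by (auto simp: eventually_nhds)
  obtain A B C where d: "(F has_derivative (\<lambda>h. A * fst h + B * fst (snd h) + C * snd (snd h))) (at p)"
    using assms(1) unfolding cdiff_def by blast
  show ?thesis
    by (rule cdiffI[OF has_derivative_transform_within_open[OF d S] refl])
qed

lemma cdiff_isCont: "cdiff F p \<Longrightarrow> isCont F p"
  unfolding cdiff_def using has_derivative_continuous by blast

lemma cdiff_eventually_nonzero: 
  assumes "cdiff F p" "F p \<noteq> 0" shows "\<forall>\<^sub>F q in nhds p. F q \<noteq> 0"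
proof -
  have "(F \<longlongrightarrow> F p) (nhds p)" using cdiff_isCont[OF assms(1)] unfolding continuous_at by (rule tendsto_at_iff_tendsto_nhds[THEN iffD1])
  then show ?thesis by (rule tendsto_imp_eventually_ne[OF _ assms(2)])
qed

lemma has_derivative_half:
  "((\<lambda>p::complex \<times> complex \<times> complex. (fst p / 2, snd p)) has_derivative (\<lambda>h. (fst h / 2, snd h))) (at p)"
  by (auto intro!: derivative_eq_intros)

lemma cdiff_half:
  assumes "cdiff F (fst p / 2, snd p)" shows "cdiff (\<lambda>p. F (fst p / 2, snd p)) p"
proof -
  obtain A B C where d: "(F has_derivative (\<lambda>h. A * fst h + B * fst (snd h) + C * snd (snd h))) (at (fst p / 2, snd p))"
    using assms unfolding cdiff_def by blast
  show ?thesis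
    by (rule cdiffI[OF has_derivative_compose[OF has_derivative_half d], where A = "A / 2" and B = B and C = C]) simp
qed

text \<open>Used with identity and constant functions for the individual partials, and with the
  parameter functions of J for the total derivative.\<close>

lemma DERIV_along_curve:
  fixes f g h :: "complex \<Rightarrow> complex"
  assumes d: "(F has_derivative (\<lambda>h. A * fst h + B * fst (snd h) + C * snd (snd h))) (at (x, y, z))"
    and fgh: "(f has_field_derivative f') (at t)" "(g has_field_derivative g') (at t)" "(h has_field_derivative h') (at t)"
    and e: "(f t, g t, h t) = (x, y, z)"
  shows "((\<lambda>t. F (f t, g t, h t)) has_field_derivative A * f' + B * g' + C * h') (at t)"
proof -
  have "((\<lambda>t. (f t, g t, h t)) has_derivative (\<lambda>s. (f' * s, g' * s, h' * s))) (at t)"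
    using fgh unfolding has_field_derivative_def by (intro has_derivative_Pair)
  moreover have "(F has_derivative (\<lambda>h. A * fst h + B * fst (snd h) + C * snd (snd h))) (at (f t, g t, h t))"
    using d by (simp only: e)
  ultimately have "((\<lambda>t. F (f t, g t, h t)) has_derivative
      (\<lambda>s. A * fst (f' * s, g' * s, h' * s) + B * fst (snd (f' * s, g' * s, h' * s)) + C * snd (snd (f' * s, g' * s, h' * s)))) (at t)"
    by (rule has_derivative_compose)
  then have "((\<lambda>t. F (f t, g t, h t)) has_derivative (\<lambda>s. A * (f' * s) + B * (g' * s) + C * (h' * s))) (at t)" by simp
  then show ?thesis
    unfolding has_field_derivative_def by (rule has_derivative_eq_rhs) (simp add: fun_eq_iff algebra_simps)
qed

lemma norm_fst_le_norm: "norm (fst h) \<le> norm h"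
proof -
  have "norm (fst h) \<le> norm (fst h, snd h)" by (rule norm_fst_le)
  then show ?thesis by (simp only: prod.collapse)
qed

lemma norm_snd_le_norm: "norm (snd h) \<le> norm h"
proof -
  have "norm (snd h) \<le> norm (fst h, snd h)" by (rule norm_snd_le)
  then show ?thesis by (simp only: prod.collapse)
qed

lemma diff_diff_regroup: "(a + b + c) - (d + e + f) = (a - d) + (b - e) + (c - f)" for a :: complex
  by simp

lemma norm_sum3_le:
  fixes u v w a b c :: complex
  assumes "norm u \<le> e / 3" "norm v \<le> e / 3" "norm w \<le> e / 3" "norm a \<le> N" "norm b \<le> N" "norm c \<le> N"
  shows "norm (u * a + v * b + w * c) \<le> e * N"
proof -
  have e: "0 \<le> e / 3" using assms(1) norm_ge_zero order_trans by blast
  have "norm (u * a) \<le> e / 3 * N" unfolding norm_mult by (rule mult_mono[OF assms(1,4) e norm_ge_zero])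
  moreover have "norm (v * b) \<le> e / 3 * N" unfolding norm_mult by (rule mult_mono[OF assms(2,5) e norm_ge_zero])
  moreover have "norm (w * c) \<le> e / 3 * N" unfolding norm_mult by (rule mult_mono[OF assms(3,6) e norm_ge_zero])
  moreover have "norm (u * a + v * b + w * c) \<le> norm (u * a + v * b) + norm (w * c)" by (rule norm_triangle_ineq)
  moreover have "norm (u * a + v * b) \<le> norm (u * a) + norm (v * b)" by (rule norm_triangle_ineq)
  moreover have "e / 3 * N + e / 3 * N + e / 3 * N = e * N" by simp
  ultimately show ?thesis by linarith
qed

text \<open>Uniform convergence of the three series of partials gives uniform convergence of the
  differentials in operator norm; the error e is split into thirds.\<close>

lemma cdiff_suminf:
  fixes f :: "nat \<Rightarrow> complex \<times> complex \<times> complex \<Rightarrow> complex"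
  assumes S: "open S" "convex S" "p \<in> S"
    and der: "\<And>n x. x \<in> S \<Longrightarrow> (f n has_derivative (\<lambda>h. A n x * fst h + B n x * fst (snd h) + D n x * snd (snd h))) (at x)"
    and bd: "\<And>n x. x \<in> S \<Longrightarrow> norm (A n x) \<le> M n" "\<And>n x. x \<in> S \<Longrightarrow> norm (B n x) \<le> M n" "\<And>n x. x \<in> S \<Longrightarrow> norm (D n x) \<le> M n"
    and M: "summable M" and sf: "summable (\<lambda>n. f n p)"
  shows "cdiff (\<lambda>x. \<Sum>n. f n x) p"
proof -
  define g' where "g' = (\<lambda>x h. (\<Sum>n. A n x) * fst h + (\<Sum>n. B n x) * fst (snd h) + (\<Sum>n. D n x) * snd (snd h))"
  have ul: "uniform_limit S (\<lambda>n x. \<Sum>i<n. E i x) (\<lambda>x. \<Sum>i. E i x) sequentially"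
    if "\<And>n x. x \<in> S \<Longrightarrow> norm (E n x) \<le> M n" for E :: "nat \<Rightarrow> complex \<times> complex \<times> complex \<Rightarrow> complex"
    using that M by (rule Weierstrass_m_test)
  have ulA: "uniform_limit S (\<lambda>n x. \<Sum>i<n. A i x) (\<lambda>x. \<Sum>i. A i x) sequentially" by (rule ul) (rule bd(1))
  have ulB: "uniform_limit S (\<lambda>n x. \<Sum>i<n. B i x) (\<lambda>x. \<Sum>i. B i x) sequentially" by (rule ul) (rule bd(2))
  have ulD: "uniform_limit S (\<lambda>n x. \<Sum>i<n. D i x) (\<lambda>x. \<Sum>i. D i x) sequentially" by (rule ul) (rule bd(3))
  have "\<exists>g. \<forall>x\<in>S. (\<lambda>n. f n x) sums g x \<and> (g has_derivative g' x) (at x within S)"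
  proof (rule has_derivative_series[where f' = "\<lambda>n x h. A n x * fst h + B n x * fst (snd h) + D n x * snd (snd h)" and x = p])
    show "convex S" "p \<in> S" "(\<lambda>n. f n p) sums (\<Sum>n. f n p)" by (rule S(2), rule S(3), rule summable_sums[OF sf])
    show "(f n has_derivative (\<lambda>h. A n x * fst h + B n x * fst (snd h) + D n x * snd (snd h))) (at x within S)" if "x \<in> S" for n x
      by (rule has_derivative_at_withinI[OF der[OF that]])
    fix e :: real assume e: "e > 0"
    have e3: "e / 3 > 0" using e by simp
    show "\<forall>\<^sub>F n in sequentially. \<forall>x\<in>S. \<forall>h. norm ((\<Sum>i<n. A i x * fst h + B i x * fst (snd h) + D i x * snd (snd h)) - g' x h) \<le> e * norm h"
      using uniform_limitD[OF ulA e3] uniform_limitD[OF ulB e3] uniform_limitD[OF ulD e3]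
    proof eventually_elim
      case (elim n)
      show ?case
      proof (intro ballI allI)
        fix x h :: "complex \<times> complex \<times> complex" assume x: "x \<in> S"
        have nh: "norm (fst h) \<le> norm h" by (rule norm_fst_le_norm)
        have ns: "norm (snd h) \<le> norm h" by (rule norm_snd_le_norm)
        have nh1: "norm (fst (snd h)) \<le> norm h" using norm_fst_le_norm ns by (rule order_trans)
        have nh2: "norm (snd (snd h)) \<le> norm h" using norm_snd_le_norm ns by (rule order_trans)
        have d: "norm ((\<Sum>i<n. A i x) - (\<Sum>i. A i x)) \<le> e / 3" "norm ((\<Sum>i<n. B i x) - (\<Sum>i. B i x)) \<le> e / 3"
            "norm ((\<Sum>i<n. D i x) - (\<Sum>i. D i x)) \<le> e / 3"
          using elim[rule_format, OF x] unfolding dist_norm by (auto intro: less_imp_le)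
        have "(\<Sum>i<n. A i x * fst h + B i x * fst (snd h) + D i x * snd (snd h)) - g' x h
          = ((\<Sum>i<n. A i x) - (\<Sum>i. A i x)) * fst h + ((\<Sum>i<n. B i x) - (\<Sum>i. B i x)) * fst (snd h) + ((\<Sum>i<n. D i x) - (\<Sum>i. D i x)) * snd (snd h)"
          unfolding g'_def sum.distrib sum_distrib_right[symmetric] left_diff_distrib by (rule diff_diff_regroup)
        with norm_sum3_le[OF d nh nh1 nh2]
        show "norm ((\<Sum>i<n. A i x * fst h + B i x * fst (snd h) + D i x * snd (snd h)) - g' x h) \<le> e * norm h" by (simp only:)
      qed
    qed
  qed
  then obtain g where g: "\<And>x. x \<in> S \<Longrightarrow> (\<lambda>n. f n x) sums g x" "(g has_derivative g' p) (at p within S)" using S(3) by blast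
  have "(g has_derivative g' p) (at p)" using g(2) at_within_open[OF S(3,1)] by simp
  then have "((\<lambda>x. \<Sum>n. f n x) has_derivative g' p) (at p)"
    by (rule has_derivative_transform_within_open[OF _ S(1,3)]) (use g(1) in \<open>simp add: sums_iff\<close>)
  then show ?thesis by (rule cdiffI) (simp add: g'_def)
qed

text \<open>A common shape for three series in the invariants: the exponent of sigma, the regular
  part of wp, and its derivative. They differ only in the weight \<open>w\<close> and the power
  \<open>e\<close> of z.\<close>

definition wseries :: "(nat \<Rightarrow> complex) \<Rightarrow> (nat \<Rightarrow> nat) \<Rightarrow> complex \<times> complex \<times> complex \<Rightarrow> complex" where
  "wseries w e p = (\<Sum>n. w n * (wcoef (fst (snd p)) (snd (snd p)) n * fst p ^ e n))"

text \<open>Half the radius of convergence buys the factor (1/2)^n. The slack n <= k + 2 allows for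
  the powers of z lost by passing to wp' and differentiating once more in z.\<close>

lemma geometric_weight:
  fixes C x :: real and n k :: nat
  assumes C: "C \<ge> 1" and z: "0 \<le> x" "x \<le> 1 / (2 * C)" and k: "n \<le> k + 2"
  shows "C ^ (n + 2) * x ^ k \<le> 8 * C ^ 4 * (1/2) ^ n"
proof -
  have "1 / (2 * C) \<le> 1 / 1" using C by (intro frac_le) auto
  then have x1: "x \<le> 1" using z by linarith
  have C4: "C ^ 2 \<le> C ^ 4" "C ^ 3 \<le> C ^ 4" using C by (intro power_increasing; simp)+
  have C40: "C ^ 4 \<ge> 0" using C by simp
  consider "n = 0" | "n = 1" | m where "n = m + 2" by (cases "n < 2") (use that(1,2) that(3)[of "n - 2"] in \<open>auto simp: less_2_cases_iff\<close>)
  then show ?thesis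
  proof cases
    case 1
    have "C ^ 2 * x ^ k \<le> C ^ 4 * 1" using C4 z x1 C by (intro mult_mono power_le_one) auto
    then have "C ^ 2 * x ^ k \<le> 8 * C ^ 4" using C40 by linarith
    then show ?thesis by (simp only: 1 add_0 power_0 mult_1_right)
  next
    case 2
    have "C ^ 3 * x ^ k \<le> C ^ 4 * 1" using C4 z x1 C by (intro mult_mono power_le_one) auto
    then have "C ^ 3 * x ^ k \<le> 8 * C ^ 4 * (1/2)" using C40 by linarith
    moreover have "n + 2 = 3" using 2 by simp
    ultimately show ?thesis by (simp only: 2 power_one_right)
  next
    case (3 m)
    have n4: "n + 2 = 4 + m" using 3 by simp
    have "x ^ k \<le> x ^ m" using k 3 z x1 by (intro power_decreasing) auto
    also have "\<dots> \<le> (1 / (2 * C)) ^ m" using z by (intro power_mono) auto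
    finally have "C ^ (n + 2) * x ^ k \<le> C ^ (n + 2) * (1 / (2 * C)) ^ m" using C by (intro mult_left_mono) auto
    also have "C ^ (n + 2) = C ^ 4 * C ^ m" by (simp only: n4 power_add)
    also have "C ^ 4 * C ^ m * (1 / (2 * C)) ^ m = C ^ 4 * (C ^ m * (1 / (2 * C)) ^ m)" by (rule mult.assoc)
    also have "C ^ m * (1 / (2 * C)) ^ m = (1/2) ^ m" using C by (simp flip: power_mult_distrib)
    also have "C ^ 4 * (1/2) ^ m = 4 * C ^ 4 * (1/2) ^ n" by (simp add: 3 power_add power2_eq_square)
    also have "\<dots> \<le> 8 * C ^ 4 * (1/2) ^ n" using C40 by simp
    finally show ?thesis by (simp only: n4 power_add)
  qed
qed

lemma summable_weight: "summable (\<lambda>n. (real n + 1) * (real n + 2) * (c * (1/2) ^ n))"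
proof -
  have "summable (\<lambda>n. (real n + 1) * (real n + 2) * (1/2) ^ n)"
  proof (rule summable_comparison_test_bigo)
    show "summable (\<lambda>n. norm ((3/4::real) ^ n))" by (simp add: summable_geometric)
    show "(\<lambda>n. (real n + 1) * (real n + 2) * (1/2) ^ n) \<in> O(\<lambda>n. (3/4) ^ n)" by real_asymp
  qed
  from summable_mult[OF this, of c] show ?thesis by (simp add: mult_ac)
qed

definition wcoef_gradient :: "real \<Rightarrow> nat \<Rightarrow> complex \<times> complex \<Rightarrow> complex \<times> complex \<Rightarrow> bool" where
  "wcoef_gradient C n ab AB \<longleftrightarrow>
    ((\<lambda>p. wcoef (fst p) (snd p) n) has_derivative (\<lambda>h. fst AB * fst h + snd AB * snd h)) (at ab)
    \<and> norm (fst AB) \<le> C ^ (n + 2) \<and> norm (snd AB) \<le> C ^ (n + 2)"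

lemma wcoef_gradient_choice:
  assumes C: "C \<ge> 1"
  shows "\<exists>AB. \<forall>n ab. norm (fst ab) \<le> C \<longrightarrow> norm (snd ab) \<le> C \<longrightarrow> wcoef_gradient C n ab (AB (n, ab))"
proof -
  define AB where "AB = (\<lambda>q. SOME AB. wcoef_gradient C (fst q) (snd q) AB)"
  have "wcoef_gradient C n ab (AB (n, ab))" if ab: "norm (fst ab) \<le> C" "norm (snd ab) \<le> C" for n ab
  proof -
    obtain A B where "((\<lambda>p. wcoef (fst p) (snd p) n) has_derivative (\<lambda>h. A * fst h + B * snd h)) (at (fst ab, snd ab))
      \<and> norm A \<le> C ^ (n + 2) \<and> norm B \<le> C ^ (n + 2)"
      using wcoef_deriv[OF C ab, of n] by (elim exE)
    then have "wcoef_gradient C n ab (A, B)" by (simp add: wcoef_gradient_def)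
    then show ?thesis unfolding AB_def fst_conv snd_conv by (rule someI)
  qed
  then show ?thesis by (intro exI[of _ AB] allI impI)
qed

lemma product_rule_regroup:
  "w * (c * (k * h * p) + (A * h1 + B * h2) * q) = w * (c * (k * p)) * h + w * (A * q) * h1 + w * (B * q) * h2" for w :: complex
  by (simp add: algebra_simps)

lemma cdiff_wseries:
  assumes w: "\<And>n. norm (w n) \<le> real n + 1" and e: "\<And>n. n \<le> e n + 1" "\<And>n. e n \<le> n + 2"
    and C: "C \<ge> 1" and p: "norm z < 1 / (2 * C)" "norm a < C" "norm b < C"
  shows "cdiff (wseries w e) (z, a, b)"
proof -
  define S where "S = ball (0::complex) (1 / (2 * C)) \<times> ball (0::complex) C \<times> ball (0::complex) C"
  obtain AB where AB0: "\<forall>n ab. norm (fst ab) \<le> C \<longrightarrow> norm (snd ab) \<le> C \<longrightarrow> wcoef_gradient C n ab (AB (n, ab))"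
    using wcoef_gradient_choice[OF C] by (rule exE)
  note AB' = AB0[rule_format, unfolded wcoef_gradient_def]
  note AB = AB'[THEN conjunct1] AB'[THEN conjunct2, THEN conjunct1] AB'[THEN conjunct2, THEN conjunct2]
  \<comment> \<open>n + 1 bounds the weight, n + 2 bounds the exponent brought down by
    differentiating in z, and the rest is \<open>geometric_weight\<close>.\<close>
  define M where "M = (\<lambda>n. (real n + 1) * (real n + 2) * (8 * C ^ 4 * (1/2) ^ n))"
  let ?c = "\<lambda>n p. wcoef (fst (snd p)) (snd (snd p)) n"
  have inS: "norm (fst x) \<le> 1 / (2 * C)" "norm (fst (snd x)) \<le> C" "norm (snd (snd x)) \<le> C" if "x \<in> S" for x
    using that by (auto simp: S_def)
  have key: "norm (w n * (c * (of_nat j * y))) \<le> M n"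
    if "norm c \<le> C ^ (n + 2)" "norm y = x ^ k" "0 \<le> x" "x \<le> 1 / (2 * C)" "n \<le> k + 2" "j \<le> n + 2" for c y :: complex and x k n j
  proof -
    have "norm (w n * (c * (of_nat j * y))) = norm (w n) * real j * (norm c * x ^ k)" by (simp add: norm_mult that(2))
    also have "\<dots> \<le> (real n + 1) * (real n + 2) * (C ^ (n + 2) * x ^ k)"
      using that w[of n] by (intro mult_mono mult_right_mono) auto
    also have "\<dots> \<le> M n" unfolding M_def using geometric_weight[OF C that(3,4,5)] by (intro mult_left_mono) auto
    finally show ?thesis .
  qed
  have key1: "norm (w n * (c * y)) \<le> M n"
    if "norm c \<le> C ^ (n + 2)" "norm y = x ^ k" "0 \<le> x" "x \<le> 1 / (2 * C)" "n \<le> k + 2" for c y :: complex and x k n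
    using key[OF that, of 1] by simp
  have sM: "summable M" unfolding M_def by (rule summable_weight)
  show ?thesis
    unfolding wseries_def
  proof (rule cdiff_suminf[where S = S and M = M
      and A = "\<lambda>n x. w n * (?c n x * (of_nat (e n) * fst x ^ (e n - 1)))"
      and B = "\<lambda>n x. w n * (fst (AB (n, snd x)) * fst x ^ e n)" and D = "\<lambda>n x. w n * (snd (AB (n, snd x)) * fst x ^ e n)"])
    show "open S" unfolding S_def by (intro open_Times open_ball)
    show "convex S" unfolding S_def by (intro convex_Times convex_ball)
    show "(z, a, b) \<in> S" using p by (simp add: S_def)
    show "summable M" by (rule sM)
    fix n x assume x: "x \<in> S"
    note i = inS[OF x]
    have d1: "((\<lambda>p. ?c n p) has_derivative (\<lambda>h. fst (AB (n, snd x)) * fst (snd h) + snd (AB (n, snd x)) * snd (snd h))) (at x)"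
      by (rule has_derivative_compose[OF has_derivative_snd[OF has_derivative_ident] AB(1)[OF i(2,3)]])
    have d2: "((\<lambda>p. fst p ^ e n) has_derivative (\<lambda>h. of_nat (e n) * fst h * fst x ^ (e n - 1))) (at x)"
      by (rule has_derivative_power[OF has_derivative_fst[OF has_derivative_ident]])
    show "((\<lambda>p. w n * (?c n p * fst p ^ e n)) has_derivative
      (\<lambda>h. w n * (?c n x * (of_nat (e n) * fst x ^ (e n - 1))) * fst h + w n * (fst (AB (n, snd x)) * fst x ^ e n) * fst (snd h)
         + w n * (snd (AB (n, snd x)) * fst x ^ e n) * snd (snd h))) (at x)"
      by (rule has_derivative_eq_rhs[OF has_derivative_mult_right[OF has_derivative_mult[OF d1 d2]]])
         (rule ext, rule product_rule_regroup)
    have "norm (?c n x) \<le> C ^ (n + 2) / 12" by (rule wcoef_bound[OF C i(2,3)])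
    moreover have "C ^ (n + 2) \<ge> 0" using C by simp
    ultimately have c: "norm (?c n x) \<le> C ^ (n + 2)" by linarith
    show "norm (w n * (?c n x * (of_nat (e n) * fst x ^ (e n - 1)))) \<le> M n"
      by (rule key[OF c norm_power _ i(1)]) (use e[of n] in auto)
    show "norm (w n * (fst (AB (n, snd x)) * fst x ^ e n)) \<le> M n"
      by (rule key1[OF AB(2)[OF i(2,3)] norm_power _ i(1)]) (use e(1)[of n] in auto)
    show "norm (w n * (snd (AB (n, snd x)) * fst x ^ e n)) \<le> M n"
      by (rule key1[OF AB(3)[OF i(2,3)] norm_power _ i(1)]) (use e(1)[of n] in auto)
  next
    have c: "norm (wcoef a b n) \<le> C ^ (n + 2)" for n
    proof -
      have "norm (wcoef a b n) \<le> C ^ (n + 2) / 12" by (rule wcoef_bound[OF C]) (use p in auto)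
      moreover have "C ^ (n + 2) \<ge> 0" using C by simp
      ultimately show ?thesis by linarith
    qed
    have "norm (w n * (wcoef a b n * z ^ e n)) \<le> M n" for n
      by (rule key1[OF c norm_power]) (use p e(1)[of n] in auto)
    then show "summable (\<lambda>n. w n * (wcoef (fst (snd (z, a, b))) (snd (snd (z, a, b))) n * fst (z, a, b) ^ e n))"
      by (intro summable_comparison_test'[OF sM, where N = 0]) simp
  qed
qed

section \<open>Sigma, wp and wp' as functions of the argument and the invariants\<close>

lemma period_lattice_props:
  assumes "a ^ 3 - 27 * b ^ 2 \<noteq> 0"
  shows "complex_lattice (period_lattice a b)" "lattice_g2 (period_lattice a b) = a" "lattice_g3 (period_lattice a b) = b"
proof -
  have "\<exists>L. is_lattice L \<and> lattice_g2 L = a \<and> lattice_g3 L = b"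
    using ex_lattice_with_invariants[OF assms] by metis
  from someI_ex[OF this, folded period_lattice_def]
  show "complex_lattice (period_lattice a b)" "lattice_g2 (period_lattice a b) = a" "lattice_g3 (period_lattice a b) = b"
    by (auto intro: complex_lattice.intro)
qed

lemma wsigma_eq: "wsigma a b = lattice_sigma (period_lattice a b)"
  and wzeta_eq: "wzeta a b = lattice_zeta (period_lattice a b)"
  and wp_eq: "wp a b = lattice_wp (period_lattice a b)"
proof -
  show s: "wsigma a b = lattice_sigma (period_lattice a b)" by (rule ext) (simp add: wsigma_def)
  show z: "wzeta a b = lattice_zeta (period_lattice a b)" by (rule ext) (simp add: wzeta_def lattice_zeta_def s)
  show "wp a b = lattice_wp (period_lattice a b)" by (rule ext) (simp add: wp_def lattice_wp_def z)
qed

definition disc_nz :: "complex \<times> complex \<times> complex \<Rightarrow> bool" where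
  "disc_nz p \<longleftrightarrow> fst (snd p) ^ 3 - 27 * snd (snd p) ^ 2 \<noteq> 0"

definition sig3 :: "complex \<times> complex \<times> complex \<Rightarrow> complex" where
  "sig3 p = wsigma (fst (snd p)) (snd (snd p)) (fst p)"

definition wp3 :: "complex \<times> complex \<times> complex \<Rightarrow> complex" where
  "wp3 p = wp (fst (snd p)) (snd (snd p)) (fst p)"

definition wpd3 :: "complex \<times> complex \<times> complex \<Rightarrow> complex" where
  "wpd3 p = deriv (wp (fst (snd p)) (snd (snd p))) (fst p)"

lemma eventually_disc_nz: assumes "disc_nz p" shows "\<forall>\<^sub>F q in nhds p. disc_nz q"
proof -
  have "cdiff (\<lambda>p. fst (snd p) ^ 3 - 27 * snd (snd p) ^ 2) p" by (intro cdiff_intros)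
  from cdiff_eventually_nonzero[OF this] assms show ?thesis by (simp add: disc_nz_def)
qed

lemma sums_small_disc:
  assumes d: "a ^ 3 - 27 * b ^ 2 \<noteq> 0" and C: "C \<ge> 1" "norm a \<le> C" "norm b \<le> C" and z: "norm z < 1 / C" "z \<noteq> 0"
  shows "wsigma a b z = z * exp (- wseries (\<lambda>n. 1 / of_nat ((n + 2) * (n + 1))) (\<lambda>n. n + 2) (z, a, b))"
    "wp a b z = 1 / z ^ 2 + wseries (\<lambda>n. 1) (\<lambda>n. n) (z, a, b)"
    "deriv (wp a b) z = - 2 / z ^ 3 + wseries of_nat (\<lambda>n. n - 1) (z, a, b)"
    "z \<notin> period_lattice a b"
proof -
  define L where "L = period_lattice a b"
  interpret complex_lattice L unfolding L_def by (rule period_lattice_props(1)[OF d])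
  have g: "lattice_g2 L = a" "lattice_g3 L = b" unfolding L_def using period_lattice_props[OF d] by auto
  have C': "C \<ge> 1" "norm (lattice_g2 L) \<le> C" "norm (lattice_g3 L) \<le> C" using C g by auto
  note sd = small_disc_expansion[OF C' z(1)]
  have Cp: "C > 0" using C by simp
  have coef: "fps_nth wpF n = wcoef a b n" for n by (simp add: wpF_eq_wcoef g)
  have "norm (fps_nth wpF n) \<le> C ^ 2 / 12 * C ^ n" for n
    using wcoef_bound[OF C, of n] by (simp add: coef power_add power2_eq_square mult_ac)
  then have rF: "fps_conv_radius wpF \<ge> ereal (1 / C)" by (rule fps_conv_radius_ge_bound[OF Cp])
  have zr: "ereal (norm z) < ereal (1 / C)" using z by simp
  have zF: "norm z < fps_conv_radius wpF" using zr rF by (rule less_le_trans)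
  have zF': "norm z < fps_conv_radius (fps_deriv wpF)" using zF fps_conv_radius_deriv by (rule less_le_trans)
  have "eval_fps wpF z = wseries (\<lambda>n. 1) (\<lambda>n. n) (z, a, b)"
    by (simp add: eval_fps_def wseries_def coef)
  then show "wp a b z = 1 / z ^ 2 + wseries (\<lambda>n. 1) (\<lambda>n. n) (z, a, b)"
    using sd(3)[OF z(2)] by (simp add: wp_eq L_def)
  have "(\<lambda>n. fps_nth (fps_deriv wpF) n * z ^ n) sums eval_fps (fps_deriv wpF) z" by (rule sums_eval_fps[OF zF'])
  then have "(\<lambda>n. of_nat (Suc n) * (wcoef a b (Suc n) * z ^ (Suc n - 1))) sums eval_fps (fps_deriv wpF) z"
    by (simp add: coef mult_ac)
  \<comment> \<open>The index shift adds a term n = 0, which is 0 through its factor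
    \<open>of_nat 0\<close>; the truncated exponent 0 - 1 = 0 is harmless there.\<close>
  then have "(\<lambda>n. of_nat n * (wcoef a b n * z ^ (n - 1))) sums (eval_fps (fps_deriv wpF) z + of_nat 0 * (wcoef a b 0 * z ^ (0 - 1)))"
    by (subst (asm) sums_Suc_iff) simp
  then have "eval_fps (fps_deriv wpF) z = wseries of_nat (\<lambda>n. n - 1) (z, a, b)"
    by (simp add: wseries_def sums_iff)
  then show "deriv (wp a b) z = - 2 / z ^ 3 + wseries of_nat (\<lambda>n. n - 1) (z, a, b)"
    using sd(4)[OF z(2)] by (simp add: wp_eq L_def)
  have s1: "1 / of_nat ((n + 2) * (n + 1)) * (wcoef a b n * z ^ (n + 2)) = fps_nth sigF (Suc (Suc n)) * z ^ Suc (Suc n)" for n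
    by (simp add: sigF_def coef algebra_simps)
  have two: "fps_nth sigF 0 = 0" "fps_nth sigF (Suc 0) = 0" by (simp_all add: sigF_def)
  have "norm (fps_nth sigF n) \<le> 1 / 12 * C ^ n" for n
  proof (cases "n < 2")
    case True then show ?thesis using Cp by (simp add: sigF_def)
  next
    case False
    then have "n = Suc (Suc (n - 2))" by simp
    then obtain m where m: "n = Suc (Suc m)" by blast
    have ge1: "1 \<le> real (n * (n - 1))" by (simp add: m)
    have "norm (fps_nth wpF m) / real (n * (n - 1)) \<le> norm (fps_nth wpF m) / 1"
      using ge1 by (intro frac_le norm_ge_zero order_refl) linarith+
    also have "\<dots> \<le> 1 / 12 * C ^ n" using wcoef_bound[OF C, of m] by (simp add: coef m power_add power2_eq_square mult_ac)
    finally show ?thesis using False by (simp add: sigF_def m norm_divide norm_mult del: of_nat_Suc of_nat_mult)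
  qed
  then have "fps_conv_radius sigF \<ge> ereal (1 / C)" by (rule fps_conv_radius_ge_bound[OF Cp])
  with zr have zS: "norm z < fps_conv_radius sigF" by (rule less_le_trans)
  have "(\<lambda>n. fps_nth sigF n * z ^ n) sums eval_fps sigF z" by (rule sums_eval_fps[OF zS])
  then have "(\<lambda>n. fps_nth sigF (Suc n) * z ^ Suc n) sums eval_fps sigF z" by (subst sums_Suc_iff) (simp add: two)
  then have "(\<lambda>n. fps_nth sigF (Suc (Suc n)) * z ^ Suc (Suc n)) sums eval_fps sigF z" by (subst sums_Suc_iff) (simp add: two)
  then have "eval_fps sigF z = wseries (\<lambda>n. 1 / of_nat ((n + 2) * (n + 1))) (\<lambda>n. n + 2) (z, a, b)"
    unfolding wseries_def fst_conv snd_conv s1 by (simp only: sums_iff)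
  then show "wsigma a b z = z * exp (- wseries (\<lambda>n. 1 / of_nat ((n + 2) * (n + 1))) (\<lambda>n. n + 2) (z, a, b))"
    using sd(1) by (simp only: wsigma_eq L_def)
  show "z \<notin> period_lattice a b" using sd(2)[OF z(2)] by (simp add: L_def)
qed

lemma cdiff_small:
  assumes d: "disc_nz (z, a, b)" and z: "z \<noteq> 0" "norm z < 1 / (2 * (norm a + norm b + 1))"
  shows "cdiff sig3 (z, a, b) \<and> cdiff wp3 (z, a, b) \<and> cdiff wpd3 (z, a, b)"
proof -
  \<comment> \<open>The strict inequalities keep C a bound for all nearby invariants, so the series
    represent the functions on a full neighbourhood in the three variables.\<close>
  define C where "C = norm a + norm b + 1"
  have C: "C \<ge> 1" "norm a < C" "norm b < C" by (auto simp: C_def add_nonneg_pos)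
  have zC: "norm z < 1 / (2 * C)" using z by (simp add: C_def)
  define N where "N = (ball (0::complex) (1 / (2 * C)) - {0}) \<times> ball (0::complex) C \<times> ball (0::complex) C"
  have "open N" unfolding N_def by (intro open_Times) auto
  then have "\<forall>\<^sub>F q in nhds (z, a, b). q \<in> N"
    by (rule eventually_nhds_in_open) (use z zC C in \<open>auto simp: N_def\<close>)
  then have "\<forall>\<^sub>F q in nhds (z, a, b). q \<in> N \<and> disc_nz q" using eventually_disc_nz[OF d] by eventually_elim simp
  then have ev: "\<forall>\<^sub>F q in nhds (z, a, b).
      fst q * exp (- wseries (\<lambda>n. 1 / of_nat ((n + 2) * (n + 1))) (\<lambda>n. n + 2) q) = sig3 q \<and>
      1 / fst q ^ 2 + wseries (\<lambda>n. 1) (\<lambda>n. n) q = wp3 q \<and>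
      - 2 / fst q ^ 3 + wseries of_nat (\<lambda>n. n - 1) q = wpd3 q"
  proof eventually_elim
    case (elim q)
    obtain z' a' b' where q: "q = (z', a', b')" by (cases q)
    have lt: "1 / (2 * C) \<le> 1 / C" using C by (intro divide_left_mono) auto
    have q': "norm z' < 1 / C" "z' \<noteq> 0" "norm a' \<le> C" "norm b' \<le> C" "a' ^ 3 - 27 * b' ^ 2 \<noteq> 0"
      using elim lt by (auto simp: N_def q disc_nz_def)
    show ?case using sums_small_disc[OF q'(5) C(1) q'(3,4,1,2)] by (simp add: q sig3_def wp3_def wpd3_def)
  qed
  have s: "cdiff (wseries (\<lambda>n. 1 / of_nat ((n + 2) * (n + 1))) (\<lambda>n. n + 2)) (z, a, b)"
  proof (rule cdiff_wseries[OF _ _ _ C(1) zC C(2,3)])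
    fix n :: nat
    have "norm (1 / of_nat ((n + 2) * (n + 1)) :: complex) = 1 / real ((n + 2) * (n + 1))" by (simp only: norm_divide norm_one norm_of_nat)
    also have "\<dots> \<le> 1 / 1" by (intro frac_le) (auto simp del: of_nat_mult)
    finally show "norm (1 / of_nat ((n + 2) * (n + 1)) :: complex) \<le> real n + 1" by linarith
  qed auto
  have p: "cdiff (wseries (\<lambda>n. 1) (\<lambda>n. n)) (z, a, b)" by (rule cdiff_wseries[OF _ _ _ C(1) zC C(2,3)]) auto
  have p': "cdiff (wseries of_nat (\<lambda>n. n - 1)) (z, a, b)" by (rule cdiff_wseries[OF _ _ _ C(1) zC C(2,3)]) auto
  have z0: "fst (z, a, b) ^ 2 \<noteq> 0" "fst (z, a, b) ^ 3 \<noteq> 0" using z by auto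
  have "cdiff (\<lambda>q. fst q * exp (- wseries (\<lambda>n. 1 / of_nat ((n + 2) * (n + 1))) (\<lambda>n. n + 2) q)) (z, a, b)"
    by (intro cdiff_intros s)
  then have 1: "cdiff sig3 (z, a, b)" by (rule cdiff_cong) (rule eventually_mono[OF ev], blast)
  have "cdiff (\<lambda>q. 1 / fst q ^ 2 + wseries (\<lambda>n. 1) (\<lambda>n. n) q) (z, a, b)" by (intro cdiff_intros p z0)
  then have 2: "cdiff wp3 (z, a, b)" by (rule cdiff_cong) (rule eventually_mono[OF ev], blast)
  have "cdiff (\<lambda>q. - 2 / fst q ^ 3 + wseries of_nat (\<lambda>n. n - 1) q) (z, a, b)" by (intro cdiff_intros p' z0)
  then have 3: "cdiff wpd3 (z, a, b)" by (rule cdiff_cong) (rule eventually_mono[OF ev], blast)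
  from 1 2 3 show ?thesis by blast
qed

text \<open>The duplication formulas must hold for all nearby arguments and invariants. Being off
  the lattice at z/2 and at z is expressed by sigma(z/2) and wp'(z/2) being nonzero, which persists
  nearby by the differentiability already known at z/2.\<close>

lemma cdiff_double:
  assumes d: "disc_nz (z, a, b)" and z: "z \<notin> period_lattice a b"
    and h: "cdiff sig3 (z / 2, a, b) \<and> cdiff wp3 (z / 2, a, b) \<and> cdiff wpd3 (z / 2, a, b)"
  shows "cdiff sig3 (z, a, b) \<and> cdiff wp3 (z, a, b) \<and> cdiff wpd3 (z, a, b)"
proof -
  define s where "s = (\<lambda>p. sig3 (fst p / 2, snd p))"
  define v where "v = (\<lambda>p. wp3 (fst p / 2, snd p))"
  define v' where "v' = (\<lambda>p. wpd3 (fst p / 2, snd p))"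
  \<comment> \<open>The tangent slope with wp'' replaced by 6 wp^2 - g2/2, so that it involves only
    functions known to be differentiable.\<close>
  define m where "m = (\<lambda>p. (6 * v p ^ 2 - fst (snd p) / 2) / v' p)"
  have cs: "cdiff s (z, a, b)" unfolding s_def by (rule cdiff_half) (use h in simp)
  have cv: "cdiff v (z, a, b)" unfolding v_def by (rule cdiff_half) (use h in simp)
  have cv': "cdiff v' (z, a, b)" unfolding v'_def by (rule cdiff_half) (use h in simp)
  have dn: "a ^ 3 - 27 * b ^ 2 \<noteq> 0" using d by (simp add: disc_nz_def)
  interpret l: complex_lattice "period_lattice a b" by (rule period_lattice_props(1)[OF dn])
  have z2: "z / 2 \<notin> period_lattice a b" using z l.add_mem[of "z / 2" "z / 2"] by auto
  have s0: "s (z, a, b) \<noteq> 0" using z2 by (simp add: s_def sig3_def wsigma_eq l.lattice_sigma_eq_0_iff)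
  have v0: "v' (z, a, b) \<noteq> 0" using z2 z by (simp add: v'_def wpd3_def wp_eq l.wp'_eq_0_iff)
  have ev: "\<forall>\<^sub>F q in nhds (z, a, b). - v' q * s q ^ 4 = sig3 q \<and> - 2 * v q + m q ^ 2 / 4 = wp3 q \<and> - v' q + m q * (3 * v q - m q ^ 2 / 4) = wpd3 q"
    using eventually_disc_nz[OF d] cdiff_eventually_nonzero[OF cs s0] cdiff_eventually_nonzero[OF cv' v0]
  proof eventually_elim
    case (elim q)
    obtain z' a' b' where q: "q = (z', a', b')" by (cases q)
    have dn': "a' ^ 3 - 27 * b' ^ 2 \<noteq> 0" using elim(1) by (simp add: disc_nz_def q)
    interpret l': complex_lattice "period_lattice a' b'" by (rule period_lattice_props(1)[OF dn'])
    have g2: "lattice_g2 (period_lattice a' b') = a'" by (rule period_lattice_props(2)[OF dn'])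
    have z2': "z' / 2 \<notin> period_lattice a' b'" using elim(2) by (simp add: q s_def sig3_def wsigma_eq l'.lattice_sigma_eq_0_iff)
    then have zz': "2 * (z' / 2) \<notin> period_lattice a' b'"
      using elim(3) l'.wp'_eq_0_iff[OF z2'] by (simp add: q v'_def wpd3_def wp_eq)
    have slope: "m q = l'.wp_slope (z' / 2)"
      using l'.wp_ode2[OF z2'] by (simp add: m_def l'.wp_slope_def v_def v'_def wp3_def wpd3_def q wp_eq g2)
    show ?case
      using l'.lattice_sigma_double[OF z2'] l'.lattice_wp_double[OF z2' zz'] l'.wp'_double[OF z2' zz']
      unfolding slope by (simp add: q s_def v_def v'_def sig3_def wp3_def wpd3_def wsigma_eq wp_eq)
  qed
  have cm: "cdiff m (z, a, b)" unfolding m_def by (intro cdiff_intros cv cv' v0) simp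
  have "cdiff (\<lambda>q. - v' q * s q ^ 4) (z, a, b)" by (intro cdiff_intros cs cv')
  then have 1: "cdiff sig3 (z, a, b)" by (rule cdiff_cong) (rule eventually_mono[OF ev], blast)
  have "cdiff (\<lambda>q. - 2 * v q + m q ^ 2 / 4) (z, a, b)" by (intro cdiff_intros cv cm) simp
  then have 2: "cdiff wp3 (z, a, b)" by (rule cdiff_cong) (rule eventually_mono[OF ev], blast)
  have "cdiff (\<lambda>q. - v' q + m q * (3 * v q - m q ^ 2 / 4)) (z, a, b)" by (intro cdiff_intros cv cv' cm) simp
  then have 3: "cdiff wpd3 (z, a, b)" by (rule cdiff_cong) (rule eventually_mono[OF ev], blast)
  from 1 2 3 show ?thesis by blast
qed

text \<open>Each doubling of the radius is one use of \<open>cdiff_double\<close>. All three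
  functions are carried through the induction because sigma(2z) involves wp', whose duplication
  involves wp.\<close>

theorem cdiff_sigma:
  assumes d: "a ^ 3 - 27 * b ^ 2 \<noteq> 0" and z: "z \<notin> period_lattice a b"
  shows "cdiff sig3 (z, a, b)"
proof -
  interpret l: complex_lattice "period_lattice a b" by (rule period_lattice_props(1)[OF d])
  have dn: "disc_nz (x, a, b)" for x using d by (simp add: disc_nz_def)
  define r where "r = 1 / (2 * (norm a + norm b + 1))"
  have r: "r > 0" by (auto simp: r_def add_nonneg_pos)
  have main: "\<forall>z. z \<notin> period_lattice a b \<longrightarrow> norm z < 2 ^ n * r \<longrightarrow>
      cdiff sig3 (z, a, b) \<and> cdiff wp3 (z, a, b) \<and> cdiff wpd3 (z, a, b)" for n
  proof (induction n)
    case 0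
    show ?case
    proof (intro allI impI)
      fix z assume "z \<notin> period_lattice a b" "norm z < 2 ^ 0 * r"
      then show "cdiff sig3 (z, a, b) \<and> cdiff wp3 (z, a, b) \<and> cdiff wpd3 (z, a, b)"
        by (intro cdiff_small dn) (auto simp: r_def)
    qed
  next
    case (Suc n)
    show ?case
    proof (intro allI impI)
      fix z assume z: "z \<notin> period_lattice a b" "norm z < 2 ^ Suc n * r"
      have "z / 2 \<notin> period_lattice a b" using z l.add_mem[of "z / 2" "z / 2"] by auto
      moreover have "norm (z / 2) < 2 ^ n * r" using z(2) by (simp add: norm_divide)
      ultimately have "cdiff sig3 (z / 2, a, b) \<and> cdiff wp3 (z / 2, a, b) \<and> cdiff wpd3 (z / 2, a, b)"
        using Suc.IH by blast
      then show "cdiff sig3 (z, a, b) \<and> cdiff wp3 (z, a, b) \<and> cdiff wpd3 (z, a, b)"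
        by (rule cdiff_double[OF dn z(1)])
    qed
  qed
  obtain n where "norm z / r < 2 ^ n" using real_arch_pow[of 2 "norm z / r"] by auto
  then have "norm z < 2 ^ n * r" using r by (simp add: field_simps)
  then show ?thesis using main z by blast
qed

section \<open>The analytic solution of Somos-5\<close>

text \<open>Apart from the last sigma factor, the solution depends on \<kappa>, g2 and g3 only
  through s = sigma(\<kappa>), which reduces its differentiability to one variable.\<close>

definition somos_prefactor :: "complex \<Rightarrow> complex \<Rightarrow> complex \<Rightarrow> int \<Rightarrow> complex \<Rightarrow> complex" where
  "somos_prefactor Ap Am Bm n s =
     (if even n then Ap * (s ^ 4 * Bm) powi (n div 2) else Am * Bm powi (n div 2)) * (- 1 / s ^ 4) powi ((n div 2)\<^sup>2)"

lemma somos5_sol_eq: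
  "somos5_sol Ap Am Bm z0 n \<kappa> g2 g3 =
     somos_prefactor Ap Am Bm n (wsigma g2 g3 \<kappa>) * wsigma g2 g3 (of_int n * \<kappa> + z0)"
  by (simp add: somos5_sol_def somos_prefactor_def Let_def)

lemma somos_prefactor_nonzero:
  assumes "Ap \<noteq> 0" "Am \<noteq> 0" "Bm \<noteq> 0" "s \<noteq> 0" shows "somos_prefactor Ap Am Bm n s \<noteq> 0"
  using assms by (simp add: somos_prefactor_def)

text \<open>For even n the quotient of the two products is Bm/Bp = s^-4. For odd n it is Bp/Bm times
  \<mu>^2, that is s^4 s^-8. The relation between the two B's makes both parities agree.\<close>

lemma somos_prefactor_quotient:
  assumes nz: "Ap \<noteq> 0" "Am \<noteq> 0" "Bm \<noteq> 0" "s \<noteq> 0"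
  defines "P \<equiv> \<lambda>n. somos_prefactor Ap Am Bm n s"
  shows "P n * P (n + 3) * s ^ 4 = P (n + 1) * P (n + 2)"
proof -
  define \<mu> where "\<mu> = - 1 / s ^ 4"
  have \<mu>: "\<mu> \<noteq> 0" "\<mu> ^ 2 * s ^ 4 * s ^ 4 = 1" using nz by (simp_all add: \<mu>_def power2_eq_square)
  define Bp where "Bp = s ^ 4 * Bm"
  have Bp: "Bp \<noteq> 0" using nz by (simp add: Bp_def)
  have P: "P m = (if even m then Ap * Bp powi (m div 2) else Am * Bm powi (m div 2)) * \<mu> powi ((m div 2)\<^sup>2)" for m
    by (simp add: P_def somos_prefactor_def \<mu>_def Bp_def)
  obtain k where "n = 2 * k \<or> n = 2 * k + 1" by (metis oddE evenE)
  then show ?thesis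
  proof
    assume n: "n = 2 * k"
    have d: "n div 2 = k" "(n + 1) div 2 = k" "(n + 2) div 2 = k + 1" "(n + 3) div 2 = k + 1" by (simp_all add: n)
    have e: "even n" "odd (n + 1)" "even (n + 2)" "odd (n + 3)" by (simp_all add: n)
    have "Bp powi (k + 1) = Bp powi k * Bp" "Bm powi (k + 1) = Bm powi k * Bm" using Bp nz by (simp_all add: power_int_add)
    then show ?thesis by (simp add: P d e) (simp add: Bp_def)
  next
    assume n: "n = 2 * k + 1"
    have d: "n div 2 = k" "(n + 1) div 2 = k + 1" "(n + 2) div 2 = k + 1" "(n + 3) div 2 = k + 2" by (simp_all add: n)
    have e: "odd n" "even (n + 1)" "odd (n + 2)" "even (n + 3)" by (simp_all add: n)
    have b: "Bp powi (k + 2) = Bp powi (k + 1) * Bp" "Bm powi (k + 1) = Bm powi k * Bm"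
      using Bp nz power_int_add[of Bp "k + 1" 1] power_int_add[of Bm k 1] by (simp_all add: algebra_simps)
    have "\<mu> powi (k\<^sup>2) * \<mu> powi ((k + 2)\<^sup>2) = \<mu> powi (k\<^sup>2 + (k + 2)\<^sup>2)" using \<mu> by (simp add: power_int_add)
    also have "k\<^sup>2 + (k + 2)\<^sup>2 = (k + 1)\<^sup>2 + (k + 1)\<^sup>2 + 2" by (simp add: power2_eq_square algebra_simps)
    also have "\<mu> powi \<dots> = \<mu> powi ((k + 1)\<^sup>2) * \<mu> powi ((k + 1)\<^sup>2) * \<mu> ^ 2"
      using \<mu>(1) by (simp only: power_int_add power_int_numeral simp_thms disj_not1)
    finally have m: "\<mu> powi (k\<^sup>2) * \<mu> powi ((k + 2)\<^sup>2) = \<mu> powi ((k + 1)\<^sup>2) * \<mu> powi ((k + 1)\<^sup>2) * \<mu> ^ 2" .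
    have "P n * P (n + 3) * s ^ 4
      = Am * Bm powi k * Ap * Bp powi (k + 1) * Bp * (\<mu> powi (k\<^sup>2) * \<mu> powi ((k + 2)\<^sup>2)) * s ^ 4"
      by (simp add: P d e b(1))
    also have "\<dots> = Am * Bm powi k * Ap * Bp powi (k + 1) * Bm * \<mu> powi ((k + 1)\<^sup>2) * \<mu> powi ((k + 1)\<^sup>2) * (\<mu> ^ 2 * s ^ 4 * s ^ 4)"
      by (simp only: m Bp_def mult_ac)
    also have "\<dots> = P (n + 1) * P (n + 2)" unfolding \<mu>(2) by (simp add: P d e b(2))
    finally show ?thesis .
  qed
qed

lemma somos_prefactor_differentiable:
  assumes "s \<noteq> 0" "Bm \<noteq> 0" shows "somos_prefactor Ap Am Bm n field_differentiable at s"
proof -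
  have "(\<lambda>s. (if even n then Ap * (s ^ 4 * Bm) powi (n div 2) else Am * Bm powi (n div 2)) * (- 1 / s ^ 4) powi ((n div 2)\<^sup>2))
    holomorphic_on - {0}"
    using assms(2) by (cases "even n") (simp_all, (intro holomorphic_intros; simp)+)
  then have "somos_prefactor Ap Am Bm n holomorphic_on - {0}"
    by (simp add: somos_prefactor_def[abs_def])
  then show ?thesis using assms(1) by (intro holomorphic_on_imp_differentiable_at) auto
qed

text \<open>With \<open>u\<close> for the difference \<open>\<wp>(z) - \<wp>(\<kappa>)\<close>, the two relations between the successive ratios
  \<open>f, g, h\<close> of a solution are the addition formulas of \<open>\<sigma>\<close> (product form) and \<open>\<wp>\<close> (sum form).\<close>

lemma somos5_ratio_relations:
  fixes f g h u v M J \<alpha> \<beta> :: complex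
  assumes fg: "f * g + \<alpha> = - (M ^ 2) * u" and gh: "g * h + \<alpha> = - (M ^ 2) * v"
    and s: "(f + g - J) * u = M ^ 2" and g: "g = u * v" and nz: "u \<noteq> 0" "g \<noteq> 0" and \<beta>: "\<beta> = M ^ 4 - \<alpha> * J"
  shows "f * g * h = \<alpha> * g + \<beta>" "f * g * (f + g) - J * f * g + \<alpha> * (f + g) + \<beta> = 0"
proof -
  have "(f * g + \<alpha>) * (f + g - J) = - (M ^ 2) * ((f + g - J) * u)" unfolding fg by simp
  also have "\<dots> = - (M ^ 4)" unfolding s by (simp flip: power_add)
  finally show "f * g * (f + g) - J * f * g + \<alpha> * (f + g) + \<beta> = 0" unfolding \<beta> by (simp add: algebra_simps)
  have "u * (M ^ 2 * v + g * (J - g) + M ^ 2 * u + \<alpha>) = 0" using fg s g by algebra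
  then have k: "M ^ 2 * v + g * (J - g) + M ^ 2 * u + \<alpha> = 0" using nz by simp
  have "g * (f * g * h - \<alpha> * g - \<beta>) = (f * g) * (g * h) - \<alpha> * g ^ 2 - \<beta> * g" by (simp add: power2_eq_square algebra_simps)
  also have "\<dots> = (- (M ^ 2) * u - \<alpha>) * (- (M ^ 2) * v - \<alpha>) - \<alpha> * g ^ 2 - \<beta> * g"
    using fg gh by algebra
  also have "\<dots> = M ^ 4 * (u * v) + \<alpha> * (M ^ 2 * v + g * (J - g) + M ^ 2 * u + \<alpha>) - \<alpha> * g * (J - g) - \<alpha> * g ^ 2 - \<beta> * g"
    by (simp add: algebra_simps power4_eq_xxxx power2_eq_square)
  also have "\<dots> = 0" unfolding k g[symmetric] \<beta> by (simp add: algebra_simps power2_eq_square)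
  finally have "f * g * h - \<alpha> * g - \<beta> = 0" using nz by simp
  then show "f * g * h = \<alpha> * g + \<beta>" by (simp add: diff_diff_eq)
qed

section \<open>Recurrence and first integral from the addition formulas\<close>

context complex_lattice begin

text \<open>Multiply the addition formula by D(z)^2 and expand the cubic around wp k. The terms of
  degree two and three in D(z) cancel, leaving wp''(k) D(z) + wp'(k)^2.\<close>

lemma wp_translates_sum:
  assumes k: "k \<notin> L" and z: "z \<notin> L" "z + k \<notin> L" "z - k \<notin> L"
  defines "D \<equiv> \<lambda>z. lattice_wp L z - lattice_wp L k"
  shows "D z \<noteq> 0"
    "(D (z - k) * D z + D z * D (z + k) - deriv (deriv (lattice_wp L)) k) * D z = deriv (lattice_wp L) k ^ 2"
proof -
  define d where "d = D z"
  define l where "l = lattice_wp L k"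
  show nz: "D z \<noteq> 0" using lattice_zeta_add(1)[OF z(1) k z(2,3)] by (simp add: D_def)
  then have d0: "d \<noteq> 0" by (simp add: d_def)
  have wz: "lattice_wp L z = d + l" by (simp add: d_def D_def l_def)
  have k1: "deriv (lattice_wp L) k ^ 2 = 4 * l ^ 3 - lattice_g2 L * l - lattice_g3 L" using wp_ode1[OF k] by (simp add: l_def)
  have k2: "deriv (deriv (lattice_wp L)) k = 6 * l ^ 2 - lattice_g2 L / 2" using wp_ode2[OF k] by (simp add: l_def)
  have z1: "deriv (lattice_wp L) z ^ 2 = 4 * (d + l) ^ 3 - lattice_g2 L * (d + l) - lattice_g3 L" using wp_ode1[OF z(1)] by (simp add: wz)
  have z2: "deriv (deriv (lattice_wp L)) z = 6 * (d + l) ^ 2 - lattice_g2 L / 2" using wp_ode2[OF z(1)] by (simp add: wz)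
  have "D (z - k) + D (z + k) = lattice_wp L (z + k) + lattice_wp L (z - k) - 2 * l" by (simp add: D_def l_def)
  also have "\<dots> = 2 * d - (6 * (d + l) ^ 2 - lattice_g2 L / 2) / d + (4 * (d + l) ^ 3 - lattice_g2 L * (d + l) - lattice_g3 L) / d ^ 2"
    unfolding lattice_wp_add[OF z(1) k z(2,3)] z1 z2 wz by (simp add: l_def[symmetric])
  finally have S: "D (z - k) + D (z + k) = \<dots>" .
  have clear: "(2 * d - A / d + B / d ^ 2) * d ^ 2 = 2 * d * d ^ 2 - A * d + B" for A B
    using d0 by (simp add: ring_distribs power2_eq_square)
  have "(D (z - k) + D (z + k)) * d ^ 2 = 2 * d * d ^ 2 - (6 * (d + l) ^ 2 - lattice_g2 L / 2) * d + (4 * (d + l) ^ 3 - lattice_g2 L * (d + l) - lattice_g3 L)"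
    unfolding S by (rule clear)
  also have "\<dots> = (6 * l ^ 2 - lattice_g2 L / 2) * d + (4 * l ^ 3 - lattice_g2 L * l - lattice_g3 L)"
    by (simp add: algebra_simps power2_eq_square power3_eq_cube)
  finally have "(D (z - k) + D (z + k)) * d ^ 2 = deriv (deriv (lattice_wp L)) k * d + deriv (lattice_wp L) k ^ 2"
    by (simp only: k1 k2)
  then show "(D (z - k) * D z + D z * D (z + k) - deriv (deriv (lattice_wp L)) k) * D z = deriv (lattice_wp L) k ^ 2"
    unfolding d_def[symmetric] by (simp add: algebra_simps power2_eq_square)
qed

lemma sigma_translates:
  assumes k: "k \<notin> L" and z: "z \<notin> L"
  shows "lattice_sigma L (z + k) * lattice_sigma L (z - k)
    = - (lattice_sigma L z ^ 2 * lattice_sigma L k ^ 2 * (lattice_wp L z - lattice_wp L k))"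
  unfolding lattice_sigma_add[OF z k] by (simp add: algebra_simps)

text \<open>sigma(z + 2k) sigma(z - 2k) is computed in two ways: through the translations at z, z +
  k and z - k, and by the addition formula with 2k and the duplication of sigma(2k).\<close>

lemma wp_translates_product:
  assumes k: "k \<notin> L" "2 * k \<notin> L" and z: "z \<notin> L" "z + k \<notin> L" "z - k \<notin> L"
  defines "D \<equiv> \<lambda>z. lattice_wp L z - lattice_wp L k"
  shows "D (z - k) * D z * (D z * D (z + k)) = deriv (lattice_wp L) k ^ 2 * (lattice_wp L (2 * k) - lattice_wp L k)
     - deriv (lattice_wp L) k ^ 2 * D z"
proof -
  define s where "s = lattice_sigma L"
  define M where "M = deriv (lattice_wp L) k"
  have nz: "s z \<noteq> 0" "s k \<noteq> 0" using sigma_nonzero z k by (auto simp: s_def)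
  have 0: "s (z + k) * s (z - k) = - (s z ^ 2 * s k ^ 2 * D z)" using sigma_translates[OF k(1) z(1)] by (simp add: s_def D_def)
  have a: "z + k + k = z + 2 * k" "z + k - k = z" "z - k + k = z" "z - k - k = z - 2 * k" by simp_all
  have 1: "s (z + 2 * k) * s z = - (s (z + k) ^ 2 * s k ^ 2 * D (z + k))"
    using sigma_translates[OF k(1) z(2)] unfolding a by (simp add: s_def D_def)
  have 2: "s z * s (z - 2 * k) = - (s (z - k) ^ 2 * s k ^ 2 * D (z - k))"
    using sigma_translates[OF k(1) z(3)] unfolding a by (simp add: s_def D_def)
  have "s (z + 2 * k) * s (z - 2 * k) = s z ^ 2 * s (2 * k) ^ 2 * (lattice_wp L (2 * k) - lattice_wp L z)"
    using lattice_sigma_add[OF z(1) k(2)] by (simp add: s_def)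
  also have "s (2 * k) = - M * s k ^ 4" using lattice_sigma_double[OF k(1)] by (simp add: s_def M_def)
  finally have 3: "s (z + 2 * k) * s (z - 2 * k) = s z ^ 2 * (- M * s k ^ 4) ^ 2 * (lattice_wp L (2 * k) - lattice_wp L z)" .
  have "s z ^ 4 * s k ^ 8 * (D (z - k) * D z * (D z * D (z + k))) = (- (s z ^ 2 * s k ^ 2 * D z)) ^ 2 * s k ^ 4 * D (z + k) * D (z - k)"
    by (simp add: power_mult_distrib flip: power_mult power_add) (simp add: power2_eq_square algebra_simps power_numeral_reduce)
  also have "\<dots> = (- (s (z + k) ^ 2 * s k ^ 2 * D (z + k))) * (- (s (z - k) ^ 2 * s k ^ 2 * D (z - k)))"
    unfolding 0[symmetric] by (simp add: power2_eq_square power4_eq_xxxx algebra_simps)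
  also have "\<dots> = s (z + 2 * k) * s (z - 2 * k) * s z ^ 2" unfolding 1[symmetric] 2[symmetric] by (simp add: power2_eq_square)
  also have "\<dots> = s z ^ 4 * s k ^ 8 * (M ^ 2 * (lattice_wp L (2 * k) - lattice_wp L z))"
    unfolding 3 by (simp add: power_mult_distrib flip: power_mult)
  finally have "D (z - k) * D z * (D z * D (z + k)) = M ^ 2 * (lattice_wp L (2 * k) - lattice_wp L z)" using nz by simp
  then show ?thesis by (simp add: M_def D_def algebra_simps)
qed

text \<open>Only six consecutive terms have to be nonzero. When z0 or J moves, one neighbourhood
  keeps only finitely many terms away from 0, so this local form is what can be
  differentiated.\<close>

lemma somos5_solution:
  assumes k: "k \<notin> L" and M: "deriv (lattice_wp L) k \<noteq> 0" and A: "Ap \<noteq> 0" "Am \<noteq> 0" "Bm \<noteq> 0"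
    and x: "\<And>m. x m = somos_prefactor Ap Am Bm m (lattice_sigma L k) * lattice_sigma L (of_int m * k + z0)"
    and nz: "\<And>m. m \<in> {n..n+5} \<Longrightarrow> of_int m * k + z0 \<notin> L"
    and J: "J = deriv (deriv (lattice_wp L)) k"
    and \<alpha>: "\<alpha> = 3 * lattice_wp L k * deriv (lattice_wp L) k ^ 2 - J ^ 2 / 4"
    and \<beta>: "\<beta> = deriv (lattice_wp L) k ^ 4 - \<alpha> * J"
  defines "q \<equiv> \<lambda>m. x m * x (m + 3) / (x (m + 1) * x (m + 2))"
  shows "x n * x (n + 5) = \<alpha> * x (n + 1) * x (n + 4) + \<beta> * x (n + 2) * x (n + 3)"
    "q n * q (n + 1) * (q n + q (n + 1)) - J * q n * q (n + 1) + \<alpha> * (q n + q (n + 1)) + \<beta> = 0"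
proof -
  define D where "D = (\<lambda>z. lattice_wp L z - lattice_wp L k)"
  define s where "s = lattice_sigma L"
  define z where "z = of_int n * k + z0"
  have k2: "2 * k \<notin> L" using M wp'_eq_0_iff[OF k] by simp
  have zs: "z \<notin> L" "z + k \<notin> L" "z + 2 * k \<notin> L" "z + 3 * k \<notin> L" "z + 4 * k \<notin> L" "z + 5 * k \<notin> L"
    using nz[of n] nz[of "n + 1"] nz[of "n + 2"] nz[of "n + 3"] nz[of "n + 4"] nz[of "n + 5"]
    by (simp_all add: z_def algebra_simps)
  have s0: "s k \<noteq> 0" using sigma_nonzero[OF k] by (simp add: s_def)
  have xn: "x (n + i) = somos_prefactor Ap Am Bm (n + i) (s k) * s (z + of_int i * k)" for i
    unfolding x s_def z_def by (simp add: algebra_simps)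
  have x0: "x (n + i) \<noteq> 0" if "z + of_int i * k \<notin> L" for i
    using sigma_nonzero[OF that] somos_prefactor_nonzero[OF A s0] by (simp add: xn s_def)
  have X: "x n \<noteq> 0" "x (n + 1) \<noteq> 0" "x (n + 2) \<noteq> 0" "x (n + 3) \<noteq> 0" "x (n + 4) \<noteq> 0" "x (n + 5) \<noteq> 0"
    using x0[of 0] x0[of 1] x0[of 2] x0[of 3] x0[of 4] x0[of 5] zs by simp_all
  \<comment> \<open>Two sigma translations produce the factor s(k)^4, which
    \<open>somos_prefactor_quotient\<close> absorbs exactly.\<close>
  have step: "x m * x (m + 3) = D (y + k) * D (y + 2 * k) * (x (m + 1) * x (m + 2))"
    if y: "y = of_int m * k + z0" "y + k \<notin> L" "y + 2 * k \<notin> L" for m y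
  proof -
    define P where "P = (\<lambda>m. somos_prefactor Ap Am Bm m (s k))"
    have xm: "x m = P m * s y" "x (m + 1) = P (m + 1) * s (y + k)" "x (m + 2) = P (m + 2) * s (y + 2 * k)"
      "x (m + 3) = P (m + 3) * s (y + 3 * k)"
      unfolding x P_def s_def y(1) by (simp_all add: algebra_simps)
    have nz: "s (y + k) \<noteq> 0" "s (y + 2 * k) \<noteq> 0" using y sigma_nonzero by (auto simp: s_def)
    have a: "y + k + k = y + 2 * k" "y + k - k = y" "y + 2 * k + k = y + 3 * k" "y + 2 * k - k = y + k" by simp_all
    have 1: "s (y + 2 * k) * s y = - (s (y + k) ^ 2 * s k ^ 2 * D (y + k))"
      using sigma_translates[OF k y(2)] unfolding a by (simp add: s_def D_def)
    have 2: "s (y + 3 * k) * s (y + k) = - (s (y + 2 * k) ^ 2 * s k ^ 2 * D (y + 2 * k))"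
      using sigma_translates[OF k y(3)] unfolding a by (simp add: s_def D_def)
    have "(s y * s (y + 3 * k)) * (s (y + k) * s (y + 2 * k)) = (s (y + 2 * k) * s y) * (s (y + 3 * k) * s (y + k))"
      by (simp only: mult_ac)
    also have "\<dots> = s k ^ 4 * D (y + k) * D (y + 2 * k) * s (y + k) * s (y + 2 * k) * (s (y + k) * s (y + 2 * k))"
      unfolding 1 2 by (simp add: power2_eq_square power4_eq_xxxx)
    finally have "s y * s (y + 3 * k) = s k ^ 4 * D (y + k) * D (y + 2 * k) * s (y + k) * s (y + 2 * k)" using nz by simp
    then have "x m * x (m + 3) = (P m * P (m + 3) * s k ^ 4) * (D (y + k) * D (y + 2 * k) * s (y + k) * s (y + 2 * k))"
      unfolding xm by (simp add: mult_ac)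
    also have "P m * P (m + 3) * s k ^ 4 = P (m + 1) * P (m + 2)"
      unfolding P_def by (rule somos_prefactor_quotient[OF A s0])
    finally show ?thesis unfolding xm by (simp add: mult_ac)
  qed
  have t0: "x n * x (n + 3) = D (z + k) * D (z + 2 * k) * (x (n + 1) * x (n + 2))"
    by (rule step) (use zs in \<open>simp_all add: z_def\<close>)
  have t1: "x (n + 1) * x (n + 4) = D (z + 2 * k) * D (z + 3 * k) * (x (n + 2) * x (n + 3))"
    using step[of "z + k" "n + 1"] zs by (simp add: z_def algebra_simps)
  have t2: "x (n + 2) * x (n + 5) = D (z + 3 * k) * D (z + 4 * k) * (x (n + 3) * x (n + 4))"
    using step[of "z + 2 * k" "n + 2"] zs by (simp add: z_def algebra_simps)
  define f where "f = D (z + k) * D (z + 2 * k)"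
  define g where "g = D (z + 2 * k) * D (z + 3 * k)"
  define h where "h = D (z + 3 * k) * D (z + 4 * k)"
  have n1: "n + 1 + 1 = n + 2" "n + 1 + 2 = n + 3" "n + 1 + 3 = n + 4" by simp_all
  have qq: "q n = f" "q (n + 1) = g" using X t0 t1 unfolding q_def n1 f_def g_def by simp_all
  have a1: "z + 2 * k + k = z + 3 * k" "z + 2 * k - k = z + k" and a2: "z + 3 * k + k = z + 4 * k" "z + 3 * k - k = z + 2 * k"
    by (simp_all add: algebra_simps)
  define M where "M = deriv (lattice_wp L) k"
  have M0: "M \<noteq> 0" using M by (simp add: M_def)
  have w2: "lattice_wp L (2 * k) - lattice_wp L k = - 3 * lattice_wp L k + J ^ 2 / (4 * M ^ 2)"
    using lattice_wp_double[OF k k2] by (simp add: wp_slope_def J M_def power_divide)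
  \<comment> \<open>The value wp(2k) - wp(k) occurring in the product formula is where \<alpha>
    comes from.\<close>
  have "M ^ 2 * (lattice_wp L (2 * k) - lattice_wp L k) = - \<alpha>"
    unfolding w2 ring_distribs using M0 by (simp add: \<alpha> M_def[symmetric])
  note al = this[unfolded M_def]
  have fg: "f * g + \<alpha> = - (M ^ 2) * D (z + 2 * k)"
    using wp_translates_product[OF k k2, of "z + 2 * k"] zs unfolding a1 al by (simp add: f_def g_def D_def M_def)
  have gh: "g * h + \<alpha> = - (M ^ 2) * D (z + 3 * k)"
    using wp_translates_product[OF k k2, of "z + 3 * k"] zs unfolding a2 al by (simp add: h_def g_def D_def M_def)
  have su: "D (z + 2 * k) \<noteq> 0" "(f + g - J) * D (z + 2 * k) = M ^ 2"
    using wp_translates_sum[OF k, of "z + 2 * k"] zs unfolding a1 by (simp_all add: f_def g_def D_def M_def J)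
  have su': "D (z + 3 * k) \<noteq> 0"
    using wp_translates_sum(1)[OF k, of "z + 3 * k"] zs unfolding a2 by (simp add: D_def)
  have g0: "g \<noteq> 0" using su(1) su' by (simp add: g_def)
  note R = somos5_ratio_relations[OF fg gh su(2) g_def su(1) g0 \<beta>[folded M_def]]
  show "q n * q (n + 1) * (q n + q (n + 1)) - J * q n * q (n + 1) + \<alpha> * (q n + q (n + 1)) + \<beta> = 0"
    unfolding qq by (rule R(2))
  have "(x n * x (n + 5)) * (x (n + 1) * x (n + 2) * x (n + 3) * x (n + 4))
    = (x n * x (n + 3)) * (x (n + 1) * x (n + 4)) * (x (n + 2) * x (n + 5))" by (simp only: mult_ac)
  also have "\<dots> = (f * g * h) * (x (n + 2) * x (n + 3)) * (x (n + 1) * x (n + 2) * x (n + 3) * x (n + 4))"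
    unfolding t0 t1 t2 f_def g_def h_def by (simp only: mult_ac)
  finally have "x n * x (n + 5) = (f * g * h) * (x (n + 2) * x (n + 3))" using X by simp
  also have "\<dots> = \<alpha> * (g * (x (n + 2) * x (n + 3))) + \<beta> * (x (n + 2) * x (n + 3))" unfolding R(1) by (simp add: algebra_simps)
  also have "g * (x (n + 2) * x (n + 3)) = x (n + 1) * x (n + 4)" unfolding t1 g_def ..
  finally show "x n * x (n + 5) = \<alpha> * x (n + 1) * x (n + 4) + \<beta> * x (n + 2) * x (n + 3)" by (simp only: mult.assoc)
qed

end

section \<open>Shadows of one-parameter families\<close>

text \<open>The shadow equation is the linearised recurrence. The neighbourhood of t0 may depend on
  n, since each n is differentiated separately.\<close>

lemma shadow_of_family:
  fixes X :: "complex \<Rightarrow> int \<Rightarrow> complex"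
  assumes d: "\<And>n. ((\<lambda>t. X t n) has_field_derivative y n) (at t0)"
    and r: "\<And>n. \<forall>\<^sub>F t in nhds t0. X t n * X t (n + 5) = \<alpha> * X t (n + 1) * X t (n + 4) + \<beta> * X t (n + 2) * X t (n + 3)"
  shows "somos5_shadow \<alpha> \<beta> (X t0) y"
  unfolding somos5_shadow_def
proof
  fix n
  have p: "((\<lambda>t. X t i * X t j) has_field_derivative X t0 i * y j + y i * X t0 j) (at t0)" for i j
    using DERIV_mult[OF d[of i] d[of j]] by (simp add: algebra_simps)
  define F where "F = (\<lambda>t. X t n * X t (n + 5) - \<alpha> * (X t (n + 1) * X t (n + 4)) - \<beta> * (X t (n + 2) * X t (n + 3)))"
  have "(F has_field_derivative (X t0 n * y (n + 5) + y n * X t0 (n + 5)) - \<alpha> * (X t0 (n + 1) * y (n + 4) + y (n + 1) * X t0 (n + 4))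
     - \<beta> * (X t0 (n + 2) * y (n + 3) + y (n + 2) * X t0 (n + 3))) (at t0)"
    unfolding F_def by (intro DERIV_diff DERIV_cmult p)
  moreover have "\<forall>\<^sub>F t in nhds t0. F t = 0"
    using r[of n] by (rule eventually_mono) (simp add: F_def)
  then have "(F has_field_derivative 0) (at t0)" using DERIV_cong_ev[of t0 t0 F "\<lambda>_. 0" 0 0] by simp
  ultimately show "X t0 n * y (n + 5) + y n * X t0 (n + 5) - \<alpha> * (X t0 (n + 1) * y (n + 4) + y (n + 1) * X t0 (n + 4))
     - \<beta> * (X t0 (n + 2) * y (n + 3) + y (n + 2) * X t0 (n + 3)) = 0"
    by (rule DERIV_unique)
qed

text \<open>The logarithmic derivative of the ratio q_n when x_n changes by r_n x_n. It kills both
  r_n = n and functions of the parity of n.\<close>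

definition ratio_variation :: "(int \<Rightarrow> complex) \<Rightarrow> int \<Rightarrow> complex" where
  "ratio_variation r n = r n + r (n + 3) - r (n + 1) - r (n + 2)"

text \<open>The derivative of the first integral in the direction \<open>y = r x\<close>; \<open>f, g\<close> are consecutive ratios of \<open>x\<close>.\<close>

definition integral_variation :: "complex \<Rightarrow> complex \<Rightarrow> (int \<Rightarrow> complex) \<Rightarrow> (int \<Rightarrow> complex) \<Rightarrow> int \<Rightarrow> complex" where
  "integral_variation \<alpha> J q r n =
     q n * (2 * q n * q (n + 1) + q (n + 1) ^ 2 - J * q (n + 1) + \<alpha>) * ratio_variation r n
   + q (n + 1) * (q n ^ 2 + 2 * q n * q (n + 1) - J * q n + \<alpha>) * ratio_variation r (n + 1)"

text \<open>Implicit differentiation of the first integral with denominators cleared: the explicit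
  occurrence of J contributes the right side.\<close>

lemma integral_variation_of_family:
  fixes X :: "complex \<Rightarrow> int \<Rightarrow> complex"
  assumes d: "\<And>n. ((\<lambda>t. X t n) has_field_derivative r n * X t0 n) (at t0)" and nz: "\<And>n. X t0 n \<noteq> 0"
    and J: "(J has_field_derivative J') (at t0)"
    and q: "\<And>t n. q t n = X t n * X t (n + 3) / (X t (n + 1) * X t (n + 2))"
    and F: "\<forall>\<^sub>F t in nhds t0. q t n * q t (n + 1) * (q t n + q t (n + 1)) - J t * q t n * q t (n + 1) + \<alpha> * (q t n + q t (n + 1)) + \<beta> = 0"
  shows "integral_variation \<alpha> (J t0) (q t0) r n = J' * q t0 n * q t0 (n + 1)"
proof -
  have dq: "((\<lambda>t. q t m) has_field_derivative q t0 m * ratio_variation r m) (at t0)" for m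
  proof -
    have n: "((\<lambda>t. X t m * X t (m + 3)) has_field_derivative X t0 m * X t0 (m + 3) * (r m + r (m + 3))) (at t0)"
      using DERIV_mult[OF d[of m] d[of "m + 3"]] by (simp add: algebra_simps)
    have e: "((\<lambda>t. X t (m + 1) * X t (m + 2)) has_field_derivative X t0 (m + 1) * X t0 (m + 2) * (r (m + 1) + r (m + 2))) (at t0)"
      using DERIV_mult[OF d[of "m + 1"] d[of "m + 2"]] by (simp add: algebra_simps)
    have b: "X t0 (m + 1) * X t0 (m + 2) \<noteq> 0" using nz by simp
    have "(a * c * b - a * (b * e)) / (b * b) = a / b * (c - e)" if "b \<noteq> 0" for a b c e :: complex
      using that by (simp add: diff_divide_distrib ring_distribs)
    from DERIV_divide[OF n e b, unfolded this[OF b]]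
    show ?thesis by (simp add: q[abs_def] ratio_variation_def diff_diff_eq)
  qed
  define G where "G = (\<lambda>t. q t n * q t (n + 1) * (q t n + q t (n + 1)) - J t * (q t n * q t (n + 1)) + \<alpha> * (q t n + q t (n + 1)) + \<beta>)"
  have p: "((\<lambda>t. q t n * q t (n + 1)) has_field_derivative q t0 n * q t0 (n + 1) * (ratio_variation r n + ratio_variation r (n + 1))) (at t0)"
    using DERIV_mult[OF dq[of n] dq[of "n + 1"]] by (simp add: algebra_simps)
  have s: "((\<lambda>t. q t n + q t (n + 1)) has_field_derivative q t0 n * ratio_variation r n + q t0 (n + 1) * ratio_variation r (n + 1)) (at t0)"
    by (rule DERIV_add[OF dq dq])
  note G1 = DERIV_add[OF DERIV_add[OF DERIV_diff[OF DERIV_mult[OF p s] DERIV_mult[OF J p]] DERIV_cmult[OF s, of \<alpha>]] DERIV_const[of \<beta>], folded G_def]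
  have "\<forall>\<^sub>F t in nhds t0. G t = 0"
    using F by (rule eventually_mono) (simp add: G_def mult.assoc)
  then have "(G has_field_derivative 0) (at t0)" using DERIV_cong_ev[of t0 t0 G "\<lambda>_. 0" 0 0] by simp
  from DERIV_unique[OF G1 this] show ?thesis
    unfolding integral_variation_def by algebra
qed

lemma lin_indep_seqsI:
  assumes "\<And>c. (\<And>n. (\<Sum>i<length ys. c i * (ys ! i) n) = 0) \<Longrightarrow> \<forall>i<length ys. c i = 0"
  shows "lin_indep_seqs ys"
proof -
  interpret module "\<lambda>(c :: complex) (y :: int \<Rightarrow> complex) n. c * y n"
    by unfold_locales (auto simp: fun_eq_iff algebra_simps)
  have dist: "distinct ys"
    unfolding distinct_conv_nth
  proof (intro allI impI notI)
    fix i j assume ij: "i < length ys" "j < length ys" "i \<noteq> j" "ys ! i = ys ! j"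
    define c :: "nat \<Rightarrow> complex" where "c = (\<lambda>k. (if k = i then 1 else 0) - (if k = j then 1 else 0))"
    have "(\<Sum>k<length ys. c k * (ys ! k) n) = (ys ! i) n - (ys ! j) n" for n
      using ij(1,2) by (simp add: c_def left_diff_distrib sum_subtractf if_distrib[where f = "\<lambda>x. x * _"] sum.delta cong: if_cong)
    then have "\<forall>k<length ys. c k = 0" using ij(4) by (intro assms) simp
    then have "c i = 0" using ij(1) by blast
    then show False using ij(3) by (simp add: c_def)
  qed
  have "\<not> dependent (set ys)"
  proof
    assume "dependent (set ys)"
    then obtain u v where u: "v \<in> set ys" "u v \<noteq> 0" "(\<Sum>v\<in>set ys. (\<lambda>n. u v * v n)) = 0"
      using dependent_finite[of "set ys"] by auto
    have app: "(\<Sum>v\<in>S. (\<lambda>n. u v * v n)) m = (\<Sum>v\<in>S. u v * v m)" if "finite S" for S m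
      using that by (induction S rule: finite_induct) auto
    have "(\<Sum>i<length ys. u (ys ! i) * (ys ! i) n) = 0" for n
    proof -
      have "(\<Sum>i<length ys. u (ys ! i) * (ys ! i) n) = (\<Sum>v\<in>set ys. u v * v n)"
        by (rule sum.reindex_bij_betw[OF bij_betw_nth[OF dist refl refl], of "\<lambda>v. u v * v n"])
      also have "\<dots> = 0" using app[of "set ys" n] u(3) by simp
      finally show ?thesis .
    qed
    then have "\<forall>i<length ys. u (ys ! i) = 0" by (rule assms)
    then show False using u(1,2) by (metis in_set_conv_nth)
  qed
  then show ?thesis using dist by (simp add: lin_indep_seqs_def)
qed

text \<open>The zeta addition formula is used with k as base point and u_{n+1} as shift. Its
  numerator is then the nonzero constant wp'(k), so a constant difference determines
  wp(u_{n+1}).\<close>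

lemma (in complex_lattice) zeta_second_difference_not_constant:
  assumes k: "k \<notin> L" "2 * k \<notin> L" and z: "\<And>n::int. of_int n * k + z0 \<notin> L"
    and c: "\<And>n::int. lattice_zeta L (of_int (n + 2) * k + z0) - lattice_zeta L (of_int n * k + z0) = c"
  shows False
proof -
  define u where "u = (\<lambda>n::int. of_int n * k + z0)"
  have up: "k + u (n + 1) = u (n + 2)" "k - u (n + 1) = - u n" for n by (simp_all add: u_def algebra_simps)
  have M: "deriv (lattice_wp L) k \<noteq> 0" using wp'_eq_0_iff[OF k(1)] k(2) by simp
  have e: "lattice_wp L k - lattice_wp L (u (n + 1)) = deriv (lattice_wp L) k / (c - 2 * lattice_zeta L k)" for n
  proof -
    have a: "k + u (n + 1) \<notin> L" "k - u (n + 1) \<notin> L" unfolding up uminus_mem_iff unfolding u_def using z[of "n + 2"] z[of n] by blast+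
    have b: "u (n + 1) \<notin> L" unfolding u_def by (rule z)
    note h = lattice_zeta_add[OF k(1) b a]
    have c': "lattice_zeta L (u (n + 2)) - lattice_zeta L (u n) = c" using c[of n] by (simp only: u_def)
    have "lattice_wp L k - lattice_wp L (u (n + 1)) \<noteq> 0" using h(1) by simp
    moreover have "c - 2 * lattice_zeta L k = deriv (lattice_wp L) k / (lattice_wp L k - lattice_wp L (u (n + 1)))"
      using h(2) c' unfolding up lattice_zeta_uminus by simp
    ultimately show ?thesis using M by simp
  qed
  have w: "lattice_wp L (u (n + 1)) = lattice_wp L (u (m + 1))" for n m using e[of n] e[of m] by (metis diff_left_imp_eq)
  have z': "u n \<notin> L" for n unfolding u_def by (rule z)
  have s: "u (n + 1) + u (n + 2) \<in> L" for n
  proof -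
    \<comment> \<open>Of the two ways for wp-values to agree, the difference is -k, not a period, so
      the sum must be one.\<close>
    have "u (n + 1) + u (n + 2) \<in> L \<or> u (n + 1) - u (n + 2) \<in> L"
      using w[of n "n + 1"] by (intro lattice_wp_eqD z') (simp only: add.assoc one_add_one)
    moreover have "u (n + 1) - u (n + 2) = - k" by (simp add: u_def algebra_simps)
    ultimately show ?thesis using k(1) uminus_mem[of "- k"] by auto
  qed
  have "(u 2 + u 3) - (u 1 + u 2) \<in> L" using s[of 0] s[of 1] by (intro diff_mem) simp_all
  moreover have "(u 2 + u 3) - (u 1 + u 2) = 2 * k" by (simp add: u_def algebra_simps)
  ultimately show False using k(2) by simp
qed

section \<open>Variation of the parameters\<close>

lemma cdiff_affine:
  assumes "cdiff F (c * fst p + d, snd p)" shows "cdiff (\<lambda>p. F (c * fst p + d, snd p)) p"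
proof -
  obtain A B C where D: "(F has_derivative (\<lambda>h. A * fst h + B * fst (snd h) + C * snd (snd h))) (at (c * fst p + d, snd p))"
    using assms unfolding cdiff_def by blast
  have "((\<lambda>p::complex \<times> complex \<times> complex. (c * fst p + d, snd p)) has_derivative (\<lambda>h. (c * fst h, snd h))) (at p)"
    by (auto intro!: derivative_eq_intros)
  from has_derivative_compose[OF this D] show ?thesis
    by (rule cdiffI[where A = "A * c" and B = B and C = C]) simp
qed

lemma cdiff_somos5_sol:
  assumes d: "a ^ 3 - 27 * b ^ 2 \<noteq> 0" and k: "k \<notin> period_lattice a b" "of_int n * k + z0 \<notin> period_lattice a b"
    and B: "Bm \<noteq> 0"
  shows "cdiff (\<lambda>p. somos5_sol Ap Am Bm z0 n (fst p) (fst (snd p)) (snd (snd p))) (k, a, b)"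
proof -
  interpret l: complex_lattice "period_lattice a b" by (rule period_lattice_props(1)[OF d])
  have s: "sig3 (k, a, b) \<noteq> 0" using k(1) by (simp add: sig3_def wsigma_eq l.sigma_nonzero)
  have "(somos_prefactor Ap Am Bm n has_field_derivative deriv (somos_prefactor Ap Am Bm n) (sig3 (k, a, b))) (at (sig3 (k, a, b)))"
    unfolding DERIV_deriv_iff_field_differentiable by (rule somos_prefactor_differentiable[OF s B])
  then have "cdiff (\<lambda>p. somos_prefactor Ap Am Bm n (sig3 p)) (k, a, b)"
    by (rule cdiff_compose[OF _ cdiff_sigma[OF d k(1)]])
  moreover have "cdiff (\<lambda>p. sig3 (of_int n * fst p + z0, snd p)) (k, a, b)"
    by (rule cdiff_affine) (use cdiff_sigma[OF d k(2)] in simp)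
  ultimately have "cdiff (\<lambda>p. somos_prefactor Ap Am Bm n (sig3 p) * sig3 (of_int n * fst p + z0, snd p)) (k, a, b)"
    by (rule cdiff_mult)
  then show ?thesis unfolding somos5_sol_eq by (simp add: sig3_def)
qed

lemma eventually_nonzero_DERIV:
  fixes f :: "complex \<Rightarrow> complex"
  assumes "(f has_field_derivative d) (at t0)" "f t0 \<noteq> 0" shows "\<forall>\<^sub>F t in nhds t0. f t \<noteq> 0"
proof -
  have "(f \<longlongrightarrow> f t0) (nhds t0)"
    using DERIV_isCont[OF assms(1)] unfolding continuous_at by (rule tendsto_at_iff_tendsto_nhds[THEN iffD1])
  then show ?thesis by (rule tendsto_imp_eventually_ne[OF _ assms(2)])
qed

locale somos5_family =
  fixes \<alpha> \<beta> J0 Ap Am Bm z0 :: complex and mut kap :: "complex \<Rightarrow> complex"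
  assumes mu_nz: "\<beta> + \<alpha> * J0 \<noteq> 0" and mut_analytic: "mut analytic_on {J0}"
    and mut4: "\<forall>\<^sub>F J in nhds J0. mut J ^ 4 = \<beta> + \<alpha> * J"
    and nonsing: "nonsingular_cubic (somos5_g2 \<alpha> mut J0) (somos5_g3 \<alpha> mut J0)"
    and kap_analytic: "kap analytic_on {J0}"
    and kap_ev: "\<forall>\<^sub>F J in nhds J0.
           kap J \<notin> period_lattice (somos5_g2 \<alpha> mut J) (somos5_g3 \<alpha> mut J) \<and>
           wp (somos5_g2 \<alpha> mut J) (somos5_g3 \<alpha> mut J) (kap J) = somos5_lambda \<alpha> mut J \<and>
           deriv (wp (somos5_g2 \<alpha> mut J) (somos5_g3 \<alpha> mut J)) (kap J) = mut J"
    and ApAmBm: "Ap \<noteq> 0" "Am \<noteq> 0" "Bm \<noteq> 0"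
    and nonzero: "\<And>n. somos5_sol Ap Am Bm z0 n (kap J0) (somos5_g2 \<alpha> mut J0) (somos5_g3 \<alpha> mut J0) \<noteq> 0"
begin

abbreviation "g2 \<equiv> somos5_g2 \<alpha> mut"
abbreviation "g3 \<equiv> somos5_g3 \<alpha> mut"
abbreviation "lattice_at J \<equiv> period_lattice (g2 J) (g3 J)"
abbreviation "sol z J n \<equiv> somos5_sol Ap Am Bm z n (kap J) (g2 J) (g3 J)"

text \<open>The conditions at a single J under which the analytic formula obeys the recurrence with
  first integral J; they persist near \<open>J0\<close>.\<close>

definition admissible :: "complex \<Rightarrow> bool" where
  "admissible J \<longleftrightarrow> g2 J ^ 3 - 27 * g3 J ^ 2 \<noteq> 0 \<and> mut J \<noteq> 0 \<and> mut J ^ 4 = \<beta> + \<alpha> * J \<and> kap J \<notin> lattice_at J \<and>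
    wp (g2 J) (g3 J) (kap J) = somos5_lambda \<alpha> mut J \<and> deriv (wp (g2 J) (g3 J)) (kap J) = mut J"

lemma mut_J0: "mut J0 \<noteq> 0"
  using eventually_nhds_x_imp_x[OF mut4] mu_nz by auto

lemma DERIV_mut: "(mut has_field_derivative deriv mut J0) (at J0)"
  and DERIV_kap: "(kap has_field_derivative deriv kap J0) (at J0)"
  unfolding DERIV_deriv_iff_field_differentiable
  using mut_analytic kap_analytic by (auto intro: analytic_on_imp_differentiable_at)

lemma differentiable_g2: "g2 field_differentiable at J0" and differentiable_g3: "g3 field_differentiable at J0"
proof -
  have m: "mut field_differentiable at J0" using DERIV_mut field_differentiable_def by blast
  have "(\<lambda>J. 1 / (3 * (mut J)\<^sup>2) * (J\<^sup>2 / 4 + \<alpha>)) field_differentiable at J0"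
    using mut_J0 by (intro derivative_intros m) auto
  then have l: "somos5_lambda \<alpha> mut field_differentiable at J0" by (simp add: somos5_lambda_def[abs_def])
  have "(\<lambda>J. 12 * (somos5_lambda \<alpha> mut J)\<^sup>2 - 2 * J) field_differentiable at J0"
    by (intro derivative_intros l)
  then show g: "g2 field_differentiable at J0" by (simp add: somos5_g2_def[abs_def])
  have "(\<lambda>J. 4 * somos5_lambda \<alpha> mut J ^ 3 - g2 J * somos5_lambda \<alpha> mut J - (mut J)\<^sup>2) field_differentiable at J0"
    by (intro derivative_intros l g m)
  then show "g3 field_differentiable at J0" by (simp add: somos5_g3_def[abs_def])
qed

lemma DERIV_g2: "(g2 has_field_derivative deriv g2 J0) (at J0)" and DERIV_g3: "(g3 has_field_derivative deriv g3 J0) (at J0)"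
  unfolding DERIV_deriv_iff_field_differentiable by (rule differentiable_g2 differentiable_g3)+

lemma eventually_admissible: "\<forall>\<^sub>F J in nhds J0. admissible J"
proof -
  have "((\<lambda>J. g2 J ^ 3 - 27 * g3 J ^ 2) has_field_derivative
      of_nat 3 * (deriv g2 J0 * g2 J0 ^ (3 - Suc 0)) - 27 * (of_nat 2 * (deriv g3 J0 * g3 J0 ^ (2 - Suc 0)))) (at J0)"
    by (intro DERIV_diff DERIV_cmult DERIV_power DERIV_g2 DERIV_g3)
  then have "\<forall>\<^sub>F J in nhds J0. g2 J ^ 3 - 27 * g3 J ^ 2 \<noteq> 0"
    by (rule eventually_nonzero_DERIV) (rule nonsingular_cubic_discriminant[OF nonsing])
  with eventually_nonzero_DERIV[OF DERIV_mut mut_J0] mut4 kap_ev show ?thesis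
    by eventually_elim (simp add: admissible_def)
qed

lemma admissible_J0: "admissible J0"
  by (rule eventually_nhds_x_imp_x[OF eventually_admissible])

text \<open>Inverts the parametrisation: wp'' = 6 wp^2 - g2/2 at \<kappa> turns the definition of g2
  into J = wp''(\<kappa>), and those of lambda and \<open>mut\<close> give \<alpha> and
  \<beta>.\<close>

lemma admissible_relations:
  assumes J: "admissible J"
  shows "complex_lattice (lattice_at J)" "deriv (lattice_wp (lattice_at J)) (kap J) \<noteq> 0"
    "J = deriv (deriv (lattice_wp (lattice_at J))) (kap J)"
    "\<alpha> = 3 * lattice_wp (lattice_at J) (kap J) * deriv (lattice_wp (lattice_at J)) (kap J) ^ 2 - J ^ 2 / 4"
    "\<beta> = deriv (lattice_wp (lattice_at J)) (kap J) ^ 4 - \<alpha> * J"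
proof -
  note j = J[unfolded admissible_def wp_eq]
  have d: "g2 J ^ 3 - 27 * g3 J ^ 2 \<noteq> 0" and m: "mut J \<noteq> 0" "mut J ^ 4 = \<beta> + \<alpha> * J" and k: "kap J \<notin> lattice_at J"
    and w: "lattice_wp (lattice_at J) (kap J) = somos5_lambda \<alpha> mut J" "deriv (lattice_wp (lattice_at J)) (kap J) = mut J"
    using j by blast+
  show l: "complex_lattice (lattice_at J)" by (rule period_lattice_props(1)[OF d])
  show "deriv (lattice_wp (lattice_at J)) (kap J) \<noteq> 0" using m w by simp
  have g: "6 * somos5_lambda \<alpha> mut J ^ 2 - g2 J / 2 = J" by (simp add: somos5_g2_def diff_divide_distrib)
  show "J = deriv (deriv (lattice_wp (lattice_at J))) (kap J)"
    using complex_lattice.wp_ode2[OF l k] unfolding period_lattice_props(2)[OF d] w by (simp add: g)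
  have "3 * somos5_lambda \<alpha> mut J * mut J ^ 2 = J ^ 2 / 4 + \<alpha>" using m by (simp add: somos5_lambda_def)
  then show "\<alpha> = 3 * lattice_wp (lattice_at J) (kap J) * deriv (lattice_wp (lattice_at J)) (kap J) ^ 2 - J ^ 2 / 4"
    unfolding w by simp
  show "\<beta> = deriv (lattice_wp (lattice_at J)) (kap J) ^ 4 - \<alpha> * J" unfolding w m(2) by simp
qed

lemma sol_nonzero_iff:
  assumes J: "admissible J"
  shows "sol z J n \<noteq> 0 \<longleftrightarrow> of_int n * kap J + z \<notin> lattice_at J"
proof -
  interpret l: complex_lattice "lattice_at J" by (rule admissible_relations(1)[OF J])
  have "lattice_sigma (lattice_at J) (kap J) \<noteq> 0" using J by (simp add: admissible_def l.sigma_nonzero)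
  then show ?thesis using ApAmBm by (simp add: somos5_sol_eq wsigma_eq somos_prefactor_nonzero l.lattice_sigma_eq_0_iff)
qed

definition sol_ratio :: "complex \<Rightarrow> complex \<Rightarrow> int \<Rightarrow> complex" where
  "sol_ratio z J n = sol z J n * sol z J (n + 3) / (sol z J (n + 1) * sol z J (n + 2))"

lemma sol_relations:
  assumes J: "admissible J" and nz: "\<And>m. m \<in> {n..n+5} \<Longrightarrow> sol z J m \<noteq> 0"
  shows "sol z J n * sol z J (n + 5) = \<alpha> * sol z J (n + 1) * sol z J (n + 4) + \<beta> * sol z J (n + 2) * sol z J (n + 3)"
    "sol_ratio z J n * sol_ratio z J (n + 1) * (sol_ratio z J n + sol_ratio z J (n + 1)) - J * sol_ratio z J n * sol_ratio z J (n + 1)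
       + \<alpha> * (sol_ratio z J n + sol_ratio z J (n + 1)) + \<beta> = 0"
proof -
  have k: "kap J \<notin> lattice_at J" using J by (simp add: admissible_def)
  have m: "of_int m * kap J + z \<notin> lattice_at J" if "m \<in> {n..n+5}" for m using nz[OF that] sol_nonzero_iff[OF J] by simp
  have x: "sol z J m = somos_prefactor Ap Am Bm m (lattice_sigma (lattice_at J) (kap J)) * lattice_sigma (lattice_at J) (of_int m * kap J + z)" for m
    by (simp add: somos5_sol_eq wsigma_eq)
  note r = admissible_relations[OF J]
  note S = complex_lattice.somos5_solution[OF r(1) k r(2) ApAmBm x m r(3-5)]
  show "sol z J n * sol z J (n + 5) = \<alpha> * sol z J (n + 1) * sol z J (n + 4) + \<beta> * sol z J (n + 2) * sol z J (n + 3)"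
    by (rule S(1))
  show "sol_ratio z J n * sol_ratio z J (n + 1) * (sol_ratio z J n + sol_ratio z J (n + 1)) - J * sol_ratio z J n * sol_ratio z J (n + 1)
       + \<alpha> * (sol_ratio z J n + sol_ratio z J (n + 1)) + \<beta> = 0"
    unfolding sol_ratio_def by (rule S(2))
qed

abbreviation "zeta_at n \<equiv> wzeta (g2 J0) (g3 J0) (z0 + of_int n * kap J0)"
abbreviation "dlog n \<equiv> log_deriv (\<lambda>J. sol z0 J n) J0"

lemma DERIV_sol_z0: "((\<lambda>z. sol z J0 n) has_field_derivative zeta_at n * sol z0 J0 n) (at z0)"
proof -
  interpret l: complex_lattice "lattice_at J0" by (rule admissible_relations(1)[OF admissible_J0])
  define w where "w = of_int n * kap J0 + z0"
  have w: "w \<notin> lattice_at J0" using nonzero[of n] sol_nonzero_iff[OF admissible_J0] by (simp add: w_def)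
  have "((\<lambda>z. of_int n * kap J0 + z) has_field_derivative 1) (at z0)" by (auto intro!: derivative_eq_intros)
  from DERIV_chain2[OF l.has_field_derivative_sigma[OF w, unfolded w_def] this]
  have "((\<lambda>z. lattice_sigma (lattice_at J0) (of_int n * kap J0 + z)) has_field_derivative
     lattice_sigma (lattice_at J0) w * lattice_zeta (lattice_at J0) w) (at z0)" by (simp add: w_def)
  from DERIV_cmult[OF this, of "somos_prefactor Ap Am Bm n (wsigma (g2 J0) (g3 J0) (kap J0))"]
  show ?thesis by (simp add: somos5_sol_eq wsigma_eq wzeta_eq w_def algebra_simps)
qed

text \<open>All four derivatives come from one differential in three variables, so the same A, B, C
  serve as partials and in the chain rule.\<close>

lemma sol_partials:
  obtains A B C where
    "((\<lambda>J. sol z0 J n) has_field_derivative A * deriv kap J0 + B * deriv g2 J0 + C * deriv g3 J0) (at J0)"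
    "((\<lambda>k. somos5_sol Ap Am Bm z0 n k (g2 J0) (g3 J0)) has_field_derivative A) (at (kap J0))"
    "((\<lambda>a. somos5_sol Ap Am Bm z0 n (kap J0) a (g3 J0)) has_field_derivative B) (at (g2 J0))"
    "((\<lambda>b. somos5_sol Ap Am Bm z0 n (kap J0) (g2 J0) b) has_field_derivative C) (at (g3 J0))"
proof -
  note J = admissible_J0
  have d: "g2 J0 ^ 3 - 27 * g3 J0 ^ 2 \<noteq> 0" and k: "kap J0 \<notin> lattice_at J0" using J by (simp_all add: admissible_def)
  have n: "of_int n * kap J0 + z0 \<notin> lattice_at J0" using nonzero[of n] sol_nonzero_iff[OF J] by simp
  let ?F = "\<lambda>p. somos5_sol Ap Am Bm z0 n (fst p) (fst (snd p)) (snd (snd p))"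
  obtain A B C where "(?F has_derivative (\<lambda>h. A * fst h + B * fst (snd h) + C * snd (snd h))) (at (kap J0, g2 J0, g3 J0))"
    using cdiff_somos5_sol[OF d k n ApAmBm(3), of Ap Am] unfolding cdiff_def by blast
  note D = DERIV_along_curve[OF this]
  show ?thesis
  proof (rule that)
    show "((\<lambda>J. sol z0 J n) has_field_derivative A * deriv kap J0 + B * deriv g2 J0 + C * deriv g3 J0) (at J0)"
      using D[OF DERIV_kap DERIV_g2 DERIV_g3 refl] by simp
    show "((\<lambda>k. somos5_sol Ap Am Bm z0 n k (g2 J0) (g3 J0)) has_field_derivative A) (at (kap J0))"
      using D[OF DERIV_ident DERIV_const DERIV_const refl] by simp
    show "((\<lambda>a. somos5_sol Ap Am Bm z0 n (kap J0) a (g3 J0)) has_field_derivative B) (at (g2 J0))"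
      using D[OF DERIV_const DERIV_ident DERIV_const refl] by simp
    show "((\<lambda>b. somos5_sol Ap Am Bm z0 n (kap J0) (g2 J0) b) has_field_derivative C) (at (g3 J0))"
      using D[OF DERIV_const DERIV_const DERIV_ident refl] by simp
  qed
qed

lemma DERIV_sol_J: "((\<lambda>J. sol z0 J n) has_field_derivative dlog n * sol z0 J0 n) (at J0)"
proof -
  obtain A B C where "((\<lambda>J. sol z0 J n) has_field_derivative A * deriv kap J0 + B * deriv g2 J0 + C * deriv g3 J0) (at J0)"
    by (rule sol_partials)
  then have "(\<lambda>J. sol z0 J n) field_differentiable at J0" unfolding field_differentiable_def by blast
  then show ?thesis using nonzero[of n] by (simp add: log_deriv_def DERIV_deriv_iff_field_differentiable)
qed

section \<open>The five shadows and their independence\<close>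

lemma shadow_parity:
  assumes "somos5 \<alpha> \<beta> x"
  shows "somos5_shadow \<alpha> \<beta> x (\<lambda>n. if odd n then 0 else x n)" "somos5_shadow \<alpha> \<beta> x (\<lambda>n. if odd n then x n else 0)"
  using assms by (auto simp: somos5_shadow_def somos5_def algebra_simps)

text \<open>In each product of the recurrence the two indices add up to 2n + 5, so the left side is
  2n + 5 times the recurrence.\<close>

lemma shadow_index:
  assumes "somos5 \<alpha> \<beta> x"
  shows "somos5_shadow \<alpha> \<beta> x (\<lambda>n. of_int n * x n)"
  unfolding somos5_shadow_def
proof
  fix n
  have "x n * x (n + 5) = \<alpha> * x (n + 1) * x (n + 4) + \<beta> * x (n + 2) * x (n + 3)" using assms by (simp add: somos5_def)
  then have "(2 * of_int n + 5) * (x n * x (n + 5) - \<alpha> * (x (n + 1) * x (n + 4)) - \<beta> * (x (n + 2) * x (n + 3))) = 0" by simp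
  then show "x n * (of_int (n + 5) * x (n + 5)) + of_int n * x n * x (n + 5)
    - \<alpha> * (x (n + 1) * (of_int (n + 4) * x (n + 4)) + of_int (n + 1) * x (n + 1) * x (n + 4))
    - \<beta> * (x (n + 2) * (of_int (n + 3) * x (n + 3)) + of_int (n + 2) * x (n + 2) * x (n + 3)) = 0"
    by (simp add: algebra_simps)
qed

text \<open>Six terms are enough for one instance of the recurrence, and a finite set of indices
  keeps the condition open.\<close>

lemma eventually_sol_nonzero_z0: "\<forall>\<^sub>F z in nhds z0. \<forall>m\<in>{n..n+5}. sol z J0 m \<noteq> 0"
  by (intro eventually_ball_finite ballI eventually_nonzero_DERIV[OF DERIV_sol_z0 nonzero]) simp

lemma eventually_sol_nonzero_J: "\<forall>\<^sub>F J in nhds J0. admissible J \<and> (\<forall>m\<in>{n..n+5}. sol z0 J m \<noteq> 0)"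
  by (intro eventually_conj eventually_admissible eventually_ball_finite ballI eventually_nonzero_DERIV[OF DERIV_sol_J nonzero]) simp

lemma shadow_zeta: "somos5_shadow \<alpha> \<beta> (sol z0 J0) (\<lambda>n. zeta_at n * sol z0 J0 n)"
  by (rule shadow_of_family[OF DERIV_sol_z0], rule eventually_mono[OF eventually_sol_nonzero_z0], rule sol_relations(1)[OF admissible_J0]) blast

lemma shadow_dlog: "somos5_shadow \<alpha> \<beta> (sol z0 J0) (\<lambda>n. dlog n * sol z0 J0 n)"
  by (rule shadow_of_family[OF DERIV_sol_J], rule eventually_mono[OF eventually_sol_nonzero_J], rule sol_relations(1)) blast+

lemma integral_variation_zeta: "integral_variation \<alpha> J0 (sol_ratio z0 J0) zeta_at n = 0"
proof -
  have "integral_variation \<alpha> J0 (sol_ratio z0 J0) zeta_at n = 0 * sol_ratio z0 J0 n * sol_ratio z0 J0 (n + 1)"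
  proof (rule integral_variation_of_family[where X = "\<lambda>z. sol z J0" and J = "\<lambda>_. J0" and q = "\<lambda>z. sol_ratio z J0" and \<beta> = \<beta>])
    show "\<forall>\<^sub>F z in nhds z0. sol_ratio z J0 n * sol_ratio z J0 (n + 1) * (sol_ratio z J0 n + sol_ratio z J0 (n + 1)) - J0 * sol_ratio z J0 n * sol_ratio z J0 (n + 1)
       + \<alpha> * (sol_ratio z J0 n + sol_ratio z J0 (n + 1)) + \<beta> = 0"
      by (rule eventually_mono[OF eventually_sol_nonzero_z0[of n]], rule sol_relations(2)[OF admissible_J0]) blast
  qed (rule DERIV_sol_z0 nonzero DERIV_const sol_ratio_def)+
  then show ?thesis by simp
qed

lemma integral_variation_dlog:
  "integral_variation \<alpha> J0 (sol_ratio z0 J0) dlog n = sol_ratio z0 J0 n * sol_ratio z0 J0 (n + 1)"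
proof -
  have "integral_variation \<alpha> J0 (sol_ratio z0 J0) dlog n = 1 * sol_ratio z0 J0 n * sol_ratio z0 J0 (n + 1)"
  proof (rule integral_variation_of_family[where X = "\<lambda>J. sol z0 J" and J = "\<lambda>J. J" and q = "\<lambda>J. sol_ratio z0 J" and \<beta> = \<beta>])
    show "\<forall>\<^sub>F J in nhds J0. sol_ratio z0 J n * sol_ratio z0 J (n + 1) * (sol_ratio z0 J n + sol_ratio z0 J (n + 1)) - J * sol_ratio z0 J n * sol_ratio z0 J (n + 1)
       + \<alpha> * (sol_ratio z0 J n + sol_ratio z0 J (n + 1)) + \<beta> = 0"
      by (rule eventually_mono[OF eventually_sol_nonzero_J[of n]], rule sol_relations(2)) blast+
  qed (rule DERIV_sol_J nonzero DERIV_ident sol_ratio_def)+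
  then show ?thesis by simp
qed

lemma independent:
  defines "y \<equiv> sol z0 J0"
  assumes z: "\<And>n. c1 * (if odd n then 0 else y n) + c2 * (if odd n then y n else 0) + c3 * (of_int n * y n)
    + c4 * (zeta_at n * y n) + c5 * (dlog n * y n) = 0"
  shows "c1 = 0 \<and> c2 = 0 \<and> c3 = 0 \<and> c4 = 0 \<and> c5 = 0"
proof -
  have y0: "y n \<noteq> 0" for n unfolding y_def by (rule nonzero)
  have r: "(if odd n then c2 else c1) + c3 * of_int n + c4 * zeta_at n + c5 * dlog n = 0" for n
  proof -
    have "((if odd n then c2 else c1) + c3 * of_int n + c4 * zeta_at n + c5 * dlog n) * y n = 0"
      using z[of n] by (cases "odd n") (simp_all add: algebra_simps)
    then show ?thesis using y0 by simp
  qed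
  \<comment> \<open>The indices n, n + 3 and n + 1, n + 2 have the same parities and the same sum,
    so the terms with c1, c2 and c3 drop out.\<close>
  have rv: "c4 * ratio_variation zeta_at n + c5 * ratio_variation dlog n = 0" for n
  proof -
    define P where "P = (\<lambda>n::int. if odd n then c2 else c1)"
    define Z where "Z = zeta_at"
    define E where "E = dlog"
    have r': "c4 * Z m + c5 * E m = - P m - c3 * of_int m" for m
    proof -
      have "P m + c3 * of_int m + c4 * Z m + c5 * E m = 0" using r[of m] by (simp only: P_def Z_def E_def)
      then show ?thesis by algebra
    qed
    have "P n + P (n + 3) = P (n + 1) + P (n + 2)" by (simp add: P_def)
    moreover have "c4 * ratio_variation Z n + c5 * ratio_variation E n
      = (c4 * Z n + c5 * E n) + (c4 * Z (n + 3) + c5 * E (n + 3)) - (c4 * Z (n + 1) + c5 * E (n + 1)) - (c4 * Z (n + 2) + c5 * E (n + 2))"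
      by (simp add: ratio_variation_def algebra_simps)
    ultimately show ?thesis unfolding r' by (simp add: algebra_simps flip: Z_def E_def)
  qed
  \<comment> \<open>By linearity this combination is 0, while the two variations are 0 and a product
    of nonzero ratios; this isolates c5.\<close>
  have "c4 * integral_variation \<alpha> J0 (sol_ratio z0 J0) zeta_at 0 + c5 * integral_variation \<alpha> J0 (sol_ratio z0 J0) dlog 0 = 0"
    unfolding integral_variation_def using rv[of 0] rv[of "0 + 1"] by algebra
  moreover have "sol_ratio z0 J0 n \<noteq> 0" for n using nonzero by (simp add: sol_ratio_def)
  ultimately have c5: "c5 = 0" unfolding integral_variation_zeta integral_variation_dlog by simp
  have c4: "c4 = 0"
  proof (rule ccontr)
    assume c4: "c4 \<noteq> 0"
    interpret l: complex_lattice "lattice_at J0" by (rule admissible_relations(1)[OF admissible_J0])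
    have k: "kap J0 \<notin> lattice_at J0" using admissible_J0 by (simp add: admissible_def)
    have k2: "2 * kap J0 \<notin> lattice_at J0" using l.wp'_eq_0_iff[OF k] admissible_relations(2)[OF admissible_J0] by simp
    have n: "of_int n * kap J0 + z0 \<notin> lattice_at J0" for n using nonzero[of n] sol_nonzero_iff[OF admissible_J0] by simp
    show False
    proof (rule l.zeta_second_difference_not_constant[OF k k2 n, where c = "- 2 * c3 / c4"])
      fix n :: int
      have elim: "c4 * (Z' - Z) = - 2 * c3"
        if "P + c3 * N + c4 * Z + c5 * E = 0" "P + c3 * N' + c4 * Z' + c5 * E' = 0" "N' = N + 2" for P N N' Z Z' E E'
        using that c5 by algebra
      \<comment> \<open>A step of two stays in one parity class, so c1 and c2 cancel and only 2 c3
        remains.\<close>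
      have p: "(if odd (n + 2) then c2 else c1) = (if odd n then c2 else c1)" by simp
      have "c4 * (zeta_at (n + 2) - zeta_at n) = - 2 * c3"
        by (rule elim[OF r[of n] r[of "n + 2", unfolded p]]) simp
      then have "zeta_at (n + 2) - zeta_at n = - 2 * c3 / c4" using c4 by (simp add: field_simps)
      then show "lattice_zeta (lattice_at J0) (of_int (n + 2) * kap J0 + z0) - lattice_zeta (lattice_at J0) (of_int n * kap J0 + z0) = - 2 * c3 / c4"
        by (simp only: wzeta_eq add.commute)
    qed
  qed
  \<comment> \<open>With c4 = c5 = 0, the indices 0, 1 and 2 give three equations that determine the
    other coefficients.\<close>
  have "c1 = 0" "c2 + c3 = 0" "c1 + c3 * 2 = 0" using r[of 0] r[of 1] r[of 2] c4 c5 by simp_all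
  then show ?thesis using c4 c5 by simp
qed

end

theorem lemma4p1:
  fixes \<alpha> \<beta> J0 Ap Am Bm z0 :: complex
    and mut kap :: "complex \<Rightarrow> complex"
    and x :: "int \<Rightarrow> complex"
  assumes "\<beta> + \<alpha> * J0 \<noteq> 0"
    and "mut analytic_on {J0}"
    and "\<forall>\<^sub>F J in nhds J0. mut J ^ 4 = \<beta> + \<alpha> * J"
    and "nonsingular_cubic (somos5_g2 \<alpha> mut J0) (somos5_g3 \<alpha> mut J0)"
    and "kap analytic_on {J0}"
    and "\<forall>\<^sub>F J in nhds J0.
           kap J \<notin> period_lattice (somos5_g2 \<alpha> mut J) (somos5_g3 \<alpha> mut J) \<and>
           wp (somos5_g2 \<alpha> mut J) (somos5_g3 \<alpha> mut J) (kap J) = somos5_lambda \<alpha> mut J \<and>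
           deriv (wp (somos5_g2 \<alpha> mut J) (somos5_g3 \<alpha> mut J)) (kap J) = mut J"
    and "Ap \<noteq> 0" and "Am \<noteq> 0" and "Bm \<noteq> 0"
    and "\<forall>n. x n = somos5_sol Ap Am Bm z0 n (kap J0) (somos5_g2 \<alpha> mut J0) (somos5_g3 \<alpha> mut J0)"
    and "somos5 \<alpha> \<beta> x"
    and "\<forall>n. x n \<noteq> 0"
  shows "let \<kappa>0 = kap J0; g2 = somos5_g2 \<alpha> mut; g3 = somos5_g3 \<alpha> mut;
             X = somos5_sol Ap Am Bm z0;
             y1 = (\<lambda>n. if odd n then 0 else x n);
             y2 = (\<lambda>n. if odd n then x n else 0);
             y3 = (\<lambda>n. of_int n * x n);
             y4 = (\<lambda>n. wzeta (g2 J0) (g3 J0) (z0 + of_int n * \<kappa>0) * x n);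
             y5 = (\<lambda>n. x n * log_deriv (\<lambda>J. X n (kap J) (g2 J) (g3 J)) J0)
         in (\<forall>y \<in> {y1, y2, y3, y4, y5}. somos5_shadow \<alpha> \<beta> x y) \<and>
            lin_indep_seqs [y1, y2, y3, y4, y5] \<and>
            g2 field_differentiable at J0 \<and> g3 field_differentiable at J0 \<and>
            (\<forall>n. (\<lambda>J. X n (kap J) (g2 J) (g3 J)) field_differentiable at J0 \<and>
                 (\<lambda>k. X n k (g2 J0) (g3 J0)) field_differentiable at \<kappa>0 \<and>
                 (\<lambda>a. X n \<kappa>0 a (g3 J0)) field_differentiable at (g2 J0) \<and>
                 (\<lambda>b. X n \<kappa>0 (g2 J0) b) field_differentiable at (g3 J0) \<and>
                 y5 n = x n *
                   (deriv kap J0 * log_deriv (\<lambda>k. X n k (g2 J0) (g3 J0)) \<kappa>0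
                    + deriv g2 J0 * log_deriv (\<lambda>a. X n \<kappa>0 a (g3 J0)) (g2 J0)
                    + deriv g3 J0 * log_deriv (\<lambda>b. X n \<kappa>0 (g2 J0) b) (g3 J0)))"
proof -
  have x_sol: "x = (\<lambda>n. somos5_sol Ap Am Bm z0 n (kap J0) (somos5_g2 \<alpha> mut J0) (somos5_g3 \<alpha> mut J0))"
    by (rule ext) (rule assms(10)[rule_format])
  interpret f: somos5_family \<alpha> \<beta> J0 Ap Am Bm z0 mut kap
  proof
    show "somos5_sol Ap Am Bm z0 n (kap J0) (somos5_g2 \<alpha> mut J0) (somos5_g3 \<alpha> mut J0) \<noteq> 0" for n
      using assms(10,12) by metis
  qed (fact assms)+
  define y1 where "y1 = (\<lambda>n. if odd n then 0 else x n)"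
  define y2 where "y2 = (\<lambda>n. if odd n then x n else 0)"
  define y3 where "y3 = (\<lambda>n. of_int n * x n)"
  define y4 where "y4 = (\<lambda>n. f.zeta_at n * x n)"
  define y5 where "y5 = (\<lambda>n. x n * f.dlog n)"
  have y5': "y5 = (\<lambda>n. f.dlog n * x n)" by (simp add: y5_def mult.commute)
  have "somos5_shadow \<alpha> \<beta> x y1" "somos5_shadow \<alpha> \<beta> x y2" "somos5_shadow \<alpha> \<beta> x y3"
    unfolding y1_def y2_def y3_def using f.shadow_parity[OF assms(11)] f.shadow_index[OF assms(11)] by blast+
  moreover have "somos5_shadow \<alpha> \<beta> x y4" "somos5_shadow \<alpha> \<beta> x y5"
    unfolding y4_def y5' x_sol by (rule f.shadow_zeta f.shadow_dlog)+
  ultimately have shadows: "\<forall>y \<in> {y1, y2, y3, y4, y5}. somos5_shadow \<alpha> \<beta> x y" by blast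
  have indep: "lin_indep_seqs [y1, y2, y3, y4, y5]"
  proof (rule lin_indep_seqsI)
    fix c assume c: "\<And>n. (\<Sum>i<length [y1, y2, y3, y4, y5]. c i * ([y1, y2, y3, y4, y5] ! i) n) = 0"
    have "c 0 * y1 n + c 1 * y2 n + c 2 * y3 n + c 3 * y4 n + c 4 * y5 n = 0" for n
      using c[of n] by (simp add: eval_nat_numeral lessThan_Suc algebra_simps)
    then have "c 0 = 0 \<and> c 1 = 0 \<and> c 2 = 0 \<and> c 3 = 0 \<and> c 4 = 0"
      unfolding y1_def y2_def y3_def y4_def y5' x_sol by (rule f.independent)
    then show "\<forall>i<length [y1, y2, y3, y4, y5]. c i = 0"
      by (simp add: eval_nat_numeral less_Suc_eq)
  qed
  have partials: "(\<lambda>J. f.sol z0 J n) field_differentiable at J0 \<and>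
      (\<lambda>k. somos5_sol Ap Am Bm z0 n k (f.g2 J0) (f.g3 J0)) field_differentiable at (kap J0) \<and>
      (\<lambda>a. somos5_sol Ap Am Bm z0 n (kap J0) a (f.g3 J0)) field_differentiable at (f.g2 J0) \<and>
      (\<lambda>b. somos5_sol Ap Am Bm z0 n (kap J0) (f.g2 J0) b) field_differentiable at (f.g3 J0) \<and>
      y5 n = x n * (deriv kap J0 * log_deriv (\<lambda>k. somos5_sol Ap Am Bm z0 n k (f.g2 J0) (f.g3 J0)) (kap J0)
        + deriv f.g2 J0 * log_deriv (\<lambda>a. somos5_sol Ap Am Bm z0 n (kap J0) a (f.g3 J0)) (f.g2 J0)
        + deriv f.g3 J0 * log_deriv (\<lambda>b. somos5_sol Ap Am Bm z0 n (kap J0) (f.g2 J0) b) (f.g3 J0))" for n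
  proof -
    obtain A B C where D:
      "((\<lambda>J. f.sol z0 J n) has_field_derivative A * deriv kap J0 + B * deriv f.g2 J0 + C * deriv f.g3 J0) (at J0)"
      "((\<lambda>k. somos5_sol Ap Am Bm z0 n k (f.g2 J0) (f.g3 J0)) has_field_derivative A) (at (kap J0))"
      "((\<lambda>a. somos5_sol Ap Am Bm z0 n (kap J0) a (f.g3 J0)) has_field_derivative B) (at (f.g2 J0))"
      "((\<lambda>b. somos5_sol Ap Am Bm z0 n (kap J0) (f.g2 J0) b) has_field_derivative C) (at (f.g3 J0))"
      by (rule f.sol_partials)
    have "y5 n = x n * (deriv kap J0 * log_deriv (\<lambda>k. somos5_sol Ap Am Bm z0 n k (f.g2 J0) (f.g3 J0)) (kap J0)
        + deriv f.g2 J0 * log_deriv (\<lambda>a. somos5_sol Ap Am Bm z0 n (kap J0) a (f.g3 J0)) (f.g2 J0)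
        + deriv f.g3 J0 * log_deriv (\<lambda>b. somos5_sol Ap Am Bm z0 n (kap J0) (f.g2 J0) b) (f.g3 J0))"
      unfolding y5_def log_deriv_def D[THEN DERIV_imp_deriv] by (simp add: add_divide_distrib mult.commute)
    with D show ?thesis unfolding field_differentiable_def by blast
  qed
  show ?thesis
    unfolding Let_def
    using shadows[unfolded y1_def y2_def y3_def y4_def y5_def] indep[unfolded y1_def y2_def y3_def y4_def y5_def]
      f.differentiable_g2 f.differentiable_g3 partials[unfolded y5_def]
    by (intro conjI allI) blast+
qed

end
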